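(* With respect to convergence in $L^2(\Omega)$, the functionals $\mathcal F^{\varepsilon}:\mathcal A(L)\to\mathbb R\cup\{+\infty\}$ $\Gamma$-converge as $\varepsilon\to0$ to $$\mathcal F_0(y):=\int_\Omega W(Dy)+f\,\big(y-L(x+\tfrac12)\big)\,dx,\qquad y\in\mathcal A(L).$$ That is: (i) whenever $y^\varepsilon,y\in\mathcal A(L)$ and $y^\varepsilon\to y$ in $L^2(\Omega)$, $\liminf_{\varepsilon\to0}\mathcal F^\varepsilon(y^\varepsilon)\ge\mathcal F_0(y)$; and (ii) for every $y\in\mathcal A(L)$ there are $y^\varepsilon\in\mathcal A(L)$ with $y^\varepsilon\to y$ in $L^2(\Omega)$ and $\limsup_{\varepsilon\to0}\mathcal F^\varepsilon(y^\varepsilon)\le\mathcal F_0(y)$.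
   Context: Reference domain. Let $L>0$ and $\Omega=[-\frac12,\frac12]$. For $N\in\mathbb N$ put $\varepsilon=1/(2N)$ and $x_i=i\varepsilon$; $\varepsilon\to0$ means $N\to\infty$, and families indexed by $\varepsilon$ are sequences indexed by $N$. Let $\mathcal A(L)=\{y\in H^1(\Omega):y(-\frac12)=0,\ y(\frac12)=L\}$ and let $\mathcal A^\varepsilon(L)\subset\mathcal A(L)$ be the functions in $\mathcal A(L)$ that are affine on each $(x_i,x_{i+1})$, $i\in\{-N,\dots,N-1\}$. For $y\in\mathcal A^\varepsilon(L)$ write $y_i=y(x_i)$, extended to all $i\in\mathbb Z$ by $y_{2kN+i+1}-y_{2kN+i}=y_{i+1}-y_i$ ($k\in\mathbb Z$), $D_jy_i=\frac{y_{i+j}-y_i}{j\varepsilon}$, and $u_i=y_i-L(x_i+\frac12)$. Potentials. $\phi_1,\phi_2$ (pure) and $\psi_1,\psi_2$ (defect) are $C^2$ on $(0,\infty)$ and satisfy, for some $l>0$, $\alpha\in(0,1)$, $C\in\mathbb R$: (1) $\phi_1(t)=\psi_1(t)=+\infty$ for $t\le0$, and $\phi_1(t),\psi_1(t)\to+\infty$ as $t\searrow0$; (2) $\phi_1''(t),\psi_1''(t)\ge l$ for all $t>0$; (3) $\phi_2,\psi_2$ are concave on $(0,\infty)$; (4) for $x>0$: $\phi_2(x)\ge-\alpha\phi_1(x)+C$, $\phi_2(x)\ge-\alpha\psi_1(x)+C$, $\psi_2(x)\ge-\alpha\phi_1(x)+C$, $\psi_2(x)\ge-\alpha\psi_1(x)+C$;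 (5) $W:=\phi_1+\phi_2$ satisfies $W''(t)\ge l$ for all $t>0$ (and $W(t)=+\infty$ for $t\le0$). The force is $f\in C^2(\Omega)$, with $f_i=f(x_i)$. Energies. For $y\in\mathcal A^\varepsilon(L)$, $E^\varepsilon_{p}(y)=\sum_{i=-N}^{N-1}\big(\phi_1(D_1y_i)+\phi_2(D_2y_i)\big)$, $E_d(y)=\psi_2(D_2y_{-2})-\phi_2(D_2y_{-2})+\psi_1(D_1y_{-1})-\phi_1(D_1y_{-1})+\psi_1(D_1y_0)-\phi_1(D_1y_0)+\psi_2(D_2y_0)-\phi_2(D_2y_0)$, $E^\varepsilon_f(y)=\sum_{i=-N}^{N-1}f_iu_i$, and $E^\varepsilon=E^\varepsilon_p+E_d+E^\varepsilon_f$, with $E^\varepsilon(y):=+\infty$ if $D_1y_i\le0$ for some $i$. Define $\mathcal F^\varepsilon:\mathcal A(L)\to\mathbb R\cup\{+\infty\}$ by $\mathcal F^\varepsilon(y)=\varepsilon E^\varepsilon(y)$ if $y\in\mathcal A^\varepsilon(L)$ and $\mathcal F^\varepsilon(y)=+\infty$ otherwise. *)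

theory Defs
  imports "HOL-Analysis.Analysis"
begin

section \<open>The Sobolev space on the reference interval\<close>

definition Omega :: "real set" where
  "Omega = {-1/2..1/2}"

definition L2_Omega :: "(real \<Rightarrow> real) set" where
  "L2_Omega = {g. g \<in> borel_measurable (lebesgue_on Omega) \<and>
                  integrable (lebesgue_on Omega) (\<lambda>x. (g x)\<^sup>2)}"

definition test_functions :: "(real \<Rightarrow> real) set" where
  "test_functions = {\<eta>. (\<forall>n x. (deriv ^^ n) \<eta> differentiable at x) \<and>
     (\<exists>K. compact K \<and> K \<subseteq> interior Omega \<and> (\<forall>x. x \<notin> K \<longrightarrow> \<eta> x = 0))}"

definition has_weak_deriv :: "(real \<Rightarrow> real) \<Rightarrow> (real \<Rightarrow> real) \<Rightarrow> bool" where
  "has_weak_deriv y g \<longleftrightarrow>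
     (\<forall>\<eta>\<in>test_functions.
        (LINT x|lebesgue_on Omega. y x * deriv \<eta> x) = - (LINT x|lebesgue_on Omega. g x * \<eta> x))"

text \<open>An element of the Sobolev space is represented by its continuous representative, so that
  point evaluation makes sense; values outside the interval are irrelevant.\<close>

definition H1_Omega :: "(real \<Rightarrow> real) set" where
  "H1_Omega = {y. continuous_on Omega y \<and> y \<in> L2_Omega \<and> (\<exists>g\<in>L2_Omega. has_weak_deriv y g)}"

text \<open>The weak derivative is unique up to null sets; any version of it may be chosen.\<close>

definition weak_deriv :: "(real \<Rightarrow> real) \<Rightarrow> real \<Rightarrow> real" where
  "weak_deriv y = (SOME g. g \<in> L2_Omega \<and> has_weak_deriv y g)"

definition L2_converges :: "(nat \<Rightarrow> real \<Rightarrow> real) \<Rightarrow> (real \<Rightarrow> real) \<Rightarrow> bool" where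
  "L2_converges ys y \<longleftrightarrow>
     (\<lambda>N. sqrt (LINT x|lebesgue_on Omega. (ys N x - y x)\<^sup>2)) \<longlonglongrightarrow> 0"

definition admissible :: "real \<Rightarrow> (real \<Rightarrow> real) set" where
  "admissible L = {y \<in> H1_Omega. y (-1/2) = 0 \<and> y (1/2) = L}"


section \<open>Lattice functions\<close>

definition eps :: "nat \<Rightarrow> real" where
  "eps N = 1 / (2 * real N)"

definition grid :: "nat \<Rightarrow> int \<Rightarrow> real" where
  "grid N i = real_of_int i * eps N"

definition admissible_eps :: "nat \<Rightarrow> real \<Rightarrow> (real \<Rightarrow> real) set" where
  "admissible_eps N L = {y \<in> admissible L.
     \<forall>i\<in>{- int N..int N - 1}. \<exists>a b. \<forall>x\<in>{grid N i<..<grid N (i + 1)}. y x = a * x + b}"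

text \<open>The nodal values, extended to all integers. The two lemmas that follow
  characterize the closed form as the extension with periodic increments.\<close>

definition node :: "nat \<Rightarrow> (real \<Rightarrow> real) \<Rightarrow> int \<Rightarrow> real" where
  "node N y i = y (grid N ((i + int N) mod (2 * int N) - int N))
     + real_of_int ((i + int N) div (2 * int N)) * (y (1/2) - y (-1/2))"

lemma node_eq:
  assumes "N > 0" "i \<in> {- int N..int N}"
  shows "node N y i = y (grid N i)"
proof (cases "i = int N")
  case True
  have a: "(i + int N) mod (2 * int N) = 0" and b: "(i + int N) div (2 * int N) = 1"
    using True assms by (simp_all add: mult_2[symmetric])
  have "grid N (- int N) = -1/2" and g: "grid N i = 1/2"
    using assms True by (simp_all add: grid_def eps_def)
  then show ?thesis unfolding node_def a b g by simp
next
  case False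
  then have "(i + int N) mod (2 * int N) = i + int N" "(i + int N) div (2 * int N) = 0"
    using assms by auto
  then show ?thesis by (simp add: node_def)
qed

lemma node_periodic_increment:
  assumes "N > 0"
  shows "node N y (2 * k * int N + i + 1) - node N y (2 * k * int N + i)
         = node N y (i + 1) - node N y i"
proof -
  have shift: "node N y (2 * k * int N + j) = node N y j + real_of_int k * (y (1/2) - y (-1/2))" for j
  proof -
    have e: "2 * k * int N + j + int N = (j + int N) + k * (2 * int N)"
      by (simp add: algebra_simps)
    have "(2 * k * int N + j + int N) mod (2 * int N) = (j + int N) mod (2 * int N)"
      unfolding e by (rule mod_mult_self1)
    moreover have "(2 * k * int N + j + int N) div (2 * int N) = (j + int N) div (2 * int N) + k"
      unfolding e using assms by (subst div_mult_self1) auto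
    ultimately show ?thesis by (simp add: node_def algebra_simps)
  qed
  show ?thesis using shift[of "i + 1"] shift[of i] by (simp add: add.assoc)
qed

definition diffq :: "nat \<Rightarrow> (real \<Rightarrow> real) \<Rightarrow> int \<Rightarrow> int \<Rightarrow> real" where
  "diffq N y j i = (node N y (i + j) - node N y i) / (real_of_int j * eps N)"


section \<open>Potentials and energies\<close>

text \<open>On a set with boundary the derivatives are one-sided at the boundary points.\<close>

definition C2_on :: "real set \<Rightarrow> (real \<Rightarrow> real) \<Rightarrow> bool" where
  "C2_on S g \<longleftrightarrow> (\<exists>g' g''.
     (\<forall>x\<in>S. (g has_real_derivative g' x) (at x within S)) \<and>
     (\<forall>x\<in>S. (g' has_real_derivative g'' x) (at x within S)) \<and>
     continuous_on S g'')"

text \<open>Nearest neighbour potentials are extended-real valued on the whole line. Next-to-nearest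
  neighbour potentials are only ever relevant on the positive half line and are kept real valued.\<close>

definition cauchy_born :: "(real \<Rightarrow> ereal) \<Rightarrow> (real \<Rightarrow> real) \<Rightarrow> real \<Rightarrow> ereal" where
  "cauchy_born \<phi>1 \<phi>2 t = \<phi>1 t + ereal (\<phi>2 t)"

definition energy_pure :: "(real \<Rightarrow> ereal) \<Rightarrow> (real \<Rightarrow> real) \<Rightarrow> nat \<Rightarrow> (real \<Rightarrow> real) \<Rightarrow> ereal" where
  "energy_pure \<phi>1 \<phi>2 N y =
     (\<Sum>i\<in>{- int N..int N - 1}. \<phi>1 (diffq N y 1 i) + ereal (\<phi>2 (diffq N y 2 i)))"

definition energy_defect ::
  "(real \<Rightarrow> ereal) \<Rightarrow> (real \<Rightarrow> real) \<Rightarrow> (real \<Rightarrow> ereal) \<Rightarrow> (real \<Rightarrow> real) \<Rightarrow>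
   nat \<Rightarrow> (real \<Rightarrow> real) \<Rightarrow> ereal" where
  "energy_defect \<phi>1 \<phi>2 \<psi>1 \<psi>2 N y =
     ereal (\<psi>2 (diffq N y 2 (-2))) - ereal (\<phi>2 (diffq N y 2 (-2)))
     + \<psi>1 (diffq N y 1 (-1)) - \<phi>1 (diffq N y 1 (-1))
     + \<psi>1 (diffq N y 1 0) - \<phi>1 (diffq N y 1 0)
     + ereal (\<psi>2 (diffq N y 2 0)) - ereal (\<phi>2 (diffq N y 2 0))"

definition energy_force :: "real \<Rightarrow> (real \<Rightarrow> real) \<Rightarrow> nat \<Rightarrow> (real \<Rightarrow> real) \<Rightarrow> real" where
  "energy_force L f N y =
     (\<Sum>i\<in>{- int N..int N - 1}. f (grid N i) * (node N y i - L * (grid N i + 1/2)))"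

definition energy ::
  "real \<Rightarrow> (real \<Rightarrow> ereal) \<Rightarrow> (real \<Rightarrow> real) \<Rightarrow> (real \<Rightarrow> ereal) \<Rightarrow> (real \<Rightarrow> real) \<Rightarrow>
   (real \<Rightarrow> real) \<Rightarrow> nat \<Rightarrow> (real \<Rightarrow> real) \<Rightarrow> ereal" where
  "energy L \<phi>1 \<phi>2 \<psi>1 \<psi>2 f N y =
     (if \<exists>i. diffq N y 1 i \<le> 0 then \<infinity>
      else energy_pure \<phi>1 \<phi>2 N y + energy_defect \<phi>1 \<phi>2 \<psi>1 \<psi>2 N y + ereal (energy_force L f N y))"

definition discrete_functional ::
  "real \<Rightarrow> (real \<Rightarrow> ereal) \<Rightarrow> (real \<Rightarrow> real) \<Rightarrow> (real \<Rightarrow> ereal) \<Rightarrow> (real \<Rightarrow> real) \<Rightarrow>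
   (real \<Rightarrow> real) \<Rightarrow> nat \<Rightarrow> (real \<Rightarrow> real) \<Rightarrow> ereal" where
  "discrete_functional L \<phi>1 \<phi>2 \<psi>1 \<psi>2 f N y =
     (if y \<in> admissible_eps N L then ereal (eps N) * energy L \<phi>1 \<phi>2 \<psi>1 \<psi>2 f N y else \<infinity>)"

text \<open>Lebesgue integral of an extended-real function as positive part minus negative part
  (\<^const>\<open>e2ennreal\<close> truncates at zero). This is the usual integral as soon as one of the
  two parts is finite, which holds for the limit functional since its integrand is bounded below.\<close>

definition ereal_integral :: "'a measure \<Rightarrow> ('a \<Rightarrow> ereal) \<Rightarrow> ereal" where
  "ereal_integral M h =
     enn2ereal (\<integral>\<^sup>+ x. e2ennreal (h x) \<partial>M) - enn2ereal (\<integral>\<^sup>+ x. e2ennreal (- h x) \<partial>M)"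

definition limit_functional ::
  "real \<Rightarrow> (real \<Rightarrow> ereal) \<Rightarrow> (real \<Rightarrow> real) \<Rightarrow> (real \<Rightarrow> real) \<Rightarrow> (real \<Rightarrow> real) \<Rightarrow> ereal" where
  "limit_functional L \<phi>1 \<phi>2 f y =
     ereal_integral (lebesgue_on Omega)
       (\<lambda>x. cauchy_born \<phi>1 \<phi>2 (weak_deriv y x) + ereal (f x * (y x - L * (x + 1/2))))"


section \<open>Gamma-convergence\<close>

definition gamma_converges ::
  "'a set \<Rightarrow> ((nat \<Rightarrow> 'a) \<Rightarrow> 'a \<Rightarrow> bool) \<Rightarrow> (nat \<Rightarrow> 'a \<Rightarrow> ereal) \<Rightarrow> ('a \<Rightarrow> ereal) \<Rightarrow> bool" where
  "gamma_converges X conv F F0 \<longleftrightarrow>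
     (\<forall>ys y. (\<forall>N. ys N \<in> X) \<and> y \<in> X \<and> conv ys y \<longrightarrow> F0 y \<le> liminf (\<lambda>N. F N (ys N))) \<and>
     (\<forall>y\<in>X. \<exists>ys. (\<forall>N. ys N \<in> X) \<and> conv ys y \<and> limsup (\<lambda>N. F N (ys N)) \<le> F0 y)"

end

theory Submission
  imports Defs
begin

text \<open>Write \<open>p\<^sub>i\<close> for the slopes of a lattice function, so that the second difference quotients are
  means of adjacent slopes.

  Lower bound: concavity of the next-to-nearest neighbour potentials bounds the discrete energy below
  by the sum of \<open>W (p\<^sub>i)\<close>, up to four defect slopes where quadratic growth absorbs any affine
  function. Functions of finite energy are increasing, hence convergence in \<open>L\<^sup>2\<close> is uniform, and
  testing with tangent lines of \<open>W\<close> on a fixed coarse grid gives the limit as the lattice is refined.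
  As the coarse grid is refined, the coarse slopes converge almost everywhere to the weak derivative,
  and Fatou's lemma concludes.

  Recovery sequence: make the limit affine near the defect, where the energy then stays bounded, and
  interpolate it. Jensen's inequality controls \<open>\<phi>1\<close> and Fatou's lemma, applied to an affine majorant
  minus \<open>\<phi>2\<close>, controls \<open>\<phi>2\<close>. A diagonal argument lets the affine region shrink.\<close>

section \<open>Smooth compactly supported functions\<close>

text \<open>The weak derivative is an arbitrary version characterised only by test functions,
  whereas the lattice energies see difference quotients of the continuous representative. Explicit
  bump functions, closed under differentiation, turn the weak formulation into the integral formula
  \<open>weak_deriv_has_integral\<close>; Lebesgue differentiation then yields convergence of
  slopes. Tangent lines are the right minorants because an affine function of the slopes telescopes:
  its sum over a block of cells depends only on two nodal values, which converge uniformly. At the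
  four exceptional slopes it costs a constant times \<open>eps N\<close>. As the limit potential is
  infinite on the left half line, tangents are taken only at points at least 1/M. In the upper bound
  Jensen's inequality has the wrong sign for the concave \<phi>2, hence Fatou's lemma. Nothing is
  lost in the affine majorant, since the mean of the second difference quotients is exactly the
  total increment of the limit.\<close>

lemma power_over_fact_le_exp:
  fixes x :: real
  assumes "x \<ge> 0"
  shows "x ^ n / fact n \<le> exp x"
proof -
  obtain t where t: "exp x = (\<Sum>m<Suc n. x ^ m / fact m) + exp t / fact (Suc n) * x ^ Suc n"
    using Maclaurin_exp_le[of x "Suc n"] by blast
  have "x ^ n / fact n \<le> (\<Sum>m<Suc n. x ^ m / fact m)"
    using assms by (intro member_le_sum) auto
  also have "\<dots> \<le> exp x"
    unfolding t using assms by simp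
  finally show ?thesis .
qed

text \<open>For \<open>k = 0\<close> and \<open>p = 1\<close> this is the standard smooth bump on
  (0, 1). The polynomial and the power in the denominator are carried along because the enlarged
  family is closed under differentiation.\<close>

definition bump :: "nat \<Rightarrow> real poly \<Rightarrow> real \<Rightarrow> real" where
  "bump k p x = (if 0 < x \<and> x < 1 then poly p x / (x * (1 - x)) ^ k * exp (- 1 / (x * (1 - x))) else 0)"

lemma bump_outside: "x \<le> 0 \<or> 1 \<le> x \<Longrightarrow> bump k p x = 0"
  by (auto simp: bump_def)

text \<open>The exponential beats every power of \<open>1 / (x * (1 - x))\<close>, so the function
  vanishes to second order at both end points. This is what permits differentiation across
  them.\<close>

lemma bump_bound:
  obtains D where "\<And>x. \<bar>bump k p x\<bar> \<le> D * x\<^sup>2" "\<And>x. \<bar>bump k p x\<bar> \<le> D * (x - 1)\<^sup>2"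
proof -
  have "compact (poly p ` {0..1})"
    by (intro compact_continuous_image continuous_intros) auto
  then obtain B where B: "\<And>x. x \<in> {0..1} \<Longrightarrow> \<bar>poly p x\<bar> \<le> B"
    by (metis (no_types, opaque_lifting) bounded_iff compact_imp_bounded imageI real_norm_def)
  have B0: "B \<ge> 0" using B[of 0] by force
  define D where "D = B * fact (k + 2)"
  have D0: "D \<ge> 0" unfolding D_def using B0 by simp
  have main: "\<bar>bump k p x\<bar> \<le> D * (x * (1 - x))\<^sup>2" if x: "0 < x" "x < 1" for x
  proof -
    define b where "b = x * (1 - x)"
    have b: "b > 0" unfolding b_def using x by simp
    \<comment> \<open>Of the \<open>k + 2\<close> powers, \<open>k\<close> absorb the denominator of
      \<open>bump\<close> and two remain for the quadratic decay.\<close>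
    have "(1 / b) ^ (k + 2) / fact (k + 2) \<le> exp (1 / b)"
      using b by (intro power_over_fact_le_exp) auto
    then have "exp (- 1 / b) \<le> fact (k + 2) * b ^ (k + 2)"
      using b by (simp add: exp_minus field_simps power_divide del: fact_Suc)
    then have e: "exp (- 1 / b) / b ^ k \<le> fact (k + 2) * b\<^sup>2"
      using b by (simp add: field_simps power_add power2_eq_square del: fact_Suc)
    have "\<bar>bump k p x\<bar> = \<bar>poly p x\<bar> * (exp (- 1 / b) / b ^ k)"
      using x b by (simp add: bump_def abs_mult b_def[symmetric])
    also have "\<dots> \<le> B * (fact (k + 2) * b\<^sup>2)"
      using B[of x] x B0 b e by (intro mult_mono) auto
    finally show ?thesis by (simp add: D_def b_def)
  qed
  have 1: "\<bar>bump k p x\<bar> \<le> D * x\<^sup>2" for x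
  proof (cases "0 < x \<and> x < 1")
    case True
    have "(x * (1 - x))\<^sup>2 \<le> (x * 1)\<^sup>2"
      using True by (intro power_mono mult_left_mono) auto
    then show ?thesis using main[of x] True D0 by (smt (verit) mult_left_mono mult.right_neutral)
  next
    case False
    then show ?thesis using D0 by (auto simp: bump_def)
  qed
  have 2: "\<bar>bump k p x\<bar> \<le> D * (x - 1)\<^sup>2" for x
  proof (cases "0 < x \<and> x < 1")
    case True
    have "(x * (1 - x))\<^sup>2 \<le> (1 * (1 - x))\<^sup>2"
      using True by (intro power_mono mult_right_mono) auto
    also have "\<dots> = (x - 1)\<^sup>2"
      by (simp add: power2_commute)
    finally show ?thesis using main[of x] True D0 by (smt (verit) mult_left_mono)
  next
    case False
    then show ?thesis using D0 by (auto simp: bump_def)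
  qed
  show thesis using that 1 2 by blast
qed

lemma has_real_derivative_0_if_quadratic:
  fixes f :: "real \<Rightarrow> real"
  assumes "f x = 0" and "\<And>z. \<bar>f z\<bar> \<le> D * (z - x)\<^sup>2"
  shows "(f has_real_derivative 0) (at x)"
proof -
  have "((\<lambda>z. (f z - f x) / (z - x)) \<longlongrightarrow> 0) (at x)"
  proof (rule tendsto_rabs_zero_cancel, rule tendsto_sandwich)
    show "\<forall>\<^sub>F z in at x. 0 \<le> \<bar>(f z - f x) / (z - x)\<bar>" by simp
    show "\<forall>\<^sub>F z in at x. \<bar>(f z - f x) / (z - x)\<bar> \<le> D * \<bar>z - x\<bar>"
    proof (rule eventually_at_filter[THEN iffD2], intro always_eventually allI impI)
      fix z assume "z \<noteq> x"
      then show "\<bar>(f z - f x) / (z - x)\<bar> \<le> D * \<bar>z - x\<bar>"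
        using assms(2)[of z] assms(1)
        by (simp add: abs_divide divide_le_eq power2_eq_square mult.assoc flip: abs_mult)
    qed
    show "((\<lambda>z. 0) \<longlongrightarrow> (0::real)) (at x)" by simp
    show "((\<lambda>z. D * \<bar>z - x\<bar>) \<longlongrightarrow> 0) (at x)"
      by (auto intro!: tendsto_eq_intros)
  qed
  then show ?thesis by (simp add: has_field_derivative_iff)
qed

text \<open>Write b = x (1 - x), with coefficients \<open>[:0, 1, -1:]\<close>, and b' = 1 - 2 x.
  This is the numerator of the derivative over the denominator b^(k + 2); its three terms come from
  differentiating \<open>p\<close>, the power b^(-k), and exp (-1 / b), whose logarithmic derivative
  is b' / b^2.\<close>

definition bump_deriv_poly :: "nat \<Rightarrow> real poly \<Rightarrow> real poly" where
  "bump_deriv_poly k p = pderiv p * [:0, 1, -1:]\<^sup>2 - smult (real k) (p * [:1, -2:] * [:0, 1, -1:]) + p * [:1, -2:]"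

text \<open>Inside (0, 1) this is the product rule. At 0 and 1 the quadratic bound forces the
  derivative 0, the value of \<open>bump\<close> there.\<close>

lemma bump_has_derivative:
  "(bump k p has_real_derivative bump (k + 2) (bump_deriv_poly k p) x) (at x)"
proof -
  obtain D where D: "\<And>x. \<bar>bump k p x\<bar> \<le> D * x\<^sup>2" "\<And>x. \<bar>bump k p x\<bar> \<le> D * (x - 1)\<^sup>2"
    using bump_bound[of k p] by metis
  consider "0 < x" "x < 1" | "x < 0" | "x = 0" | "x = 1" | "1 < x" by linarith
  then show ?thesis
  proof cases
    case 1
    define b where "b = x * (1 - x)"
    have b: "b > 0" unfolding b_def using 1 by simp
    have b1: "((\<lambda>x. x * (1 - x)) has_real_derivative (1 - 2 * x)) (at x)"
      by (auto intro!: derivative_eq_intros simp: algebra_simps)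
    have "((\<lambda>x. - 1 / (x * (1 - x))) has_real_derivative (1 - 2 * x) / b\<^sup>2) (at x)"
      using b unfolding b_def
      by (auto intro!: derivative_eq_intros b1 simp: power2_eq_square) (metis minus_diff_eq minus_divide_left)
    then have e1: "((\<lambda>x. exp (- 1 / (x * (1 - x)))) has_real_derivative exp (- 1 / b) * ((1 - 2 * x) / b\<^sup>2)) (at x)"
      unfolding b_def by (rule DERIV_fun_exp)
    have k1: "((\<lambda>x. inverse (x * (1 - x)) ^ k) has_real_derivative - real k * (1 - 2 * x) / b ^ (k + 1)) (at x)"
    proof (cases k)
      case (Suc j)
      have "((\<lambda>x. inverse (x * (1 - x))) has_real_derivative - ((1 - 2 * x) / b\<^sup>2)) (at x)"
        using b unfolding b_def by (intro DERIV_cong[OF DERIV_inverse_fun[OF b1]]) (auto simp: power2_eq_square divide_inverse)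
      from DERIV_power[OF this, of k] show ?thesis
        by (rule DERIV_cong) (use b in \<open>simp add: Suc b_def[symmetric] field_simps power2_eq_square power_inverse\<close>)
    qed simp
    have "((\<lambda>x. poly p x * inverse (x * (1 - x)) ^ k * exp (- 1 / (x * (1 - x)))) has_real_derivative
        bump (k + 2) (bump_deriv_poly k p) x) (at x)"
    proof (rule DERIV_cong[OF DERIV_mult[OF DERIV_mult[OF poly_DERIV k1] e1]])
      have q: "poly (bump_deriv_poly k p) x =
          poly (pderiv p) x * b\<^sup>2 - real k * (poly p x * (1 - 2 * x) * b) + poly p x * (1 - 2 * x)"
        by (simp add: bump_deriv_poly_def b_def algebra_simps)
      show "(poly (pderiv p) x * inverse (x * (1 - x)) ^ k + - real k * (1 - 2 * x) / b ^ (k + 1) * poly p x) * exp (- 1 / (x * (1 - x))) +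
          exp (- 1 / b) * ((1 - 2 * x) / b\<^sup>2) * (poly p x * inverse (x * (1 - x)) ^ k) = bump (k + 2) (bump_deriv_poly k p) x"
        using 1 b unfolding bump_def q b_def[symmetric]
        by (simp add: field_simps power2_eq_square power_add power_inverse)
    qed
    then show ?thesis
      by (rule has_field_derivative_transform_within_open[where S = "{0<..<1}"])
        (use 1 in \<open>auto simp: bump_def field_simps power_inverse\<close>)
  next
    case 2
    have "((\<lambda>x. 0) has_real_derivative 0) (at x)" by simp
    then show ?thesis
      by (rule has_field_derivative_transform_within_open[where S = "{..<0}", THEN DERIV_cong])
        (use 2 in \<open>auto simp: bump_def\<close>)
  next
    case 5
    have "((\<lambda>x. 0) has_real_derivative 0) (at x)" by simp
    then show ?thesis
      by (rule has_field_derivative_transform_within_open[where S = "{1<..}", THEN DERIV_cong])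
        (use 5 in \<open>auto simp: bump_def\<close>)
  next
    case 3
    then show ?thesis
      using has_real_derivative_0_if_quadratic[of "bump k p" 0 D] D by (simp add: bump_outside)
  next
    case 4
    then show ?thesis
      using has_real_derivative_0_if_quadratic[of "bump k p" 1 D] D by (simp add: bump_outside)
  qed
qed

definition smooth :: "(real \<Rightarrow> real) \<Rightarrow> bool" where
  "smooth f \<longleftrightarrow> (\<forall>n x. (deriv ^^ n) f differentiable at x)"

text \<open>Smoothness without a formula for higher derivatives: all iterated derivatives stay
  inside a family that is closed under differentiation.\<close>

lemma deriv_closed_imp_smooth:
  assumes "f \<in> F" and "\<And>f. f \<in> F \<Longrightarrow> \<exists>f'\<in>F. \<forall>x. (f has_real_derivative f' x) (at x)"
  shows "smooth f"
proof -
  have "(deriv ^^ n) f \<in> F" for n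
  proof (induction n)
    case (Suc n)
    then obtain f' where "f' \<in> F" "\<forall>x. ((deriv ^^ n) f has_real_derivative f' x) (at x)"
      using assms(2) by blast
    then have "deriv ((deriv ^^ n) f) = f'" using DERIV_imp_deriv by blast
    then show ?case using \<open>f' \<in> F\<close> by simp
  qed (use assms in simp)
  then show ?thesis
    unfolding smooth_def using assms(2) real_differentiable_def by blast
qed

text \<open>An antiderivative is unique up to a constant, and the approximations below use only
  differences of values. Its total rise is not normalised to 1, which explains the factor
  \<open>smooth_step 1 - smooth_step 0\<close> below.\<close>

definition smooth_step :: "real \<Rightarrow> real" where
  "smooth_step = (SOME S. (\<forall>x. (S has_real_derivative bump 0 1 x) (at x)))"

lemma smooth_step_deriv: "(smooth_step has_real_derivative bump 0 1 x) (at x)"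
proof -
  have "isCont (bump 0 1) x" for x
    using bump_has_derivative DERIV_isCont by blast
  then obtain F where "\<And>x. (F has_vector_derivative bump 0 1 x) (at x)"
    using einterval_antiderivative[of "-\<infinity>" "\<infinity>" "bump 0 1"] by auto
  then have "\<exists>S. \<forall>x. (S has_real_derivative bump 0 1 x) (at x)"
    using has_real_derivative_iff_has_vector_derivative by blast
  from someI_ex[OF this] show ?thesis unfolding smooth_step_def by blast
qed

lemma smooth_step_const:
  "x \<le> 0 \<Longrightarrow> smooth_step x = smooth_step 0"
  "x \<ge> 1 \<Longrightarrow> smooth_step x = smooth_step 1"
proof -
  assume "x \<le> 0"
  then show "smooth_step x = smooth_step 0"
    using DERIV_isconst2[of x 0 smooth_step x] DERIV_isconst_end[of x 0 smooth_step]
      smooth_step_deriv bump_outside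
    by (metis DERIV_isCont continuous_at_imp_continuous_on less_eq_real_def)
next
  assume "x \<ge> 1"
  then show "smooth_step x = smooth_step 1"
    using DERIV_isconst_end[of 1 x smooth_step] smooth_step_deriv bump_outside
    by (metis DERIV_isCont continuous_at_imp_continuous_on less_eq_real_def)
qed

lemma bump_nonneg: "bump 0 1 x \<ge> 0"
  by (simp add: bump_def)

lemma smooth_step_mono: "x \<le> y \<Longrightarrow> smooth_step x \<le> smooth_step y"
  by (rule DERIV_nonneg_imp_nondecreasing) (use smooth_step_deriv bump_nonneg in blast)+

lemma smooth_step_less: "smooth_step 0 < smooth_step 1"
  by (rule DERIV_pos_imp_increasing_open)
    (auto intro!: exI smooth_step_deriv continuous_at_imp_continuous_on DERIV_isCont, auto simp: bump_def)

section \<open>Weak derivatives\<close>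

abbreviation "\<mu> \<equiv> lebesgue_on Omega"

lemma Omega_measurable [measurable, simp]: "Omega \<in> sets lebesgue"
  by (simp add: Omega_def)

lemma emeasure_Omega: "emeasure \<mu> Omega = 1"
  by (simp add: emeasure_restrict_space Omega_def)

lemma space_Omega [simp]: "space \<mu> = Omega"
  by simp

lemma finite_measure_Omega: "finite_measure \<mu>"
  by (rule finite_measureI) (simp add: emeasure_Omega)

lemma continuous_integrable_Omega:
  fixes h :: "real \<Rightarrow> real"
  assumes "continuous_on Omega h"
  shows "integrable \<mu> h"
  using continuous_imp_integrable_real[of "-1/2" "1/2" h] assms by (simp add: Omega_def)

lemma continuous_measurable_Omega:
  fixes h :: "real \<Rightarrow> real"
  assumes "continuous_on Omega h"
  shows "h \<in> borel_measurable \<mu>"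
  using continuous_integrable_Omega[OF assms] by auto

lemma continuous_bounded_Omega:
  fixes h :: "real \<Rightarrow> real"
  assumes "continuous_on Omega h"
  obtains B where "B \<ge> 0" "\<And>x. x \<in> Omega \<Longrightarrow> \<bar>h x\<bar> \<le> B"
proof -
  have "compact Omega" "0 \<in> Omega" by (simp_all add: Omega_def)
  then obtain B where B: "\<forall>x\<in>Omega. \<bar>h x\<bar> \<le> B"
    using compact_imp_bounded[OF compact_continuous_image[OF assms]] by (auto simp: bounded_iff)
  moreover have "\<bar>h 0\<bar> \<le> B" using B \<open>0 \<in> Omega\<close> by blast
  ultimately show thesis by (intro that[of B]) auto
qed

lemma L2_imp_integrable:
  assumes "g \<in> L2_Omega"
  shows "integrable \<mu> g"
proof (rule Bochner_Integration.integrable_bound)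
  interpret finite_measure "\<mu>" by (rule finite_measure_Omega)
  show "integrable \<mu> (\<lambda>x. 1 + (g x)\<^sup>2)"
    using assms by (auto simp: L2_Omega_def)
  show "g \<in> borel_measurable \<mu>"
    using assms by (auto simp: L2_Omega_def)
  have "\<bar>t\<bar> \<le> 1 + t\<^sup>2" for t :: real
    using zero_le_power2[of "\<bar>t\<bar> - 1"] by (simp add: power2_diff)
  then show "AE x in \<mu>. norm (g x) \<le> norm (1 + (g x)\<^sup>2)"
    by auto
qed

lemma smooth_step_shift_deriv:
  "((\<lambda>x. smooth_step (n * (x - a))) has_real_derivative n * bump 0 1 (n * (x - a))) (at x)"
proof -
  have "((\<lambda>x. n * (x - a)) has_real_derivative n) (at x)"
    by (auto intro!: derivative_eq_intros)
  from DERIV_chain2[OF smooth_step_deriv this] show ?thesis by (simp only: mult.commute)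
qed

lemma bump_shift_deriv:
  "((\<lambda>x. bump k p (n * (x - a))) has_real_derivative n * bump (k + 2) (bump_deriv_poly k p) (n * (x - a))) (at x)"
proof -
  have "((\<lambda>x. n * (x - a)) has_real_derivative n) (at x)"
    by (auto intro!: derivative_eq_intros)
  from DERIV_chain2[OF bump_has_derivative this] show ?thesis by (simp only: mult.commute)
qed

text \<open>A smooth approximation, up to the total rise of the step, of the indicator of the
  interval from \<open>a\<close> to \<open>b\<close>. It rises on (a, a + 1/n) and falls on (b, b +
  1/n), so its derivative approximates a multiple of the Dirac mass at \<open>a\<close> minus that
  at \<open>b\<close>.\<close>

definition mollified :: "real \<Rightarrow> real \<Rightarrow> real \<Rightarrow> real \<Rightarrow> real" where
  "mollified n a b x = smooth_step (n * (x - a)) - smooth_step (n * (x - b))"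

lemma mollified_deriv:
  "(mollified n a b has_real_derivative n * bump 0 1 (n * (x - a)) - n * bump 0 1 (n * (x - b))) (at x)"
  unfolding mollified_def[abs_def] by (intro DERIV_diff smooth_step_shift_deriv)

lemma mollified_test:
  assumes "-1/2 < a" "a < b" "0 < n" "b + 1 / n < 1/2"
  shows "mollified n a b \<in> test_functions"
proof -
  \<comment> \<open>Combinations of the two shifted bumps are closed under differentiation; the free
    coefficients \<open>c\<close>, \<open>d\<close> absorb the factor \<open>n\<close> of the chain
    rule.\<close>
  define F where "F = insert (mollified n a b)
    {\<lambda>x. c * bump k p (n * (x - a)) + d * bump k p (n * (x - b)) | c d k p. True}"
  have "smooth (mollified n a b)"
  proof (rule deriv_closed_imp_smooth[of _ F])
    fix f assume "f \<in> F"
    then consider "f = mollified n a b"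
      | c d k p where "f = (\<lambda>x. c * bump k p (n * (x - a)) + d * bump k p (n * (x - b)))"
      unfolding F_def by auto
    then show "\<exists>f'\<in>F. \<forall>x. (f has_real_derivative f' x) (at x)"
    proof cases
      case 1
      have "(f has_real_derivative n * bump 0 1 (n * (x - a)) + (- n) * bump 0 1 (n * (x - b))) (at x)" for x
        unfolding 1 using mollified_deriv[of n a b x] by simp
      moreover have "(\<lambda>x. n * bump 0 1 (n * (x - a)) + (- n) * bump 0 1 (n * (x - b))) \<in> F"
        unfolding F_def by (rule insertI2, rule CollectI, intro exI conjI TrueI) (rule refl)
      ultimately show ?thesis by (intro bexI) auto
    next
      case 2
      let ?q = "bump_deriv_poly k p"
      have "(f has_real_derivative (c * n) * bump (k + 2) ?q (n * (x - a)) + (d * n) * bump (k + 2) ?q (n * (x - b))) (at x)" for x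
        unfolding 2 using DERIV_add[OF DERIV_cmult[OF bump_shift_deriv[of k p n a x], of c] DERIV_cmult[OF bump_shift_deriv[of k p n b x], of d]]
        by (simp only: mult.assoc)
      moreover have "(\<lambda>x. (c * n) * bump (k + 2) ?q (n * (x - a)) + (d * n) * bump (k + 2) ?q (n * (x - b))) \<in> F"
        unfolding F_def by (rule insertI2, rule CollectI, intro exI conjI TrueI) (rule refl)
      ultimately show ?thesis by (intro bexI) auto
    qed
  qed (simp add: F_def)
  moreover have "mollified n a b x = 0" if "x \<notin> {a..b + 1 / n}" for x
  proof (cases "x < a")
    case True
    then have "n * (x - a) \<le> 0" "n * (x - b) \<le> 0"
      using assms by (auto simp: mult_le_0_iff)
    then show ?thesis
      by (simp add: mollified_def smooth_step_const(1)[of "n * (x - a)"] smooth_step_const(1)[of "n * (x - b)"])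
  next
    case False
    then have *: "x - b > 1 / n" using that by auto
    then have "n * (x - b) \<ge> 1"
      using assms by (simp add: field_simps)
    moreover have "n * (x - b) \<le> n * (x - a)" using assms by simp
    ultimately show ?thesis
      by (simp add: mollified_def smooth_step_const(2)[of "n * (x - a)"] smooth_step_const(2)[of "n * (x - b)"])
  qed
  moreover have "{a..b + 1 / n} \<subseteq> interior Omega"
    using assms unfolding Omega_def by (auto simp: interior_atLeastAtMost_real)
  ultimately show ?thesis
    unfolding test_functions_def smooth_def by (blast intro: compact_Icc)
qed


lemma smooth_step_range: "smooth_step 0 \<le> smooth_step x \<and> smooth_step x \<le> smooth_step 1"
proof -
  consider "x \<le> 0" | "0 \<le> x" "x \<le> 1" | "1 \<le> x" by linarith
  then show ?thesis
  proof cases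
    case 1
    then show ?thesis using smooth_step_const(1)[of x] smooth_step_less by linarith
  next
    case 2
    then show ?thesis using smooth_step_mono by blast
  next
    case 3
    then show ?thesis using smooth_step_const(2)[of x] smooth_step_less by linarith
  qed
qed

text \<open>The rescaled bumps are an approximate identity: they are nonnegative, keep a fixed mass,
  and are concentrated on (a, a + 1/n), where \<open>y\<close> is close to
  \<open>y a\<close>.\<close>

lemma mollify_tendsto:
  fixes y :: "real \<Rightarrow> real"
  assumes y: "continuous_on Omega y" and a: "-1/2 < a" "a < 1/2"
  shows "(\<lambda>n. LINT x|\<mu>. y x * (real n * bump 0 1 (real n * (x - a))))
    \<longlonglongrightarrow> (smooth_step 1 - smooth_step 0) * y a"
proof (rule LIMSEQ_I)
  fix r :: real assume r: "r > 0"
  define c where "c = smooth_step 1 - smooth_step 0"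
  have c: "c > 0" unfolding c_def using smooth_step_less by simp
  have "a \<in> Omega" using a by (simp add: Omega_def)
  then obtain d where d: "d > 0" "\<And>x. x \<in> Omega \<Longrightarrow> \<bar>x - a\<bar> < d \<Longrightarrow> \<bar>y x - y a\<bar> < r / (2 * c)"
    using y[unfolded continuous_on_iff, rule_format, of a "r / (2 * c)"] r c
    by (auto simp: dist_real_def)
  \<comment> \<open>The minimum serves two ends: the support lies within distance \<open>d\<close>
    of \<open>a\<close>, and it stays inside \<open>Omega\<close>, so that no mass is lost.\<close>
  obtain n0 where n0: "n0 > 0" "1 / real n0 < min d (1/2 - a)"
    using real_arch_inverse[of "min d (1/2 - a)"] d a by (auto simp: inverse_eq_divide)
  have bound: "norm ((LINT x|\<mu>. y x * (real n * bump 0 1 (real n * (x - a)))) - c * y a) < r"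
    if n: "n \<ge> n0" for n
  proof -
    define \<rho> where "\<rho> x = real n * bump 0 1 (real n * (x - a))" for x
    have npos: "real n > 0" using n n0 by simp
    have n1: "1 / real n < d" "1 / real n < 1/2 - a"
      using n n0 frac_le[of 1 1 "real n0" "real n"] by auto
    have \<rho>0: "\<rho> x \<ge> 0" for x unfolding \<rho>_def using bump_nonneg by simp
    have \<rho>c: "continuous_on Omega \<rho>"
      unfolding \<rho>_def
      by (intro continuous_at_imp_continuous_on ballI continuous_mult continuous_const DERIV_isCont[OF bump_shift_deriv])
    have "(\<rho> has_integral (smooth_step (real n * (1/2 - a)) - smooth_step (real n * (-1/2 - a)))) {-1/2..1/2}"
      unfolding \<rho>_def
      by (rule fundamental_theorem_of_calculus)
        (auto intro: has_field_derivative_at_within[OF smooth_step_shift_deriv]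
          simp flip: has_real_derivative_iff_has_vector_derivative)
    moreover have "real n * (1/2 - a) \<ge> 1"
      using n1 npos by (simp add: field_simps)
    moreover have "real n * (-1/2 - a) \<le> 0"
      using npos a by (intro mult_nonneg_nonpos) auto
    ultimately have "(\<rho> has_integral c) Omega"
      using smooth_step_const(2)[of "real n * (1/2 - a)"] smooth_step_const(1)[of "real n * (-1/2 - a)"]
      by (simp only: c_def Omega_def)
    then have \<rho>i: "(LINT x|\<mu>. \<rho> x) = c"
      using lebesgue_integral_eq_integral[OF continuous_integrable_Omega[OF \<rho>c]] by auto
    have le: "\<bar>(y x - y a) * \<rho> x\<bar> \<le> r / (2 * c) * \<rho> x" if "x \<in> Omega" for x
    proof (cases "\<bar>x - a\<bar> < d")
      case True
      have "\<bar>y x - y a\<bar> * \<rho> x \<le> r / (2 * c) * \<rho> x"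
        using d(2)[OF that True] \<rho>0[of x] by (intro mult_right_mono) auto
      then show ?thesis using \<rho>0[of x] by (simp add: abs_mult)
    next
      case False
      have "real n * (x - a) \<le> 0 \<or> real n * (x - a) \<ge> 1"
      proof (cases "x \<le> a")
        case False
        then have "x - a \<ge> d" using \<open>\<not> \<bar>x - a\<bar> < d\<close> by auto
        then have "x - a \<ge> 1 / real n" using n1 by simp
        then show ?thesis using npos by (simp add: field_simps)
      qed (use npos in \<open>simp add: mult_le_0_iff\<close>)
      then have "\<rho> x = 0" unfolding \<rho>_def using bump_outside by auto
      then show ?thesis by simp
    qed
    have i1: "integrable \<mu> (\<lambda>x. y x * \<rho> x)"
      by (intro continuous_integrable_Omega continuous_on_mult y \<rho>c)
    have i2: "integrable \<mu> (\<lambda>x. y a * \<rho> x)"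
      by (intro continuous_integrable_Omega continuous_on_mult continuous_on_const \<rho>c)
    have i3: "integrable \<mu> (\<lambda>x. r / (2 * c) * \<rho> x)"
      by (intro continuous_integrable_Omega continuous_on_mult continuous_on_const \<rho>c)
    have "(LINT x|\<mu>. y x * \<rho> x) - c * y a
        = (LINT x|\<mu>. y x * \<rho> x) - (LINT x|\<mu>. y a * \<rho> x)"
      by (simp add: \<rho>i)
    also have "\<dots> = (LINT x|\<mu>. (y x - y a) * \<rho> x)"
      using i1 i2 by (simp add: left_diff_distrib)
    finally have "\<bar>(LINT x|\<mu>. y x * \<rho> x) - c * y a\<bar>
        \<le> (LINT x|\<mu>. \<bar>(y x - y a) * \<rho> x\<bar>)"
      by (simp only: integral_abs_bound)
    also have "\<dots> \<le> (LINT x|\<mu>. r / (2 * c) * \<rho> x)"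
    proof (rule integral_mono[OF _ i3])
      show "integrable \<mu> (\<lambda>x. \<bar>(y x - y a) * \<rho> x\<bar>)"
        using i1 i2 by (auto simp: left_diff_distrib intro!: integrable_abs Bochner_Integration.integrable_diff)
    qed (use le in auto)
    also have "\<dots> = r / 2" using c by (simp add: \<rho>i)
    finally show ?thesis using r unfolding \<rho>_def by simp
  qed
  then show "\<exists>n0. \<forall>n\<ge>n0. norm ((LINT x|\<mu>. y x * (real n * bump 0 1 (real n * (x - a)))) - (smooth_step 1 - smooth_step 0) * y a) < r"
    unfolding c_def by blast
qed

text \<open>At each point both steps eventually saturate, so the sequence is eventually constant.
  The limit interval is open at \<open>a\<close> and closed at \<open>b\<close> because each step
  still has its lower value at its starting point.\<close>

lemma mollified_tendsto:
  assumes "a < b"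
  shows "(\<lambda>n. mollified (real n) a b x) \<longlonglongrightarrow> (smooth_step 1 - smooth_step 0) * indicator {a<..b} x"
proof -
  have le: "smooth_step (real n * (x - d)) = smooth_step 0" if "x \<le> d" for n d
    using that by (intro smooth_step_const(1)) (simp add: mult_le_0_iff)
  have gt: "\<forall>\<^sub>F n in sequentially. smooth_step (real n * (x - d)) = smooth_step 1" if d: "x > d" for d
  proof -
    obtain n0 where "n0 > 0" "1 / real n0 < x - d"
      using real_arch_inverse[of "x - d"] d by (auto simp: inverse_eq_divide)
    have "real n * (x - d) \<ge> 1" if "n \<ge> n0" for n
    proof -
      have "1 \<le> real n0 * (x - d)" using \<open>1 / real n0 < x - d\<close> \<open>n0 > 0\<close> by (simp add: field_simps)
      also have "\<dots> \<le> real n * (x - d)" using that d by (intro mult_right_mono) auto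
      finally show ?thesis .
    qed
    then have "\<forall>n\<ge>n0. smooth_step (real n * (x - d)) = smooth_step 1"
      by (intro allI impI smooth_step_const(2))
    then show ?thesis unfolding eventually_sequentially by (rule exI)
  qed
  have "\<forall>\<^sub>F n in sequentially. mollified (real n) a b x = (smooth_step 1 - smooth_step 0) * indicator {a<..b} x"
  proof -
    consider "x \<le> a" | "a < x" "x \<le> b" | "x > b" by linarith
    then show ?thesis
    proof cases
      case 1
      then show ?thesis using assms le[of a] le[of b] by (simp add: mollified_def)
    next
      case 2
      then show ?thesis using le[of b] eventually_mono[OF gt[of a]] by (simp add: mollified_def)
    next
      case 3
      then have "\<forall>\<^sub>F n in sequentially. smooth_step (real n * (x - a)) = smooth_step 1 \<and> smooth_step (real n * (x - b)) = smooth_step 1"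
        using assms gt[of a] gt[of b] by (simp add: eventually_conj)
      then show ?thesis using 3 by (auto elim!: eventually_mono simp: mollified_def)
    qed
  qed
  then show ?thesis by (rule tendsto_eventually)
qed

text \<open>Testing with \<open>mollified\<close> and letting \<open>n\<close> tend to infinity
  gives, on the left, a multiple of \<open>y a - y b\<close> from the two approximate Dirac masses,
  and on the right, by dominated convergence, the same multiple of minus the integral of
  \<open>g\<close>. The strict inequalities leave room for the support of the test function.\<close>

lemma weak_deriv_integral_interior:
  fixes y g :: "real \<Rightarrow> real"
  assumes y: "continuous_on Omega y" and g: "integrable \<mu> g"
    and w: "has_weak_deriv y g" and ab: "-1/2 < a" "a < b" "b < 1/2"
  shows "integral {a..b} g = y b - y a"
proof -
  define c where "c = smooth_step 1 - smooth_step 0"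
  have c: "c > 0" unfolding c_def using smooth_step_less by simp
  let ?\<rho> = "\<lambda>n a x. real n * bump 0 1 (real n * (x - a))"
  have i: "integrable \<mu> (\<lambda>x. y x * ?\<rho> n d x)" for n d
    by (intro continuous_integrable_Omega continuous_on_mult y continuous_at_imp_continuous_on ballI
        continuous_mult continuous_const DERIV_isCont[OF bump_shift_deriv])
  obtain n0 where n0: "n0 > 0" "1 / real n0 < 1/2 - b"
    using real_arch_inverse[of "1/2 - b"] ab by (auto simp: inverse_eq_divide)
  have eq: "(LINT x|\<mu>. y x * ?\<rho> n a x) - (LINT x|\<mu>. y x * ?\<rho> n b x)
      = - (LINT x|\<mu>. g x * mollified (real n) a b x)" if n: "n \<ge> n0" for n
  proof -
    have "1 / real n \<le> 1 / real n0" using n n0 by (intro frac_le) auto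
    then have "mollified (real n) a b \<in> test_functions"
      using ab n0 n by (intro mollified_test) auto
    moreover have "deriv (mollified (real n) a b) x = ?\<rho> n a x - ?\<rho> n b x" for x
      by (rule DERIV_imp_deriv[OF mollified_deriv])
    ultimately have "(LINT x|\<mu>. y x * (?\<rho> n a x - ?\<rho> n b x))
        = - (LINT x|\<mu>. g x * mollified (real n) a b x)"
      using w[unfolded has_weak_deriv_def, rule_format, of "mollified (real n) a b"] by simp
    then show ?thesis using i[of n a] i[of n b] by (simp add: right_diff_distrib)
  qed
  have "(\<lambda>n. (LINT x|\<mu>. y x * ?\<rho> n a x) - (LINT x|\<mu>. y x * ?\<rho> n b x))
      \<longlonglongrightarrow> c * y a - c * y b"
    unfolding c_def using ab by (intro tendsto_diff mollify_tendsto y) auto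
  moreover have "(\<lambda>n. - (LINT x|\<mu>. g x * mollified (real n) a b x))
      \<longlonglongrightarrow> - (LINT x|\<mu>. g x * (c * indicator {a<..b} x))"
  proof (intro tendsto_minus integral_dominated_convergence[where w = "\<lambda>x. \<bar>g x\<bar> * c"])
    show "(\<lambda>x. g x * (c * indicator {a<..b} x)) \<in> borel_measurable \<mu>"
      using g ab by (intro borel_measurable_times borel_measurable_const borel_measurable_indicator)
        (auto simp: sets_restrict_space_iff Omega_def)
    show "(\<lambda>x. g x * mollified (real n) a b x) \<in> borel_measurable \<mu>" for n
      by (intro borel_measurable_times borel_measurable_integrable[OF g] continuous_measurable_Omega
          continuous_at_imp_continuous_on ballI DERIV_isCont[OF mollified_deriv])
    show "integrable \<mu> (\<lambda>x. \<bar>g x\<bar> * c)" using g by simp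
    show "AE x in \<mu>. (\<lambda>n. g x * mollified (real n) a b x) \<longlonglongrightarrow> g x * (c * indicator {a<..b} x)"
      unfolding c_def using ab by (intro AE_I2 tendsto_mult tendsto_const mollified_tendsto) auto
    have "\<bar>mollified (real n) a b x\<bar> \<le> c" for n x
    proof -
      from smooth_step_range[of "real n * (x - a)"] smooth_step_range[of "real n * (x - b)"] show ?thesis
        unfolding mollified_def c_def by linarith
    qed
    then show "AE x in \<mu>. norm (g x * mollified (real n) a b x) \<le> \<bar>g x\<bar> * c" for n
      by (intro AE_I2) (simp add: abs_mult mult_left_mono)
  qed
  then have "(\<lambda>n. (LINT x|\<mu>. y x * ?\<rho> n a x) - (LINT x|\<mu>. y x * ?\<rho> n b x))
      \<longlonglongrightarrow> - (LINT x|\<mu>. g x * (c * indicator {a<..b} x))"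
    by (rule Lim_transform_eventually) (use eq in \<open>auto simp: eventually_sequentially intro!: exI[of _ n0]\<close>)
  ultimately have "c * y a - c * y b = - (LINT x|\<mu>. g x * (c * indicator {a<..b} x))"
    by (rule LIMSEQ_unique)
  then have "c * (y b - y a) = c * (LINT x|\<mu>. g x * indicator {a<..b} x)"
    by (simp add: algebra_simps)
  then have "y b - y a = (LINT x|\<mu>. g x * indicator {a<..b} x)"
    using c by simp
  also have "\<dots> = integral Omega (\<lambda>x. g x * indicator {a<..b} x)"
    using g ab by (intro lebesgue_integral_eq_integral integrable_real_mult_indicator)
      (auto simp: sets_restrict_space_iff Omega_def)
  also have "\<dots> = integral Omega (\<lambda>x. if x \<in> {a<..b} then g x else 0)"
    by (intro integral_cong) (auto simp: indicator_def)
  also have "\<dots> = integral {a<..b} g"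
    using ab by (subst integral_restrict_Int) (auto simp: Omega_def intro!: arg_cong[of _ _ "\<lambda>S. integral S g"])
  also have "\<dots> = integral {a..b} g"
    by (rule integral_spike_set; rule negligible_subset[OF negligible_sing[of a]]) auto
  finally show ?thesis by simp
qed

lemma integrable_on_subinterval_Omega:
  fixes g :: "real \<Rightarrow> real"
  assumes "integrable \<mu> g" "-1/2 \<le> a" "b \<le> 1/2"
  shows "g integrable_on {a..b}"
  using integrable_on_lebesgue_on[OF assms(1)] assms integrable_on_subinterval[of g Omega a b]
  by (auto simp: Omega_def)

text \<open>The difference between the indefinite integral of \<open>g\<close> and \<open>y\<close>
  is constant on the open interval by the interior case, and continuity carries this to the end
  points.\<close>

theorem weak_deriv_has_integral:
  fixes y g :: "real \<Rightarrow> real"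
  assumes y: "continuous_on Omega y" and g: "integrable \<mu> g"
    and w: "has_weak_deriv y g" and ab: "-1/2 \<le> a" "a \<le> b" "b \<le> 1/2"
  shows "(g has_integral (y b - y a)) {a..b}"
proof -
  let ?G = "\<lambda>x. integral {-1/2..x} g"
  define D where "D x = ?G x - y x" for x
  have gi: "g integrable_on {-1/2..1/2}" by (rule integrable_on_subinterval_Omega[OF g]) auto
  have split: "?G x + integral {x..x'} g = ?G x'" if "-1/2 \<le> x" "x \<le> x'" "x' \<le> 1/2" for x x'
    using that integrable_on_subinterval_Omega[OF g] by (intro Henstock_Kurzweil_Integration.integral_combine) auto
  have cont: "continuous_on {-1/2..1/2} D"
    unfolding D_def using y by (intro continuous_on_diff indefinite_integral_continuous_1 gi) (simp add: Omega_def)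
  have eqD: "D x = D 0" if "x \<in> {-1/2<..<1/2}" for x
  proof -
    consider "x < 0" | "x = 0" | "x > 0" by linarith
    then show ?thesis
    proof cases
      case 1
      then show ?thesis using that weak_deriv_integral_interior[OF y g w, of x 0] split[of x 0]
        by (simp add: D_def)
    next
      case 3
      then show ?thesis using that weak_deriv_integral_interior[OF y g w, of 0 x] split[of 0 x]
        by (simp add: D_def)
    qed simp
  qed
  have cl: "closure {-1/2<..<1/2::real} = {-1/2..1/2}"
    by (rule closure_greaterThanLessThan) simp
  have Dc: "D x = D 0" if "x \<in> {-1/2..1/2}" for x
    by (rule continuous_constant_on_closure[of "{-1/2<..<1/2}"]) (simp only: cl cont, erule eqD, simp only: cl that)
  have "D a = D b" using Dc[of a] Dc[of b] ab by simp
  then have "integral {a..b} g = y b - y a"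
    using split[of a b] ab unfolding D_def by simp
  then show ?thesis
    using integrable_on_subinterval_Omega[OF g, of a b] ab by (metis integrable_integral)
qed

section \<open>Grids and step functions\<close>

text \<open>This isolates what the energy estimates need from a weak derivative. The flattened limit
  of the recovery construction is treated at this level, without showing that it lies in
  \<open>H1_Omega\<close>; only its interpolants have to be admissible.\<close>

definition primitive :: "(real \<Rightarrow> real) \<Rightarrow> (real \<Rightarrow> real) \<Rightarrow> bool" where
  "primitive g Y \<longleftrightarrow> integrable \<mu> g \<and>
     (\<forall>a b. -1/2 \<le> a \<longrightarrow> a \<le> b \<longrightarrow> b \<le> 1/2 \<longrightarrow> (g has_integral (Y b - Y a)) {a..b})"

lemma primitiveD:
  assumes "primitive g Y"
  shows "integrable \<mu> g"
    and "\<And>a b. -1/2 \<le> a \<Longrightarrow> a \<le> b \<Longrightarrow> b \<le> 1/2 \<Longrightarrow> (g has_integral (Y b - Y a)) {a..b}"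
  using assms by (auto simp: primitive_def)

section \<open>Lebesgue differentiation and difference quotients\<close>

lemma AE_Omega_negligible:
  assumes "negligible N" and "\<And>x. x \<in> Omega \<Longrightarrow> x \<notin> N \<Longrightarrow> P x"
  shows "AE x in \<mu>. P x"
proof -
  have "AE x in lebesgue. x \<notin> N"
    using assms(1) by (intro AE_not_in) (simp add: negligible_iff_null_sets)
  then have "AE x in lebesgue. x \<in> Omega \<longrightarrow> P x"
    by eventually_elim (use assms(2) in auto)
  then show ?thesis
    by (subst AE_restrict_space_iff) auto
qed

lemma AE_Omega_interior: "AE x in \<mu>. -1/2 < x \<and> x < 1/2"
proof (rule AE_Omega_negligible[of "{-1/2, 1/2}"])
  fix x :: real assume "x \<in> Omega" "x \<notin> {-1/2, 1/2}"
  then show "-1/2 < x \<and> x < 1/2" unfolding Omega_def by (auto simp: less_le)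
qed simp

text \<open>Lebesgue's differentiation theorem, applied to \<open>g\<close> extended by 0, gives
  averages over intervals to the right of a point. The same theorem for the reflected function gives
  the averages to the left, at the price of excluding the reflected null set as well.\<close>

lemma primitive_AE_derivative:
  assumes p: "primitive g Y"
  shows "AE x in \<mu>. (Y has_real_derivative g x) (at x)"
proof -
  define G where "G x = (if x \<in> Omega then g x else 0)" for x
  have "g integrable_on Omega"
    using primitiveD(2)[OF p, of "-1/2" "1/2"] by (auto simp: Omega_def intro: has_integral_integrable)
  then have "G integrable_on UNIV"
    unfolding G_def using integrable_restrict_UNIV by blast
  then have Gi: "G integrable_on cbox a b" for a b
    using integrable_on_subcbox by blast
  then have Gi': "(\<lambda>x. G (- x)) integrable_on cbox a b" for a b :: real
    using integrable_reflect[of G "-a" "-b"] by simp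
  have GY: "integral {a..b} G = Y b - Y a" if "-1/2 \<le> a" "a \<le> b" "b \<le> 1/2" for a b
  proof -
    have "integral {a..b} G = integral {a..b} g"
      by (intro integral_cong) (use that in \<open>auto simp: G_def Omega_def\<close>)
    then show ?thesis using primitiveD(2)[OF p that] by (simp add: integral_unique)
  qed
  have avg: "norm (integral (cbox x (x + h *\<^sub>R One)) F /\<^sub>R h ^ DIM(real) - c) = \<bar>integral {x..x + h} F / h - c\<bar>"
    for x h c :: real and F :: "real \<Rightarrow> real"
    by (simp add: field_simps)
  obtain N1 where N1: "negligible N1"
    "\<And>x e. x \<notin> N1 \<Longrightarrow> 0 < e \<Longrightarrow> \<exists>d>0. \<forall>h. 0 < h \<and> h < d \<longrightarrow>
      norm (integral (cbox x (x + h *\<^sub>R One)) G /\<^sub>R h ^ DIM(real) - G x) < e"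
    using integrable_ccontinuous_explicit[of G] Gi by metis
  obtain N2 where N2: "negligible N2"
    "\<And>x e. x \<notin> N2 \<Longrightarrow> 0 < e \<Longrightarrow> \<exists>d>0. \<forall>h. 0 < h \<and> h < d \<longrightarrow>
      norm (integral (cbox x (x + h *\<^sub>R One)) (\<lambda>x. G (- x)) /\<^sub>R h ^ DIM(real) - G (- x)) < e"
    using integrable_ccontinuous_explicit[of "\<lambda>x. G (- x)"] Gi' by metis
  have "negligible (uminus ` N2)"
    by (rule negligible_differentiable_image_negligible[OF _ N2(1)])
      (simp_all add: linear_imp_differentiable_on bounded_linear.linear[OF bounded_linear_minus[OF bounded_linear_ident]])
  then have neg: "negligible (N1 \<union> uminus ` N2 \<union> {-1/2, 1/2})"
    using N1(1) by (intro negligible_Un) auto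
  show ?thesis
  proof (rule AE_Omega_negligible[OF neg])
    fix x assume xO: "x \<in> Omega" and x: "x \<notin> N1 \<union> uminus ` N2 \<union> {-1/2, 1/2}"
    have x2: "- x \<notin> N2" using x by force
    have xi: "-1/2 < x" "x < 1/2" using xO x unfolding Omega_def by (auto simp: less_le)
    have Gx: "G x = g x" using xO by (simp add: G_def)
    have "((\<lambda>z. (Y z - Y x) / (z - x)) \<longlongrightarrow> g x) (at x)"
    proof (rule tendstoI)
      fix e :: real assume e: "e > 0"
      have "\<exists>d>0. \<forall>h. 0 < h \<and> h < d \<longrightarrow> \<bar>integral {x..x + h} G / h - g x\<bar> < e"
        using N1(2)[of x e] x e unfolding avg Gx by blast
      then obtain d1 where d1: "d1 > 0"
        "\<And>h. 0 < h \<Longrightarrow> h < d1 \<Longrightarrow> \<bar>integral {x..x + h} G / h - g x\<bar> < e"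
        by blast
      have "\<exists>d>0. \<forall>h. 0 < h \<and> h < d \<longrightarrow> \<bar>integral {-x..-x + h} (\<lambda>x. G (- x)) / h - g x\<bar> < e"
        using N2(2)[of "- x" e] x2 e unfolding avg minus_minus Gx by blast
      then obtain d2 where d2: "d2 > 0"
        "\<And>h. 0 < h \<Longrightarrow> h < d2 \<Longrightarrow> \<bar>integral {-x..-x + h} (\<lambda>x. G (- x)) / h - g x\<bar> < e"
        by blast
      define d where "d = min (min d1 d2) (min (1/2 - x) (x + 1/2))"
      have "dist ((Y z - Y x) / (z - x)) (g x) < e" if z: "z \<noteq> x" "dist z x < d" for z
      proof (cases "z > x")
        case True
        then have "\<bar>integral {x..z} G / (z - x) - g x\<bar> < e"
          using d1(2)[of "z - x"] z by (simp add: dist_real_def d_def)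
        moreover have "integral {x..z} G = Y z - Y x"
          using z True xi by (intro GY) (auto simp: dist_real_def d_def)
        ultimately show ?thesis by (simp add: dist_real_def)
      next
        case False
        then have zx: "z < x" using z by simp
        then have "\<bar>integral {-x..-z} (\<lambda>x. G (- x)) / (x - z) - g x\<bar> < e"
          using d2(2)[of "x - z"] z by (simp add: dist_real_def d_def)
        moreover have "integral {z..x} G = Y x - Y z"
          using z zx xi by (intro GY) (auto simp: dist_real_def d_def)
        then have "integral {-x..-z} (\<lambda>x. G (- x)) = Y x - Y z"
          by simp
        moreover have "(Y x - Y z) / (x - z) = (Y z - Y x) / (z - x)"
          using minus_divide_divide[of "Y z - Y x" "z - x"] by simp
        ultimately show ?thesis by (simp add: dist_real_def)
      qed
      moreover have "d > 0" using d1(1) d2(1) xi by (simp add: d_def)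
      ultimately show "\<forall>\<^sub>F z in at x. dist ((Y z - Y x) / (z - x)) (g x) < e"
        unfolding eventually_at by auto
    qed
    then show "(Y has_real_derivative g x) (at x)"
      by (simp add: has_field_derivative_iff)
  qed
qed

text \<open>The linearisation errors at the two end points are proportional to their distances from
  \<open>x\<close>. As \<open>x\<close> lies between them, these distances add up to the length of
  the interval, so the error survives division by that length.\<close>

lemma straddle_tendsto:
  fixes Y :: "real \<Rightarrow> real"
  assumes D: "(Y has_real_derivative D) (at x)"
    and ab: "\<forall>\<^sub>F n in F. a n \<le> x \<and> x \<le> b n \<and> a n < b n" and lim: "((\<lambda>n. b n - a n) \<longlongrightarrow> 0) F"
  shows "((\<lambda>n. (Y (b n) - Y (a n)) / (b n - a n)) \<longlongrightarrow> D) F"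
proof (rule tendstoI)
  fix e :: real assume e: "e > 0"
  obtain d where d: "d > 0" "\<And>z. \<bar>z - x\<bar> < d \<Longrightarrow> \<bar>Y z - Y x - D * (z - x)\<bar> \<le> e / 2 * \<bar>z - x\<bar>"
    using D[unfolded has_field_derivative_def has_derivative_at_alt, THEN conjunct2, rule_format, of "e / 2"] e
    by auto
  have "\<forall>\<^sub>F n in F. dist (b n - a n) 0 < d" using lim d(1) by (rule tendstoD)
  with ab show "\<forall>\<^sub>F n in F. dist ((Y (b n) - Y (a n)) / (b n - a n)) D < e"
  proof eventually_elim
    case (elim n)
    then have "\<bar>Y (b n) - Y x - D * (b n - x)\<bar> \<le> e / 2 * (b n - x)"
      "\<bar>Y (a n) - Y x - D * (a n - x)\<bar> \<le> e / 2 * (x - a n)"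
      using d(2)[of "b n"] d(2)[of "a n"] by (auto simp: dist_real_def)
    then have "\<bar>(Y (b n) - Y x - D * (b n - x)) - (Y (a n) - Y x - D * (a n - x))\<bar> \<le> e / 2 * (b n - x) + e / 2 * (x - a n)"
      by linarith
    moreover have "(Y (b n) - Y x - D * (b n - x)) - (Y (a n) - Y x - D * (a n - x)) = Y (b n) - Y (a n) - D * (b n - a n)"
      "e / 2 * (b n - x) + e / 2 * (x - a n) = e / 2 * (b n - a n)"
      by (simp_all add: field_simps)
    ultimately have "\<bar>Y (b n) - Y (a n) - D * (b n - a n)\<bar> \<le> e / 2 * (b n - a n)"
      by (simp only:)
    also have "\<dots> < e * (b n - a n)" using e elim by simp
    finally have *: "\<bar>Y (b n) - Y (a n) - D * (b n - a n)\<bar> < e * (b n - a n)" .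
    have "(Y (b n) - Y (a n)) / (b n - a n) - D = (Y (b n) - Y (a n) - D * (b n - a n)) / (b n - a n)"
      using elim by (simp add: field_simps)
    then show ?case using * elim by (simp add: dist_real_def abs_divide divide_less_eq)
  qed
qed

section \<open>The lattice, its cells and step functions\<close>

lemma eps_pos: "N > 0 \<Longrightarrow> eps N > 0"
  by (simp add: eps_def)

lemma eps_tendsto: "eps \<longlonglongrightarrow> 0"
  using tendsto_mult_right_zero[OF lim_1_over_n, of "1 / 2 :: real"] by (simp add: eps_def[abs_def])

lemma grid_add: "grid N (i + j) = grid N i + of_int j * eps N"
  by (simp add: grid_def algebra_simps)

lemma grid_ends: "N > 0 \<Longrightarrow> grid N (- int N) = -1/2" "N > 0 \<Longrightarrow> grid N (int N) = 1/2"
  by (simp_all add: grid_def eps_def)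

lemma grid_mono: "i \<le> j \<Longrightarrow> grid N i \<le> grid N j"
  by (simp add: grid_def eps_def divide_right_mono)

lemma grid_less: "N > 0 \<Longrightarrow> grid N i < grid N j \<longleftrightarrow> i < j"
  by (simp add: grid_def eps_def divide_less_cancel)

lemma grid_in_Omega: "N > 0 \<Longrightarrow> i \<in> {- int N..int N} \<Longrightarrow> grid N i \<in> Omega"
  using grid_mono[of "- int N" i N] grid_mono[of i "int N" N] grid_ends[of N] by (simp add: Omega_def)

abbreviation cells :: "nat \<Rightarrow> int set" where
  "cells N \<equiv> {- int N..int N - 1}"

text \<open>Cells are half-open on the right, so for positive \<open>N\<close> the end point 1/2 has
  index \<open>N\<close>, outside \<open>cells N\<close>. Identities with step functions are
  therefore stated almost everywhere.\<close>

definition cell :: "nat \<Rightarrow> real \<Rightarrow> int" where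
  "cell N x = \<lfloor>2 * real N * x\<rfloor>"

lemma cell_bounds: "N > 0 \<Longrightarrow> grid N (cell N x) \<le> x" "N > 0 \<Longrightarrow> x < grid N (cell N x + 1)"
proof -
  assume N: "N > 0"
  have 1: "of_int (cell N x) \<le> 2 * real N * x" "2 * real N * x < of_int (cell N x) + 1"
    unfolding cell_def by linarith+
  show "grid N (cell N x) \<le> x" "x < grid N (cell N x + 1)"
    using 1 N by (simp_all add: grid_def eps_def field_simps)
qed

lemma cell_eq:
  assumes "N > 0" "grid N i \<le> x" "x < grid N (i + 1)"
  shows "cell N x = i"
  using assms unfolding cell_def grid_def eps_def by (intro floor_unique) (simp_all add: field_simps)

lemma cell_range:
  assumes "N > 0" "-1/2 \<le> x" "x < 1/2"
  shows "cell N x \<in> cells N"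
proof -
  have "grid N (- int N) < grid N (cell N x + 1)" "grid N (cell N x) < grid N (int N)"
    using cell_bounds[OF assms(1), of x] assms grid_ends[OF assms(1)] by linarith+
  then show ?thesis using assms(1) by (simp add: grid_less)
qed

lemma cell_measurable [measurable]: "cell N \<in> measurable \<mu> (count_space UNIV)"
proof -
  have "(\<lambda>x. 2 * real N * x) \<in> borel_measurable \<mu>"
    by (intro continuous_measurable_Omega continuous_intros)
  then show ?thesis unfolding cell_def[abs_def] by measurable
qed

lemma cell_interval:
  assumes "N > 0" "i \<in> cells N"
  shows "{grid N i..<grid N (i + 1)} \<in> sets \<mu>"
    and "emeasure \<mu> {grid N i..<grid N (i + 1)} = ennreal (eps N)"
proof -
  have "-1/2 \<le> grid N i" "grid N (i + 1) \<le> 1/2"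
    using assms grid_in_Omega[OF assms(1), of i] grid_in_Omega[OF assms(1), of "i + 1"] by (auto simp: Omega_def)
  then have sub: "{grid N i..<grid N (i + 1)} \<subseteq> Omega"
    by (auto simp: Omega_def)
  then show "{grid N i..<grid N (i + 1)} \<in> sets \<mu>"
    by (simp add: sets_restrict_space_iff)
  show "emeasure \<mu> {grid N i..<grid N (i + 1)} = ennreal (eps N)"
    using sub assms(1) eps_pos[of N] by (simp add: emeasure_restrict_space grid_add)
qed

lemma cell_indicator:
  assumes "N > 0"
  shows "indicator {grid N i..<grid N (i + 1)} x = (if cell N x = i then 1 else 0 :: 'a :: zero_neq_one)"
  using cell_eq[OF assms, of i x] cell_bounds[OF assms, of x] by (auto simp: indicator_def)

text \<open>This turns lattice sums into integrals of step functions, so that the convergence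
  theorems of measure theory apply to them.\<close>

lemma has_bochner_integral_cell:
  fixes F :: "int \<Rightarrow> real"
  assumes N: "N > 0"
  shows "has_bochner_integral \<mu> (\<lambda>x. F (cell N x)) (\<Sum>i\<in>cells N. eps N * F i)"
proof -
  let ?I = "\<lambda>i. {grid N i..<grid N (i + 1)}"
  have m: "measure \<mu> (?I i) = eps N" if "i \<in> cells N" for i
    using cell_interval(2)[OF N that] eps_pos[OF N] by (simp add: measure_def)
  have "has_bochner_integral \<mu> (\<lambda>x. \<Sum>i\<in>cells N. indicator (?I i) x *\<^sub>R F i)
      (\<Sum>i\<in>cells N. measure \<mu> (?I i) *\<^sub>R F i)"
    using cell_interval[OF N] by (intro has_bochner_integral_sum has_bochner_integral_indicator) auto
  also have "(\<Sum>i\<in>cells N. measure \<mu> (?I i) *\<^sub>R F i) = (\<Sum>i\<in>cells N. eps N * F i)"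
    using m by (intro sum.cong) auto
  finally have h: "has_bochner_integral \<mu> (\<lambda>x. \<Sum>i\<in>cells N. indicator (?I i) x *\<^sub>R F i)
      (\<Sum>i\<in>cells N. eps N * F i)" .
  have "AE x in \<mu>. (\<Sum>i\<in>cells N. indicator (?I i) x *\<^sub>R F i) = F (cell N x)"
    using AE_Omega_interior
  proof eventually_elim
    case (elim x)
    then have "cell N x \<in> cells N" using cell_range[OF N, of x] by auto
    then show ?case by (simp add: cell_indicator[OF N] if_distrib if_distribR sum.delta cong: if_cong)
  qed
  then show ?thesis
    using h by (subst has_bochner_integral_cong_AE[symmetric]) (auto simp: has_bochner_integral_iff)
qed

lemma nn_integral_cell:
  fixes F :: "int \<Rightarrow> ennreal"
  assumes N: "N > 0"
  shows "(\<integral>\<^sup>+ x. F (cell N x) \<partial>\<mu>) = (\<Sum>i\<in>cells N. F i * ennreal (eps N))"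
proof -
  let ?I = "\<lambda>i. {grid N i..<grid N (i + 1)}"
  have "AE x in \<mu>. F (cell N x) = (\<Sum>i\<in>cells N. F i * indicator (?I i) x)"
    using AE_Omega_interior
  proof eventually_elim
    case (elim x)
    then have "cell N x \<in> cells N" using cell_range[OF N, of x] by auto
    then show ?case by (simp add: cell_indicator[OF N] if_distrib if_distribR sum.delta cong: if_cong)
  qed
  then have "(\<integral>\<^sup>+ x. F (cell N x) \<partial>\<mu>)
      = (\<integral>\<^sup>+ x. (\<Sum>i\<in>cells N. F i * indicator (?I i) x) \<partial>\<mu>)"
    by (rule nn_integral_cong_AE)
  also have "\<dots> = (\<Sum>i\<in>cells N. \<integral>\<^sup>+ x. F i * indicator (?I i) x \<partial>\<mu>)"
    using cell_interval(1)[OF N] by (intro nn_integral_sum) auto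
  also have "\<dots> = (\<Sum>i\<in>cells N. F i * ennreal (eps N))"
    using cell_interval[OF N] by (intro sum.cong) (auto simp: nn_integral_cmult_indicator)
  finally show ?thesis .
qed

lemma grid_cell_tendsto:
  "(\<lambda>N. grid N (cell N x + k)) \<longlonglongrightarrow> x"
proof (rule Lim_null_comparison[where g = "\<lambda>N. (1 + \<bar>of_int k\<bar>) * eps N", THEN LIM_zero_cancel])
  have "norm (grid N (cell N x + k) - x) \<le> (1 + \<bar>of_int k\<bar>) * eps N" if "N > 0" for N
  proof -
    have "\<bar>grid N (cell N x) - x\<bar> \<le> eps N"
      using cell_bounds[OF that, of x] by (simp add: grid_add)
    moreover have "\<bar>of_int k * eps N\<bar> = \<bar>of_int k\<bar> * eps N"
      using eps_pos[OF that] by (simp add: abs_mult)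
    ultimately have "\<bar>(grid N (cell N x) - x) + of_int k * eps N\<bar> \<le> eps N + \<bar>of_int k\<bar> * eps N"
      by linarith
    then show ?thesis by (simp only: grid_add real_norm_def) (simp add: algebra_simps)
  qed
  then show "\<forall>\<^sub>F N in sequentially. norm (grid N (cell N x + k) - x) \<le> (1 + \<bar>of_int k\<bar>) * eps N"
    using eventually_gt_at_top[of 0] by (rule eventually_mono[rotated])
  show "(\<lambda>N. (1 + \<bar>of_int k\<bar>) * eps N) \<longlonglongrightarrow> 0"
    using tendsto_mult_right_zero[OF eps_tendsto] by simp
qed

lemma riemann_sum_tendsto:
  assumes h: "continuous_on Omega h"
  shows "(\<lambda>N. \<Sum>i\<in>cells N. eps N * h (grid N i)) \<longlonglongrightarrow> (LINT x|\<mu>. h x)"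
proof -
  obtain B where B0: "B \<ge> 0" and B: "\<And>x. x \<in> Omega \<Longrightarrow> \<bar>h x\<bar> \<le> B"
    by (rule continuous_bounded_Omega[OF h]) (rule that; assumption)
  \<comment> \<open>For \<open>N = 0\<close> the sum is empty; the default 0 matches it and keeps
    the family bounded for all \<open>N\<close>, as dominated convergence requires.\<close>
  let ?s = "\<lambda>N x. if N = 0 then 0 else h (grid N (cell N x))"
  have "(\<lambda>N. LINT x|\<mu>. ?s N x) \<longlonglongrightarrow> (LINT x|\<mu>. h x)"
  proof (rule integral_dominated_convergence[where w = "\<lambda>x. B"])
    show "h \<in> borel_measurable \<mu>" by (rule continuous_measurable_Omega[OF h])
    show "?s N \<in> borel_measurable \<mu>" for N
      by measurable
    show "integrable \<mu> (\<lambda>x. B)"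
      using finite_measure.integrable_const[OF finite_measure_Omega] .
    have ev: "AE x in \<mu>. \<forall>N>0. grid N (cell N x) \<in> Omega"
      using AE_Omega_interior
    proof eventually_elim
      case (elim x)
      show ?case
      proof (intro allI impI)
        fix N :: nat assume N: "N > 0"
        have "cell N x \<in> {- int N..int N}" using cell_range[OF N, of x] elim by auto
        then show "grid N (cell N x) \<in> Omega" by (rule grid_in_Omega[OF N])
      qed
    qed
    then show "AE x in \<mu>. (\<lambda>N. ?s N x) \<longlonglongrightarrow> h x"
      using AE_Omega_interior
    proof eventually_elim
      case (elim x)
      then have "x \<in> Omega" by (auto simp: Omega_def)
      have "\<forall>\<^sub>F N in sequentially. grid N (cell N x) \<in> Omega"
        using eventually_gt_at_top[of "0::nat"] by eventually_elim (use elim in auto)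
      with h grid_cell_tendsto[of x 0, simplified] \<open>x \<in> Omega\<close>
      have "(\<lambda>N. h (grid N (cell N x))) \<longlonglongrightarrow> h x"
        by (rule continuous_on_tendsto_compose)
      then show ?case
      proof (rule Lim_transform_eventually)
        show "\<forall>\<^sub>F N in sequentially. h (grid N (cell N x)) = ?s N x"
          using eventually_gt_at_top[of "0::nat"] by eventually_elim simp
      qed
    qed
    from ev show "AE x in \<mu>. norm (?s N x) \<le> B" for N
      by (auto elim!: eventually_mono intro: B B0)
  qed
  moreover have "(LINT x|\<mu>. ?s N x) = (\<Sum>i\<in>cells N. eps N * h (grid N i))" for N
    using has_bochner_integral_cell[of N "\<lambda>i. h (grid N i)"] by (cases "N = 0") (auto simp: has_bochner_integral_iff)
  ultimately show ?thesis by simp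
qed

text \<open>The counterpart of \<open>diffq\<close> built from point values, without the periodic
  extension. For \<open>j = 1\<close> the two agree on \<open>cells N\<close>; for
  \<open>j = 2\<close> the last cell is excluded because its bond wraps around.\<close>

definition slope :: "nat \<Rightarrow> (real \<Rightarrow> real) \<Rightarrow> int \<Rightarrow> int \<Rightarrow> real" where
  "slope N Y j i = (Y (grid N (i + j)) - Y (grid N i)) / (real_of_int j * eps N)"

text \<open>For \<open>j \<ge> 1\<close> the lattice interval starting at the cell of
  \<open>x\<close> contains \<open>x\<close>, so the slope is a straddling difference quotient. The
  case \<open>j = 1\<close> serves the coarse slopes of the lower bound, \<open>j = 2\<close> the
  next-to-nearest neighbours of the upper bound.\<close>

lemma slope_tendsto:
  assumes p: "primitive g Y" and j: "j \<ge> 1"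
  shows "AE x in \<mu>. (\<lambda>N. slope N Y j (cell N x)) \<longlonglongrightarrow> g x"
  using primitive_AE_derivative[OF p]
proof eventually_elim
  case (elim x)
  have "(\<lambda>N. (Y (grid N (cell N x + j)) - Y (grid N (cell N x))) / (grid N (cell N x + j) - grid N (cell N x))) \<longlonglongrightarrow> g x"
  proof (rule straddle_tendsto[OF elim])
    have "grid N (cell N x) \<le> x \<and> x \<le> grid N (cell N x + j) \<and> grid N (cell N x) < grid N (cell N x + j)"
      if "N > 0" for N
      using cell_bounds[OF that, of x] grid_mono[of "cell N x + 1" "cell N x + j" N] j by auto
    then show "\<forall>\<^sub>F N in sequentially. grid N (cell N x) \<le> x \<and> x \<le> grid N (cell N x + j) \<and> grid N (cell N x) < grid N (cell N x + j)"
      using eventually_gt_at_top[of 0] by (rule eventually_mono[rotated])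
    show "(\<lambda>N. grid N (cell N x + j) - grid N (cell N x)) \<longlonglongrightarrow> 0"
      using tendsto_mult_right_zero[OF eps_tendsto, of "of_int j"] by (simp add: grid_add)
  qed
  then show ?case by (simp add: slope_def grid_add)
qed

section \<open>Piecewise affine interpolation\<close>

lemma sum_telescope_int:
  fixes F :: "int \<Rightarrow> 'a::ab_group_add"
  assumes "a \<le> b"
  shows "(\<Sum>i\<in>{a..<b}. F (i + 1) - F i) = F b - F a"
  using assms
proof (induction b rule: int_ge_induct)
  case (step b)
  have "{a..<b + 1} = insert b {a..<b}" using step.hyps by auto
  then show ?case using step.IH by simp
qed simp

text \<open>Each summand is a ramp that rises across its own cell and is constant elsewhere. In this
  form of the piecewise affine interpolant, continuity, and monotonicity for nonnegative slopes, can
  be read off term by term.\<close>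

definition interp :: "nat \<Rightarrow> (real \<Rightarrow> real) \<Rightarrow> real \<Rightarrow> real" where
  "interp N Y x = Y (-1/2) + (\<Sum>i\<in>cells N. slope N Y 1 i * max 0 (min (eps N) (x - grid N i)))"

lemma slope_times_eps: "N > 0 \<Longrightarrow> slope N Y 1 i * eps N = Y (grid N (i + 1)) - Y (grid N i)"
  using eps_pos[of N] by (simp add: slope_def)

lemma interp_eq:
  assumes N: "N > 0" and i: "i \<in> cells N" and x: "grid N i \<le> x" "x \<le> grid N (i + 1)"
  shows "interp N Y x = Y (grid N i) + slope N Y 1 i * (x - grid N i)"
proof -
  let ?t = "\<lambda>j. slope N Y 1 j * max 0 (min (eps N) (x - grid N j))"
  have e: "eps N > 0" using eps_pos[OF N] .
  have split: "cells N = {- int N..<i} \<union> ({i} \<union> {i<..int N - 1})"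
    using i by auto
  have "(\<Sum>j\<in>cells N. ?t j) = (\<Sum>j\<in>{- int N..<i}. ?t j) + (?t i + (\<Sum>j\<in>{i<..int N - 1}. ?t j))"
    unfolding split by (subst sum.union_disjoint; simp?)+ auto
  also have "(\<Sum>j\<in>{- int N..<i}. ?t j) = (\<Sum>j\<in>{- int N..<i}. Y (grid N (j + 1)) - Y (grid N j))"
  proof (rule sum.cong[OF refl])
    fix j assume "j \<in> {- int N..<i}"
    then have "grid N (j + 1) \<le> x" using grid_mono[of "j + 1" i N] x by auto
    then have "max 0 (min (eps N) (x - grid N j)) = eps N" using e by (simp add: grid_add)
    then show "?t j = Y (grid N (j + 1)) - Y (grid N j)" using slope_times_eps[OF N] by simp
  qed
  also have "\<dots> = Y (grid N i) - Y (grid N (- int N))"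
    using i by (intro sum_telescope_int) auto
  also have "(\<Sum>j\<in>{i<..int N - 1}. ?t j) = 0"
  proof (rule sum.neutral, rule ballI)
    fix j assume "j \<in> {i<..int N - 1}"
    then have "x \<le> grid N j" using grid_mono[of "i + 1" j N] x by auto
    then show "?t j = 0" using e by simp
  qed
  also have "?t i = slope N Y 1 i * (x - grid N i)"
    using x e by (simp add: grid_add)
  finally show ?thesis using grid_ends(1)[OF N] by (simp add: interp_def)
qed

lemma interp_grid:
  assumes N: "N > 0" and i: "i \<in> {- int N..int N}"
  shows "interp N Y (grid N i) = Y (grid N i)"
proof (cases "i = int N")
  case True
  then have "interp N Y (grid N i) = Y (grid N (int N - 1)) + slope N Y 1 (int N - 1) * (grid N i - grid N (int N - 1))"
    using N by (intro interp_eq) (auto intro: grid_mono)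
  moreover have "grid N i - grid N (int N - 1) = eps N"
    using True grid_add[of N "int N - 1" 1] by simp
  ultimately show ?thesis using slope_times_eps[OF N, of Y "int N - 1"] True by simp
next
  case False
  then show ?thesis using interp_eq[OF N, of i "grid N i" Y] i grid_mono[of i "i + 1" N] by simp
qed

lemma interp_continuous: "continuous_on S (interp N Y)"
  unfolding interp_def[abs_def] by (intro continuous_intros)

lemma interp_has_derivative:
  assumes N: "N > 0" and x: "-1/2 < x" "x < 1/2" "x \<notin> grid N ` {- int N..int N}"
  shows "(interp N Y has_real_derivative slope N Y 1 (cell N x)) (at x)"
proof -
  let ?i = "cell N x"
  have i: "?i \<in> cells N" using cell_range[OF N, of x] x by simp
  have "grid N ?i \<in> grid N ` {- int N..int N}" using i by (intro imageI) auto
  then have "grid N ?i \<noteq> x" using x(3) by metis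
  then have xi: "grid N ?i < x" "x < grid N (?i + 1)" using cell_bounds[OF N, of x] by auto
  have "((\<lambda>z. Y (grid N ?i) + slope N Y 1 ?i * (z - grid N ?i)) has_real_derivative slope N Y 1 ?i) (at x)"
    by (auto intro!: derivative_eq_intros)
  then show ?thesis
    by (rule has_field_derivative_transform_within_open[where S = "{grid N ?i<..<grid N (?i + 1)}"])
      (use xi interp_eq[OF N i] in auto)
qed

lemma test_function_facts:
  assumes "\<eta> \<in> test_functions"
  shows "(\<eta> has_real_derivative deriv \<eta> x) (at x)" "continuous_on S \<eta>" "continuous_on S (deriv \<eta>)"
    "\<eta> (-1/2) = 0" "\<eta> (1/2) = 0"
proof -
  have d: "(deriv ^^ n) \<eta> differentiable at x" for n x
    using assms by (auto simp: test_functions_def)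
  show D: "(\<eta> has_real_derivative deriv \<eta> x) (at x)" for x
    using d[of 0 x] by (simp add: DERIV_deriv_iff_real_differentiable)
  show "continuous_on S \<eta>"
    using DERIV_isCont[OF D] by (intro continuous_at_imp_continuous_on) auto
  show "continuous_on S (deriv \<eta>)"
    using d[of 1] by (intro continuous_at_imp_continuous_on ballI differentiable_imp_continuous_within) simp
  obtain K where K: "K \<subseteq> interior Omega" "\<And>x. x \<notin> K \<Longrightarrow> \<eta> x = 0"
    using assms by (auto simp: test_functions_def)
  have "-1/2 \<notin> K" "1/2 \<notin> K"
    using K(1) by (auto simp: Omega_def interior_atLeastAtMost_real)
  then show "\<eta> (-1/2) = 0" "\<eta> (1/2) = 0" using K(2) by auto
qed

text \<open>Integration by parts through the fundamental theorem of calculus with the nodes as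
  finite exceptional set; the boundary terms vanish because test functions vanish at the end
  points.\<close>

lemma interp_has_weak_deriv:
  assumes N: "N > 0"
  shows "has_weak_deriv (interp N Y) (\<lambda>x. slope N Y 1 (cell N x))"
  unfolding has_weak_deriv_def
proof
  fix \<eta> assume "\<eta> \<in> test_functions"
  note \<eta> = test_function_facts[OF this]
  let ?y = "interp N Y" and ?s = "\<lambda>x. slope N Y 1 (cell N x)"
  have "((\<lambda>x. ?y x * deriv \<eta> x + ?s x * \<eta> x) has_integral ?y (1/2) * \<eta> (1/2) - ?y (-1/2) * \<eta> (-1/2)) {-1/2..1/2}"
  proof (rule fundamental_theorem_of_calculus_interior_strong[where S = "grid N ` {- int N..int N}"])
    fix x :: real assume x: "x \<in> {-1/2<..<1/2} - grid N ` {- int N..int N}"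
    have "((\<lambda>x. ?y x * \<eta> x) has_real_derivative ?y x * deriv \<eta> x + ?s x * \<eta> x) (at x)"
      using DERIV_mult[OF interp_has_derivative[OF N] \<eta>(1), of x Y] x by (simp add: algebra_simps)
    then show "((\<lambda>x. ?y x * \<eta> x) has_vector_derivative ?y x * deriv \<eta> x + ?s x * \<eta> x) (at x)"
      by (simp add: has_real_derivative_iff_has_vector_derivative)
  qed (auto intro!: continuous_on_mult interp_continuous \<eta>(2))
  then have hi: "((\<lambda>x. ?y x * deriv \<eta> x + ?s x * \<eta> x) has_integral 0) Omega"
    using \<eta>(4,5) by (simp add: Omega_def)
  have i1: "integrable \<mu> (\<lambda>x. ?y x * deriv \<eta> x)"
    by (intro continuous_integrable_Omega continuous_on_mult interp_continuous \<eta>(3))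
  have i2: "integrable \<mu> (\<lambda>x. ?s x * \<eta> x)"
  proof -
    have s: "integrable \<mu> ?s"
      using has_bochner_integral_cell[OF N, of "slope N Y 1"] by (simp add: has_bochner_integral_iff)
    obtain B where B0: "B \<ge> 0" and B: "\<And>x. x \<in> Omega \<Longrightarrow> \<bar>\<eta> x\<bar> \<le> B"
      by (rule continuous_bounded_Omega[OF \<eta>(2)]) (rule that; assumption)
    show ?thesis
    proof (rule Bochner_Integration.integrable_bound)
      show "integrable \<mu> (\<lambda>x. \<bar>?s x\<bar> * B)" using s by simp
      show "(\<lambda>x. ?s x * \<eta> x) \<in> borel_measurable \<mu>"
        by (intro borel_measurable_times borel_measurable_integrable[OF s] continuous_measurable_Omega \<eta>(2))
      show "AE x in \<mu>. norm (?s x * \<eta> x) \<le> norm (\<bar>?s x\<bar> * B)"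
      proof (rule AE_I2)
        fix x assume "x \<in> space \<mu>"
        then have "\<bar>\<eta> x\<bar> \<le> B" by (intro B) simp
        then have "\<bar>\<eta> x\<bar> \<le> \<bar>B\<bar>" by linarith
        then show "norm (?s x * \<eta> x) \<le> norm (\<bar>?s x\<bar> * B)"
          by (simp add: abs_mult mult_left_mono)
      qed
    qed
  qed
  have "(LINT x|\<mu>. ?y x * deriv \<eta> x) + (LINT x|\<mu>. ?s x * \<eta> x)
      = (LINT x|\<mu>. ?y x * deriv \<eta> x + ?s x * \<eta> x)"
    using i1 i2 by simp
  also have "\<dots> = integral Omega (\<lambda>x. ?y x * deriv \<eta> x + ?s x * \<eta> x)"
    using i1 i2 by (intro lebesgue_integral_eq_integral) auto
  also have "\<dots> = 0" using hi by (rule integral_unique)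
  finally show "(LINT x|\<mu>. ?y x * deriv \<eta> x) = - (LINT x|\<mu>. ?s x * \<eta> x)"
    by linarith
qed

lemma continuous_in_L2: "continuous_on Omega h \<Longrightarrow> h \<in> L2_Omega"
  unfolding L2_Omega_def
  by (auto intro!: continuous_measurable_Omega continuous_integrable_Omega continuous_on_power)

lemma interp_admissible:
  assumes N: "N > 0" and Y: "Y (-1/2) = 0" "Y (1/2) = L"
  shows "interp N Y \<in> admissible_eps N L"
proof -
  have s: "(\<lambda>x. slope N Y 1 (cell N x)) \<in> L2_Omega"
    unfolding L2_Omega_def
    using has_bochner_integral_cell[OF N, of "slope N Y 1"] has_bochner_integral_cell[OF N, of "\<lambda>i. (slope N Y 1 i)\<^sup>2"]
    by (auto simp: has_bochner_integral_iff)
  have "interp N Y \<in> H1_Omega"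
    unfolding H1_Omega_def using s interp_has_weak_deriv[OF N] interp_continuous continuous_in_L2 by blast
  moreover have "interp N Y (-1/2) = 0" "interp N Y (1/2) = L"
    using interp_grid[OF N, of "- int N" Y] interp_grid[OF N, of "int N" Y] grid_ends[OF N] Y by simp_all
  moreover have "\<exists>a b. \<forall>x\<in>{grid N i<..<grid N (i + 1)}. interp N Y x = a * x + b" if "i \<in> cells N" for i
    using interp_eq[OF N that, of _ Y]
    by (intro exI[of _ "slope N Y 1 i"] exI[of _ "Y (grid N i) - slope N Y 1 i * grid N i"])
      (auto simp: algebra_simps)
  ultimately show ?thesis by (simp add: admissible_eps_def admissible_def)
qed

section \<open>Discrete energies\<close>

lemma diffq_slope:
  assumes "N > 0" "i \<in> cells N"
  shows "diffq N y 1 i = slope N y 1 i"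
proof -
  have "node N y i = y (grid N i)" "node N y (i + 1) = y (grid N (i + 1))"
    using assms by (intro node_eq; simp)+
  then show ?thesis by (simp add: diffq_def slope_def)
qed

lemma diffq_2: "diffq N y 2 i = (diffq N y 1 i + diffq N y 1 (i + 1)) / 2"
  by (simp add: diffq_def add_divide_distrib[symmetric] add.assoc)

lemma diffq_periodic:
  assumes "N > 0"
  shows "diffq N y 1 (2 * k * int N + i) = diffq N y 1 i"
  using node_periodic_increment[OF assms, of y k i] by (simp add: diffq_def)

text \<open>The definition of \<open>energy\<close> tests every integer index; periodicity reduces
  this to one period.\<close>

lemma diffq_pos:
  assumes N: "N > 0" and pos: "\<And>i. i \<in> cells N \<Longrightarrow> slope N y 1 i > 0"
  shows "diffq N y 1 i > 0"
proof -
  define k where "k = (i + int N) div (2 * int N)"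
  define j where "j = (i + int N) mod (2 * int N) - int N"
  have "i = 2 * k * int N + j"
    using div_mult_mod_eq[of "i + int N" "2 * int N"] unfolding k_def j_def by (simp add: algebra_simps)
  moreover have "j \<in> cells N"
    using N pos_mod_bound[of "2 * int N" "i + int N"] pos_mod_sign[of "2 * int N" "i + int N"] unfolding j_def by auto
  ultimately show ?thesis
    using diffq_periodic[OF N, of y k j] diffq_slope[OF N, of j y] pos[of j] by simp
qed

text \<open>The pure and defect energies as a real function of the nearest neighbour slopes
  \<open>p\<close>, with second difference quotients written as means. For positive slopes no
  infinite term occurs, so sums can be rearranged freely.\<close>

definition real_energy ::
  "(real \<Rightarrow> real) \<Rightarrow> (real \<Rightarrow> real) \<Rightarrow> (real \<Rightarrow> real) \<Rightarrow> (real \<Rightarrow> real) \<Rightarrow> nat \<Rightarrow> (int \<Rightarrow> real) \<Rightarrow> real" where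
  "real_energy F1 F2 G1 G2 N p =
     (\<Sum>i\<in>cells N. F1 (p i) + F2 ((p i + p (i + 1)) / 2))
     + (G2 ((p (-2) + p (-1)) / 2) - F2 ((p (-2) + p (-1)) / 2)
        + (G1 (p (-1)) - F1 (p (-1))) + (G1 (p 0) - F1 (p 0))
        + (G2 ((p 0 + p 1) / 2) - F2 ((p 0 + p 1) / 2)))"

lemma energy_eq_real_energy:
  assumes pos: "\<And>i. diffq N y 1 i > 0"
    and \<phi>1: "\<And>t. t > 0 \<Longrightarrow> \<phi>1 t = ereal (F1 t)" and \<psi>1: "\<And>t. t > 0 \<Longrightarrow> \<psi>1 t = ereal (G1 t)"
  shows "energy L \<phi>1 \<phi>2 \<psi>1 \<psi>2 f N y
    = ereal (real_energy F1 \<phi>2 G1 \<psi>2 N (diffq N y 1) + energy_force L f N y)"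
proof -
  have "\<not> (\<exists>i. diffq N y 1 i \<le> 0)" using pos by (auto simp: not_le)
  moreover have "energy_pure \<phi>1 \<phi>2 N y
      = ereal (\<Sum>i\<in>cells N. F1 (diffq N y 1 i) + \<phi>2 ((diffq N y 1 i + diffq N y 1 (i + 1)) / 2))"
    unfolding energy_pure_def using \<phi>1[OF pos] by (simp add: diffq_2)
  ultimately show ?thesis
    unfolding energy_def energy_defect_def real_energy_def
    using \<phi>1[OF pos] \<psi>1[OF pos] by (simp add: diffq_2)
qed

text \<open>By concavity, each next-to-nearest neighbour bond dominates the mean of its values at the two
  adjacent slopes. Splitting all bonds in this way leaves an energy per slope, which differs from
  the Cauchy--Born density only at the four slopes touched by the defect.\<close>

definition site_energy ::
  "(real \<Rightarrow> real) \<Rightarrow> (real \<Rightarrow> real) \<Rightarrow> (real \<Rightarrow> real) \<Rightarrow> (real \<Rightarrow> real) \<Rightarrow> int \<Rightarrow> real \<Rightarrow> real" where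
  "site_energy F1 F2 G1 G2 i t =
     (if i \<in> {-1, 0} then G1 t else F1 t) + (if i \<in> {-2, -1, 0, 1} then (F2 t + G2 t) / 2 else F2 t)"

lemma concave_on_midpoint:
  fixes F :: "real \<Rightarrow> real"
  assumes "concave_on {0<..} F" "s > 0" "t > 0"
  shows "F ((s + t) / 2) \<ge> F s / 2 + F t / 2"
  using concave_onD[OF assms(1), of "1/2" s t] assms(2,3) by (simp add: add_divide_distrib)

lemma sum_shift_int:
  fixes h :: "int \<Rightarrow> 'a::ab_group_add"
  assumes "a \<le> b"
  shows "(\<Sum>i\<in>{a..b}. h (i + 1)) = (\<Sum>i\<in>{a..b}. h i) + h (b + 1) - h a"
proof -
  have "(\<Sum>i\<in>{a..<b + 1}. h (i + 1) - h i) = h (b + 1) - h a"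
    using assms by (intro sum_telescope_int) simp
  moreover have "{a..<b + 1} = {a..b}" by auto
  ultimately show ?thesis by (simp add: sum_subtractf algebra_simps)
qed

text \<open>Each bond is split into two halves, one for each adjacent slope. Re-indexing the halves
  that belong to the right slope is free of boundary terms because the slopes are periodic.\<close>

lemma real_energy_ge_sites:
  assumes conc: "concave_on {0<..} F2" "concave_on {0<..} G2"
    and N: "N \<ge> 2" and pos: "\<And>i. p i > 0" and per: "p (int N) = p (- int N)"
  shows "(\<Sum>i\<in>cells N. site_energy F1 F2 G1 G2 i (p i)) \<le> real_energy F1 F2 G1 G2 N p"
proof -
  let ?I = "cells N"
  define b where "b i t = (if i \<in> {-2, 0::int} then G2 t else F2 t)" for i t
  define s where "s i t = (if i \<in> {-1, 0::int} then G1 t else F1 t)" for i t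
  let ?m = "\<lambda>i. (p i + p (i + 1)) / 2"
  have bond: "b i (p i) / 2 + b i (p (i + 1)) / 2 \<le> b i (?m i)" for i
    using concave_on_midpoint[OF conc(1) pos pos] concave_on_midpoint[OF conc(2) pos pos] by (simp add: b_def)
  have mem: "-2 \<in> ?I" "-1 \<in> ?I" "0 \<in> ?I" using N by auto
  have S: "(\<Sum>i\<in>?I. s i (p i)) = (\<Sum>i\<in>?I. F1 (p i)) + (G1 (p (-1)) - F1 (p (-1))) + (G1 (p 0) - F1 (p 0))"
  proof -
    have "s i (p i) = F1 (p i) + (if i = -1 then G1 (p (-1)) - F1 (p (-1)) else 0) + (if i = 0 then G1 (p 0) - F1 (p 0) else 0)" for i
      by (simp add: s_def)
    then show ?thesis using mem by (simp only: sum.distrib sum.delta' sum.delta finite_atLeastAtMost_int if_True)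
  qed
  have B: "(\<Sum>i\<in>?I. b i (?m i)) = (\<Sum>i\<in>?I. F2 (?m i)) + (G2 (?m (-2)) - F2 (?m (-2))) + (G2 (?m 0) - F2 (?m 0))"
  proof -
    have "b i (?m i) = F2 (?m i) + (if i = -2 then G2 (?m (-2)) - F2 (?m (-2)) else 0) + (if i = 0 then G2 (?m 0) - F2 (?m 0) else 0)" for i
      by (simp add: b_def)
    then show ?thesis using mem by (simp only: sum.distrib sum.delta' sum.delta finite_atLeastAtMost_int if_True)
  qed
  have shift: "(\<Sum>i\<in>?I. b i (p (i + 1)) / 2) = (\<Sum>i\<in>?I. b (i - 1) (p i) / 2)"
  proof -
    \<comment> \<open>Both are pure bonds: \<open>N \<ge> 2\<close> keeps the indices
      \<open>N - 1\<close> and \<open>- N - 1\<close> away from the defect bonds -2 and 0.\<close>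
    have "b (int N - 1) (p (int N)) = b (- int N - 1) (p (- int N))"
      using N per by (simp add: b_def)
    then show ?thesis
      using sum_shift_int[of "- int N" "int N - 1" "\<lambda>i. b (i - 1) (p i) / 2"] N by simp
  qed
  have site: "site_energy F1 F2 G1 G2 i t = s i t + (b i t / 2 + b (i - 1) t / 2)" for i t
    by (simp add: site_energy_def s_def b_def add_divide_distrib)
  have "(\<Sum>i\<in>?I. site_energy F1 F2 G1 G2 i (p i)) = (\<Sum>i\<in>?I. s i (p i)) + (\<Sum>i\<in>?I. b i (p i) / 2 + b i (p (i + 1)) / 2)"
    by (simp add: site sum.distrib shift)
  also have "\<dots> \<le> (\<Sum>i\<in>?I. s i (p i)) + (\<Sum>i\<in>?I. b i (?m i))"
    using bond by (intro add_left_mono sum_mono)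
  also have "\<dots> = real_energy F1 F2 G1 G2 N p"
    unfolding real_energy_def S B by (simp add: sum.distrib)
  finally show ?thesis .
qed

section \<open>Blocks of fine cells over a coarse grid\<close>

lemma sum_blocks_int:
  fixes j :: "int \<Rightarrow> int" and F :: "int \<Rightarrow> 'a::comm_monoid_add"
  assumes "a \<le> b" "\<And>k. j k \<le> j (k + 1)"
  shows "(\<Sum>i\<in>{j a..<j b}. F i) = (\<Sum>k\<in>{a..<b}. \<Sum>i\<in>{j k..<j (k + 1)}. F i)"
  using assms(1)
proof (induction b rule: int_ge_induct)
  case (step b)
  have mono: "j a \<le> j b" using step.hyps
  proof (induction b rule: int_ge_induct)
    case (step b)
    then show ?case using assms(2)[of b] by simp
  qed simp
  have "{a..<b + 1} = insert b {a..<b}" using step.hyps by auto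
  moreover have "{j a..<j (b + 1)} = {j a..<j b} \<union> {j b..<j (b + 1)}"
    using mono assms(2)[of b] by auto
  ultimately show ?case using step.IH by (simp add: sum.union_disjoint ivl_disj_int add.commute)
qed simp

text \<open>The index of the fine node at or just left of the coarse node \<open>k\<close>. Rounding
  is needed since \<open>N\<close> need not be a multiple of \<open>M\<close>.\<close>

definition block :: "nat \<Rightarrow> nat \<Rightarrow> int \<Rightarrow> int" where
  "block M N k = (k * int N) div int M"

lemma block_step: "block M N k \<le> block M N (k + 1)"
  unfolding block_def by (cases "M = 0") (auto intro!: zdiv_mono1 simp: distrib_right)

lemma block_ends: "M > 0 \<Longrightarrow> block M N (- int M) = - int N" "M > 0 \<Longrightarrow> block M N (int M) = int N"
  using nonzero_mult_div_cancel_left[of "int M" "- int N"] by (simp_all add: block_def)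

lemma block_range:
  assumes "M > 0" "k \<in> {- int M..int M}"
  shows "block M N k \<in> {- int N..int N}"
proof -
  have "(- int M * int N) div int M \<le> (k * int N) div int M" "(k * int N) div int M \<le> (int M * int N) div int M"
    using assms by (intro zdiv_mono1 mult_right_mono; simp)+
  then show ?thesis
    using assms(1) block_ends[of M N] by (simp add: block_def)
qed

text \<open>The gap is the remainder of \<open>k * N\<close> modulo \<open>M\<close> divided by
  \<open>2 * M * N\<close>; as the remainder is below \<open>M\<close>, one fine mesh width bounds
  it.\<close>

lemma block_grid:
  assumes "M > 0" "N > 0"
  shows "\<bar>grid N (block M N k) - grid M k\<bar> \<le> eps N"
proof -
  define q r where "q = block M N k" and "r = (k * int N) mod int M"
  have "k * int N = q * int M + r"
    unfolding q_def r_def block_def by simp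
  then have e: "real_of_int k * real N = real_of_int q * real M + real_of_int r"
    by (metis of_int_add of_int_mult of_int_of_nat_eq)
  have r: "0 \<le> r" "r < int M" using assms unfolding r_def by auto
  have r': "real_of_int r \<le> real M"
    using r(2) by linarith
  have "grid M k - grid N q = real_of_int r / (2 * real M * real N)"
    using assms e by (simp add: grid_def eps_def field_simps)
  moreover have "real_of_int r / (2 * real M * real N) \<le> eps N"
    using assms r' by (simp add: eps_def field_simps)
  moreover have "real_of_int r / (2 * real M * real N) \<ge> 0" using r assms by simp
  ultimately show ?thesis unfolding q_def by linarith
qed

text \<open>The scaled sum of the affine functions \<open>A k + B k * p\<close> over the cells of
  each block, where the slopes have already been telescoped. It involves \<open>v\<close> only at
  block ends, so it converges as soon as these values do.\<close>

abbreviation coarse_sum ::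
  "nat \<Rightarrow> nat \<Rightarrow> (int \<Rightarrow> real) \<Rightarrow> (int \<Rightarrow> real) \<Rightarrow> (int \<Rightarrow> real) \<Rightarrow> real" where
  "coarse_sum M N A B v \<equiv> \<Sum>k\<in>{- int M..<int M}. A k * (eps N * of_int (block M N (k + 1) - block M N k))
     + B k * (v (block M N (k + 1)) - v (block M N k))"

text \<open>An affine minorant in each block, telescoped. The penalty \<open>K\<close> is paid at
  four indices only, hence the error \<open>eps N * (4 * K)\<close>, which disappears as the lattice
  is refined.\<close>

lemma sum_affine_minorant:
  fixes A B :: "int \<Rightarrow> real" and v :: "int \<Rightarrow> real"
  assumes M: "M > 0" and N: "N \<ge> 2"
    and v: "\<And>i. i \<in> cells N \<Longrightarrow> v (i + 1) - v i = eps N * p i"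
    and h: "\<And>i k. i \<in> cells N \<Longrightarrow> k \<in> {- int M..<int M} \<Longrightarrow>
        A k + B k * p i - (if i \<in> {-2, -1, 0, 1} then K else 0) \<le> h i"
    and K: "K \<ge> 0"
  shows "coarse_sum M N A B v - eps N * (4 * K)
      \<le> eps N * (\<Sum>i\<in>cells N. h i)"
proof -
  let ?j = "block M N" and ?c = "\<lambda>i::int. if i \<in> {-2, -1, 0, 1} then K else 0"
  have N0: "N > 0" using N by simp
  have e0: "eps N > 0" using eps_pos[OF N0] .
  have I: "cells N = {?j (- int M)..<?j (int M)}"
    using block_ends[OF M] by auto
  have blk: "(\<Sum>i\<in>{?j k..<?j (k + 1)}. eps N * (h i + ?c i)) \<ge> A k * (eps N * of_int (?j (k + 1) - ?j k)) + B k * (v (?j (k + 1)) - v (?j k))"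
    if k: "k \<in> {- int M..<int M}" for k
  proof -
    have r: "i \<in> cells N" if "i \<in> {?j k..<?j (k + 1)}" for i
      using that block_range[OF M, of k N] block_range[OF M, of "k + 1" N] k by auto
    have "(\<Sum>i\<in>{?j k..<?j (k + 1)}. eps N * (h i + ?c i)) \<ge> (\<Sum>i\<in>{?j k..<?j (k + 1)}. A k * eps N + B k * (v (i + 1) - v i))"
    proof (rule sum_mono)
      fix i assume i: "i \<in> {?j k..<?j (k + 1)}"
      have "A k + B k * p i \<le> h i + ?c i" using h[OF r[OF i] k] by simp
      then have "eps N * (A k + B k * p i) \<le> eps N * (h i + ?c i)" using e0 by (intro mult_left_mono) auto
      then show "A k * eps N + B k * (v (i + 1) - v i) \<le> eps N * (h i + ?c i)"
        unfolding v[OF r[OF i]] by (simp add: algebra_simps)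
    qed
    also have "(\<Sum>i\<in>{?j k..<?j (k + 1)}. A k * eps N + B k * (v (i + 1) - v i))
        = A k * (eps N * of_int (?j (k + 1) - ?j k)) + B k * (v (?j (k + 1)) - v (?j k))"
      using block_step[of M N k]
      by (simp add: sum.distrib sum_distrib_left[symmetric] sum_telescope_int)
    finally show ?thesis .
  qed
  have "(\<Sum>k\<in>{- int M..<int M}. A k * (eps N * of_int (?j (k + 1) - ?j k)) + B k * (v (?j (k + 1)) - v (?j k)))
      \<le> (\<Sum>k\<in>{- int M..<int M}. \<Sum>i\<in>{?j k..<?j (k + 1)}. eps N * (h i + ?c i))"
    by (intro sum_mono blk)
  also have "\<dots> = (\<Sum>i\<in>cells N. eps N * (h i + ?c i))"
    unfolding I by (rule sum_blocks_int[symmetric]) (use block_step in auto)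
  also have "\<dots> = eps N * (\<Sum>i\<in>cells N. h i) + eps N * (\<Sum>i\<in>cells N. ?c i)"
    by (simp only: sum_distrib_left[symmetric] sum.distrib distrib_left)
  also have "(\<Sum>i\<in>cells N. ?c i) = (\<Sum>i\<in>{-2, -1, 0, 1 :: int}. K)"
    by (rule sum.mono_neutral_cong_right) (use N in auto)
  finally show ?thesis by simp
qed

section \<open>Uniform convergence of monotone sequences\<close>

lemma uniform_limit_compose_tendsto:
  fixes z :: "nat \<Rightarrow> real \<Rightarrow> real"
  assumes z: "uniform_limit S z y sequentially" and y: "continuous_on S y"
    and x: "x \<longlonglongrightarrow> l" "l \<in> S" "\<forall>\<^sub>F N in sequentially. x N \<in> S"
  shows "(\<lambda>N. z N (x N)) \<longlonglongrightarrow> y l"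
proof (rule tendstoI)
  fix e :: real assume e: "e > 0"
  have "(\<lambda>N. y (x N)) \<longlonglongrightarrow> y l" using y x by (rule continuous_on_tendsto_compose)
  then have "\<forall>\<^sub>F N in sequentially. dist (y (x N)) (y l) < e / 2" using e by (intro tendstoD) auto
  moreover have "\<forall>\<^sub>F N in sequentially. \<forall>t\<in>S. dist (z N t) (y t) < e / 2"
    using e by (intro uniform_limitD[OF z]) auto
  ultimately show "\<forall>\<^sub>F N in sequentially. dist (z N (x N)) (y l) < e"
    using x(3) by eventually_elim (metis dist_triangle_half_r dist_commute)
qed

lemma block_grid_tendsto:
  assumes "M > 0"
  shows "(\<lambda>N. grid N (block M N k)) \<longlonglongrightarrow> grid M k"
proof (rule LIM_zero_cancel, rule Lim_null_comparison[OF _ eps_tendsto])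
  show "\<forall>\<^sub>F N in sequentially. norm (grid N (block M N k) - grid M k) \<le> eps N"
    using eventually_gt_at_top[of "0::nat"]
    by eventually_elim (use block_grid[OF assms] in simp)
qed

lemma affine_sum_tendsto:
  fixes A B :: "int \<Rightarrow> real"
  assumes M: "M > 0" and z: "uniform_limit Omega z y sequentially" and y: "continuous_on Omega y"
  shows "(\<lambda>N. coarse_sum M N A B (\<lambda>i. z N (grid N i)) - eps N * (4 * K))
    \<longlonglongrightarrow> (\<Sum>k\<in>{- int M..<int M}. eps M * (A k + B k * slope M y 1 k))"
proof -
  have len: "(\<lambda>N. eps N * of_int (block M N (k + 1) - block M N k)) \<longlonglongrightarrow> eps M" for k
  proof -
    have "(\<lambda>N. grid N (block M N (k + 1)) - grid N (block M N k)) \<longlonglongrightarrow> grid M (k + 1) - grid M k"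
      by (intro tendsto_diff block_grid_tendsto M)
    moreover have "grid N (block M N (k + 1)) - grid N (block M N k) = eps N * of_int (block M N (k + 1) - block M N k)" for N
      by (simp add: grid_def algebra_simps)
    ultimately show ?thesis by (simp add: grid_add)
  qed
  have val: "(\<lambda>N. z N (grid N (block M N k))) \<longlonglongrightarrow> y (grid M k)" if "k \<in> {- int M..int M}" for k
  proof (rule uniform_limit_compose_tendsto[OF z y block_grid_tendsto[OF M]])
    show "grid M k \<in> Omega" using grid_in_Omega[OF M that] .
    show "\<forall>\<^sub>F N in sequentially. grid N (block M N k) \<in> Omega"
      using eventually_gt_at_top[of "0::nat"]
      by eventually_elim (use block_range[OF M that] grid_in_Omega in blast)
  qed
  have "(\<lambda>N. coarse_sum M N A B (\<lambda>i. z N (grid N i)) - eps N * (4 * K))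
    \<longlonglongrightarrow> (\<Sum>k\<in>{- int M..<int M}. A k * eps M + B k * (y (grid M (k + 1)) - y (grid M k))) - 0 * (4 * K)"
    by (intro tendsto_diff tendsto_sum tendsto_add tendsto_mult tendsto_const len val eps_tendsto) auto
  also have "(\<Sum>k\<in>{- int M..<int M}. A k * eps M + B k * (y (grid M (k + 1)) - y (grid M k))) - 0 * (4 * K)
    = (\<Sum>k\<in>{- int M..<int M}. eps M * (A k + B k * slope M y 1 k))"
    unfolding slope_times_eps[OF M, symmetric] by (simp add: algebra_simps)
  finally show ?thesis .
qed

text \<open>If a monotone \<open>z N\<close> exceeds \<open>y\<close> by \<open>e\<close> at some
  point, it exceeds \<open>y\<close> by \<open>e / 2\<close> on an interval of length
  \<open>d\<close> to the right of that point (to the left if it lies below), which costs at least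
  \<open>q\<close> in the squared norm. Where this interval would leave \<open>Omega\<close>, the
  common boundary value already contradicts the gap. The alternative \<open>z N = y\<close> admits
  sequences in which unsuitable members have been replaced by the limit.\<close>

lemma mono_L2_imp_uniform:
  assumes y: "continuous_on Omega y"
    and z: "\<And>N. continuous_on Omega (z N)" "\<And>N. mono_on Omega (z N) \<or> z N = y"
    and ends: "\<And>N. z N (-1/2) = y (-1/2)" "\<And>N. z N (1/2) = y (1/2)"
    and conv: "L2_converges z y"
  shows "uniform_limit Omega z y sequentially"
proof (rule uniform_limitI)
  fix e :: real assume e: "e > 0"
  have "uniformly_continuous_on Omega y"
    using y by (intro compact_uniformly_continuous) (simp_all add: Omega_def)
  then obtain r where r: "r > 0" "\<And>s t. s \<in> Omega \<Longrightarrow> t \<in> Omega \<Longrightarrow> \<bar>s - t\<bar> < r \<Longrightarrow> \<bar>y s - y t\<bar> < e / 2"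
    using e unfolding uniformly_continuous_on_def dist_real_def by (meson half_gt_zero)
  define d where "d = r / 2"
  have d: "d > 0" "\<And>s t. s \<in> Omega \<Longrightarrow> t \<in> Omega \<Longrightarrow> \<bar>s - t\<bar> \<le> d \<Longrightarrow> \<bar>y s - y t\<bar> < e / 2"
    using r by (auto simp: d_def)
  define q where "q = d * (e / 2)\<^sup>2"
  have q: "q > 0" using d e by (simp add: q_def)
  have low: "q \<le> (LINT x|\<mu>. (z N x - y x)\<^sup>2)"
    if a: "-1/2 \<le> a" "a + d \<le> 1/2" and ge: "\<And>t. a \<le> t \<Longrightarrow> t \<le> a + d \<Longrightarrow> e / 2 \<le> \<bar>z N t - y t\<bar>" for N a
  proof -
    have sub: "{a..a + d} \<subseteq> Omega" using a by (auto simp: Omega_def)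
    have s: "{a..a + d} \<in> sets \<mu>"
      using sub by (simp add: sets_restrict_space_iff)
    have m: "measure \<mu> {a..a + d} = d"
      using sub d by (simp add: measure_restrict_space)
    have h: "has_bochner_integral \<mu> (\<lambda>x. indicator {a..a + d} x *\<^sub>R (e / 2)\<^sup>2)
        (measure \<mu> {a..a + d} *\<^sub>R (e / 2)\<^sup>2)"
      by (rule has_bochner_integral_indicator[OF s]) (use sub d in \<open>simp add: emeasure_restrict_space\<close>)
    have "q = (LINT x|\<mu>. indicator {a..a + d} x *\<^sub>R (e / 2)\<^sup>2)"
      unfolding has_bochner_integral_integral_eq[OF h] m q_def by simp
    also have "\<dots> \<le> (LINT x|\<mu>. (z N x - y x)\<^sup>2)"
    proof (rule integral_mono)
      show "integrable \<mu> (\<lambda>x. indicator {a..a + d} x *\<^sub>R (e / 2)\<^sup>2)"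
        using h unfolding has_bochner_integral_iff by (rule conjunct1)
      show "integrable \<mu> (\<lambda>x. (z N x - y x)\<^sup>2)"
        by (intro continuous_integrable_Omega continuous_intros z y)
      fix x
      have "(e / 2)\<^sup>2 \<le> (z N x - y x)\<^sup>2" if "x \<in> {a..a + d}"
        using power_mono[OF ge[of x], of 2] that e by simp
      then show "indicator {a..a + d} x *\<^sub>R (e / 2)\<^sup>2 \<le> (z N x - y x)\<^sup>2"
        by (simp add: indicator_def)
    qed
    finally show ?thesis .
  qed
  have close: "dist (z N x) (y x) < e" if small: "(LINT x|\<mu>. (z N x - y x)\<^sup>2) < q" and x: "x \<in> Omega" for N x
  proof (rule ccontr)
    assume far: "\<not> dist (z N x) (y x) < e"
    then have "z N \<noteq> y" using e by auto
    then have mono: "mono_on Omega (z N)" using z(2) by blast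
    from far
    consider "z N x \<ge> y x + e" | "z N x \<le> y x - e" unfolding dist_real_def by linarith
    then show False
    proof cases
      case 1
      show False
      proof (cases "x + d \<le> 1/2")
        case True
        have "e / 2 \<le> \<bar>z N t - y t\<bar>" if t: "x \<le> t" "t \<le> x + d" for t
        proof -
          have tO: "t \<in> Omega" using t x True by (auto simp: Omega_def)
          have "z N x \<le> z N t" using mono x tO t(1) by (rule mono_onD)
          moreover have "\<bar>y t - y x\<bar> < e / 2" using t by (intro d(2) x tO) auto
          ultimately show ?thesis using 1 by linarith
        qed
        then have "q \<le> (LINT x|\<mu>. (z N x - y x)\<^sup>2)"
          using x True by (intro low[of x]) (auto simp: Omega_def)
        then show False using small by simp
      next
        case False
        have h: "1/2 \<in> Omega" by (simp add: Omega_def)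
        have "z N x \<le> z N (1/2)" using mono x h by (rule mono_onD) (use x in \<open>simp add: Omega_def\<close>)
        moreover have "\<bar>y (1/2) - y x\<bar> < e / 2" using False x by (intro d(2) x h) (auto simp: Omega_def)
        ultimately show False using 1 ends(2)[of N] e by linarith
      qed
    next
      case 2
      show False
      proof (cases "-1/2 \<le> x - d")
        case True
        have "e / 2 \<le> \<bar>z N t - y t\<bar>" if t: "x - d \<le> t" "t \<le> x - d + d" for t
        proof -
          have tO: "t \<in> Omega" using t x True by (auto simp: Omega_def)
          have "z N t \<le> z N x" using mono tO x by (rule mono_onD) (use t in simp)
          moreover have "\<bar>y t - y x\<bar> < e / 2" using t by (intro d(2) x tO) auto
          ultimately show ?thesis using 2 by linarith
        qed
        then have "q \<le> (LINT x|\<mu>. (z N x - y x)\<^sup>2)"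
          using x True by (intro low[of "x - d"]) (auto simp: Omega_def)
        then show False using small by simp
      next
        case False
        have h: "-1/2 \<in> Omega" by (simp add: Omega_def)
        have "z N (-1/2) \<le> z N x" using mono h x by (rule mono_onD) (use x in \<open>simp add: Omega_def\<close>)
        moreover have "\<bar>y (-1/2) - y x\<bar> < e / 2" using False x by (intro d(2) x h) (auto simp: Omega_def)
        ultimately show False using 2 ends(1)[of N] e by linarith
      qed
    qed
  qed
  have "\<forall>\<^sub>F N in sequentially. dist (sqrt (LINT x|\<mu>. (z N x - y x)\<^sup>2)) 0 < sqrt q"
    using conv[unfolded L2_converges_def] q by (intro tendstoD) auto
  then show "\<forall>\<^sub>F N in sequentially. \<forall>x\<in>Omega. dist (z N x) (y x) < e"
  proof eventually_elim
    case (elim N)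
    then have "(LINT x|\<mu>. (z N x - y x)\<^sup>2) < q"
      by (simp add: dist_real_def abs_less_iff)
    then show ?case using close by blast
  qed
qed

text \<open>Affinity is given on open cells only; continuity extends it to the nodes, and the two
  end values then determine the coefficients.\<close>

lemma admissible_eps_eq_interp:
  assumes N: "N > 0" and y: "y \<in> admissible_eps N L" and x: "x \<in> Omega"
  shows "y x = interp N y x"
proof (cases "x = 1/2")
  case True
  show ?thesis unfolding True using interp_grid[OF N, of "int N" y] N unfolding grid_ends(2)[OF N] by simp
next
  case False
  let ?i = "cell N x"
  let ?a = "grid N ?i" and ?b = "grid N (?i + 1)"
  have "-1/2 \<le> x" "x \<le> 1/2" using x unfolding Omega_def by auto
  then have i: "?i \<in> cells N"
    using False by (intro cell_range[OF N]) linarith+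
  have xi: "?a \<le> x" "x < ?b" using cell_bounds[OF N] by auto
  have "\<forall>i\<in>cells N. \<exists>a b. \<forall>t\<in>{grid N i<..<grid N (i + 1)}. y t = a * t + b"
    using y unfolding admissible_eps_def by (rule CollectE) (rule conjunct2)
  from this[rule_format, OF i] obtain a b where "\<forall>t\<in>{?a<..<?b}. y t = a * t + b"
    by (elim exE)
  then have ab: "y t = a * t + b" if "t \<in> {?a<..<?b}" for t
    using that by (rule bspec)
  have "?a \<in> Omega" "?b \<in> Omega"
    using i by (intro grid_in_Omega[OF N]; simp)+
  then have sub: "{?a..?b} \<subseteq> Omega" by (auto simp: Omega_def)
  have "continuous_on Omega y" using y by (auto simp: admissible_eps_def admissible_def H1_Omega_def)
  then have c: "continuous_on {?a..?b} (\<lambda>t. y t - (a * t + b))"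
    using sub by (intro continuous_intros) (rule continuous_on_subset)
  have cl: "closure {?a<..<?b} = {?a..?b}"
    using xi by (intro closure_greaterThanLessThan) simp
  have eq: "y t = a * t + b" if "t \<in> {?a..?b}" for t
  proof -
    have "y t - (a * t + b) = 0"
      by (rule continuous_constant_on_closure[of "{?a<..<?b}" "\<lambda>t. y t - (a * t + b)" 0])
        (simp only: cl c, simp add: ab, simp only: cl that)
    then show ?thesis by simp
  qed
  have ends: "y ?a = a * ?a + b" "y ?b = a * ?b + b" using xi by (intro eq; simp)+
  have g1: "?b = ?a + eps N" by (simp add: grid_add)
  have "slope N y 1 ?i * eps N = a * eps N"
    unfolding slope_times_eps[OF N] ends unfolding g1 by (simp add: algebra_simps)
  then have "slope N y 1 ?i = a" using eps_pos[OF N] by simp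
  then show ?thesis
    using interp_eq[OF N i xi(1), of y] xi(2) eq[of x] ends(1) xi(1) by (simp add: algebra_simps)
qed

lemma interp_mono:
  assumes "N > 0" and "\<And>i. i \<in> cells N \<Longrightarrow> slope N Y 1 i \<ge> 0"
  shows "mono_on S (interp N Y)"
  unfolding interp_def[abs_def]
  by (intro mono_onI add_left_mono sum_mono mult_left_mono assms max.mono min.mono) auto

lemma admissible_eps_mono:
  assumes "N > 0" "y \<in> admissible_eps N L" and "\<And>i. i \<in> cells N \<Longrightarrow> slope N y 1 i > 0"
  shows "mono_on Omega y"
  using interp_mono[OF assms(1), of y Omega] assms(3) admissible_eps_eq_interp[OF assms(1,2)]
  by (fastforce simp: monotone_on_def less_imp_le)

text \<open>Write H = w + u. For a large constant c the identity H^+ + c = (w + K) + (u - K + c) +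
  H^- has only nonnegative terms, so it may be integrated term by term even where \<open>w\<close>
  is infinite. The negative part H^- is bounded, hence its integral is finite and can be
  subtracted.\<close>

lemma ereal_integral_split:
  assumes m: "(\<lambda>x. w x) \<in> borel_measurable \<mu>"
    and low: "\<And>x. x \<in> Omega \<Longrightarrow> w x \<ge> - ereal K" and u: "continuous_on Omega u"
  shows "ereal_integral \<mu> (\<lambda>x. w x + ereal (u x))
    = enn2ereal (\<integral>\<^sup>+ x. e2ennreal (w x + ereal K) \<partial>\<mu>) + ereal ((LINT x|\<mu>. u x) - K)"
proof -
  obtain B where B0: "B \<ge> 0" and B: "\<And>x. x \<in> Omega \<Longrightarrow> \<bar>u x\<bar> \<le> B"
    by (rule continuous_bounded_Omega[OF u]) (rule that; assumption)
  have um: "u \<in> borel_measurable \<mu>" using u by (rule continuous_measurable_Omega)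
  have ui: "integrable \<mu> u" using u by (rule continuous_integrable_Omega)
  define H where "H x = w x + ereal (u x)" for x
  have Hm: "H \<in> borel_measurable \<mu>" unfolding H_def using m um by measurable
  \<comment> \<open>Large enough for both \<open>u x - K + c \<ge> 0\<close> and
    \<open>- H x \<le> c\<close>.\<close>
  define c where "c = \<bar>K\<bar> + \<bar>B\<bar>"
  have c0: "c \<ge> 0" by (simp add: c_def)
  have pt: "e2ennreal (H x) + ennreal c = e2ennreal (w x + ereal K) + ennreal (u x - K + c) + e2ennreal (- H x)"
    if x: "x \<in> Omega" for x
  proof (cases "w x")
    case (real t)
    have t: "t + K \<ge> 0" using low[OF x] by (simp add: real)
    have b: "u x - K + c \<ge> 0" using B[OF x] unfolding c_def by linarith
    have "ennreal (t + u x) + ennreal c = ennreal (t + K) + ennreal (u x - K + c) + ennreal (- (t + u x))"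
    proof (cases "t + u x \<ge> 0")
      case True
      then show ?thesis using t b c0 by (simp add: ennreal_neg flip: ennreal_plus)
    next
      case False
      then show ?thesis using t b c0 by (simp add: ennreal_neg flip: ennreal_plus)
    qed
    then show ?thesis by (simp add: H_def real e2ennreal_ereal)
  next
    case PInf
    then show ?thesis by (simp add: H_def)
  next
    case MInf
    then show ?thesis using low[OF x] by simp
  qed
  have ci: "integrable \<mu> (\<lambda>x. a)" for a :: real
    by (rule finite_measure.integrable_const[OF finite_measure_Omega])
  have uc: "integrable \<mu> (\<lambda>x. u x - K + c)"
    by (intro Bochner_Integration.integrable_add Bochner_Integration.integrable_diff ui ci)
  have uI: "(LINT x|\<mu>. u x - K + c) = (LINT x|\<mu>. u x) - K + c"
  proof -
    have "measure \<mu> Omega = 1" by (simp add: measure_def emeasure_Omega)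
    then have "(LINT x|\<mu>. a) = a" for a :: real by (simp only: lebesgue_integral_const space_Omega) simp
    then show ?thesis
      using ui ci by (simp only: Bochner_Integration.integral_add Bochner_Integration.integral_diff Bochner_Integration.integrable_diff)
  qed
  have u0: "0 \<le> u x - K + c" if "x \<in> Omega" for x
    using B[OF that] unfolding c_def by linarith
  have cint: "(\<integral>\<^sup>+ x. ennreal c \<partial>\<mu>) = ennreal c"
    by (simp add: emeasure_Omega)
  have unn: "(\<integral>\<^sup>+ x. ennreal (u x - K + c) \<partial>\<mu>) = ennreal ((LINT x|\<mu>. u x) - K + c)"
  proof -
    have "AE x in \<mu>. 0 \<le> u x - K + c" by (rule AE_I2) (simp add: u0)
    from nn_integral_eq_integral[OF uc this] show ?thesis unfolding uI .
  qed
  have cI: "0 \<le> (LINT x|\<mu>. u x) - K + c"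
    unfolding uI[symmetric] by (rule Bochner_Integration.integral_nonneg) (simp add: u0)
  have neg: "(\<integral>\<^sup>+ x. e2ennreal (- H x) \<partial>\<mu>) \<le> ennreal c"
  proof -
    have "(\<integral>\<^sup>+ x. e2ennreal (- H x) \<partial>\<mu>) \<le> (\<integral>\<^sup>+ x. ennreal c \<partial>\<mu>)"
    proof (rule nn_integral_mono)
      fix x assume "x \<in> space \<mu>"
      then have x: "x \<in> Omega" by simp
      have "- H x \<le> ereal c"
        using low[OF x] B[OF x] unfolding H_def c_def by (cases "w x") auto
      then have "e2ennreal (- H x) \<le> e2ennreal (ereal c)" by (rule e2ennreal_mono)
      then show "e2ennreal (- H x) \<le> ennreal c" by (simp add: e2ennreal_ereal)
    qed
    then show ?thesis using cint by simp
  qed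
  have "(\<integral>\<^sup>+ x. e2ennreal (H x) + ennreal c \<partial>\<mu>)
      = (\<integral>\<^sup>+ x. e2ennreal (w x + ereal K) + ennreal (u x - K + c) + e2ennreal (- H x) \<partial>\<mu>)"
    using pt by (intro nn_integral_cong) simp
  then have "(\<integral>\<^sup>+ x. e2ennreal (H x) \<partial>\<mu>) + ennreal c
      = (\<integral>\<^sup>+ x. e2ennreal (w x + ereal K) \<partial>\<mu>) + ennreal ((LINT x|\<mu>. u x) - K + c) + (\<integral>\<^sup>+ x. e2ennreal (- H x) \<partial>\<mu>)"
    using Hm m um by (simp add: nn_integral_add unn cint emeasure_Omega)
  moreover have "(\<integral>\<^sup>+ x. e2ennreal (- H x) \<partial>\<mu>) < top"
    using neg by (rule le_less_trans) simp
  then obtain n where n: "(\<integral>\<^sup>+ x. e2ennreal (- H x) \<partial>\<mu>) = ennreal n" "n \<ge> 0"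
    unfolding less_top_ennreal by blast
  ultimately have "(\<integral>\<^sup>+ x. e2ennreal (H x) \<partial>\<mu>) + ennreal c
      = (\<integral>\<^sup>+ x. e2ennreal (w x + ereal K) \<partial>\<mu>) + ennreal ((LINT x|\<mu>. u x) - K + c) + ennreal n"
    by (simp only:)
  from arg_cong[OF this, of enn2ereal] have "enn2ereal (\<integral>\<^sup>+ x. e2ennreal (H x) \<partial>\<mu>) + ereal c
      = enn2ereal (\<integral>\<^sup>+ x. e2ennreal (w x + ereal K) \<partial>\<mu>) + ereal ((LINT x|\<mu>. u x) - K + c) + ereal n"
    using c0 cI n(2) by (simp only: enn2ereal_ennreal plus_ennreal.rep_eq)
  then show ?thesis
    unfolding ereal_integral_def H_def[symmetric] n(1) using n(2)
    by (cases "enn2ereal (\<integral>\<^sup>+ x. e2ennreal (H x) \<partial>\<mu>)"; cases "enn2ereal (\<integral>\<^sup>+ x. e2ennreal (w x + ereal K) \<partial>\<mu>)")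
      (auto simp: enn2ereal_ennreal algebra_simps)
qed

section \<open>The lower bound\<close>

text \<open>\<open>F1\<close> and \<open>G1\<close> stand for the finite parts of \<phi>1 and
  \<psi>1, \<open>F2\<close> and \<open>G2\<close> for \<phi>2 and \<psi>2. Convexity enters through
  its consequences, supporting lines and superlinear growth, so the variational argument never
  differentiates; \<open>W'\<close> is a choice of supporting slopes for
  \<open>F1 + F2\<close>.\<close>

locale defect_potentials =
  fixes F1 F2 G1 G2 W' :: "real \<Rightarrow> real" and \<alpha> C :: real
  assumes alpha: "0 < \<alpha>" "\<alpha> < 1"
    and conc: "concave_on {0<..} F2" "concave_on {0<..} G2"
    and growth: "\<And>t. t > 0 \<Longrightarrow> F2 t \<ge> - \<alpha> * F1 t + C" "\<And>t. t > 0 \<Longrightarrow> F2 t \<ge> - \<alpha> * G1 t + C"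
      "\<And>t. t > 0 \<Longrightarrow> G2 t \<ge> - \<alpha> * F1 t + C" "\<And>t. t > 0 \<Longrightarrow> G2 t \<ge> - \<alpha> * G1 t + C"
    and superlinear: "\<And>B. \<exists>K. \<forall>t>0. B * t - K \<le> F1 t" "\<And>B. \<exists>K. \<forall>t>0. B * t - K \<le> G1 t"
    and cont: "continuous_on {0<..} F1" "continuous_on {0<..} F2"
    and tangent: "\<And>s t. s > 0 \<Longrightarrow> t > 0 \<Longrightarrow> F1 s + F2 s + W' s * (t - s) \<le> F1 t + F2 t"
    and F1_tangent: "\<And>s. s > 0 \<Longrightarrow> \<exists>b. \<forall>t>0. F1 s + b * (t - s) \<le> F1 t"
    and F2_upper: "\<exists>a b. \<forall>t>0. F2 t \<le> a + b * t"
    and F1_blowup: "filterlim F1 at_top (at_right 0)"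
begin

definition W :: "real \<Rightarrow> real" where "W t = F1 t + F2 t"

definition W_ext :: "real \<Rightarrow> ereal" where "W_ext t = (if t > 0 then ereal (W t) else \<infinity>)"

lemma W_ge_F1: "t > 0 \<Longrightarrow> W t \<ge> (1 - \<alpha>) * F1 t + C"
  using growth(1)[of t] by (simp add: W_def algebra_simps)

lemma W_cont: "continuous_on {0<..} W"
  unfolding W_def[abs_def] using cont by (intro continuous_intros)

text \<open>After the next-to-nearest neighbour term has consumed the fraction \<alpha> of a nearest
  neighbour potential, the fraction \<open>1 - \<alpha>\<close> still dominates every linear
  function.\<close>

lemma scaled_superlinear:
  assumes "\<And>B. \<exists>K. \<forall>t>0. B * t - K \<le> X t"
  shows "\<exists>K\<ge>0. \<forall>t>0. B * t - K \<le> (1 - \<alpha>) * X t"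
proof -
  obtain K where K: "\<forall>t>0. B / (1 - \<alpha>) * t - K \<le> X t" using assms by blast
  have "B * t - max 0 ((1 - \<alpha>) * K) \<le> (1 - \<alpha>) * X t" if "t > 0" for t
  proof -
    have "(1 - \<alpha>) * (B / (1 - \<alpha>) * t - K) \<le> (1 - \<alpha>) * X t"
      using K that alpha by (intro mult_left_mono) auto
    then have "B * t - (1 - \<alpha>) * K \<le> (1 - \<alpha>) * X t" using alpha by (simp add: right_diff_distrib)
    then show ?thesis by linarith
  qed
  then show ?thesis by (intro exI[of _ "max 0 ((1 - \<alpha>) * K)"]) auto
qed

text \<open>Away from the defect the site energy is \<open>W\<close> itself. At the four exceptional
  sites the mean of \<open>F2\<close> and \<open>G2\<close> inherits their common lower bound, in
  terms of \<open>G1\<close> at -1 and 0 and of \<open>F1\<close> at -2 and 1; superlinear growth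
  then beats the slope \<open>B\<close> up to a constant.\<close>

lemma site_energy_ge_affine:
  assumes "\<And>t. t > 0 \<Longrightarrow> A + B * t \<le> W t"
  shows "\<exists>K\<ge>0. \<forall>i. \<forall>t>0. A + B * t - (if i \<in> {-2, -1, 0, 1} then K else 0) \<le> site_energy F1 F2 G1 G2 i t"
proof -
  obtain K1 where K1: "K1 \<ge> 0" "\<And>t. t > 0 \<Longrightarrow> B * t - K1 \<le> (1 - \<alpha>) * F1 t"
    using scaled_superlinear[OF superlinear(1)] by blast
  obtain K2 where K2: "K2 \<ge> 0" "\<And>t. t > 0 \<Longrightarrow> B * t - K2 \<le> (1 - \<alpha>) * G1 t"
    using scaled_superlinear[OF superlinear(2)] by blast
  define K where "K = \<bar>A\<bar> + \<bar>C\<bar> + K1 + K2"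
  have "A + B * t - (if i \<in> {-2, -1, 0, 1} then K else 0) \<le> site_energy F1 F2 G1 G2 i t" if t: "t > 0" for i t
  proof -
    have split: "(1 - \<alpha>) * X + C = X + (- \<alpha> * X + C)" for X by (simp add: algebra_simps)
    have avg: "X \<le> (u + v) / 2" if "X \<le> u" "X \<le> v" for X u v :: real using that by simp
    consider "i \<in> {-1, 0}" | "i \<in> {-2, 1}" | "i \<notin> {-2, -1, 0, 1}" by auto
    then show ?thesis
    proof cases
      case 1
      have "(1 - \<alpha>) * G1 t + C \<le> G1 t + (F2 t + G2 t) / 2"
        unfolding split by (rule add_left_mono[OF avg[OF growth(2)[OF t] growth(4)[OF t]]])
      then have "A + B * t - K \<le> G1 t + (F2 t + G2 t) / 2"
        using K2(2)[OF t] K1(1) K2(1) unfolding K_def by linarith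
      then show ?thesis using 1 by (auto simp: site_energy_def)
    next
      case 2
      have "(1 - \<alpha>) * F1 t + C \<le> F1 t + (F2 t + G2 t) / 2"
        unfolding split by (rule add_left_mono[OF avg[OF growth(1)[OF t] growth(3)[OF t]]])
      then have "A + B * t - K \<le> F1 t + (F2 t + G2 t) / 2"
        using K1(2)[OF t] K1(1) K2(1) unfolding K_def by linarith
      then show ?thesis using 2 by (auto simp: site_energy_def)
    next
      case 3
      then show ?thesis using assms[OF t] by (simp add: site_energy_def W_def)
    qed
  qed
  moreover have "K \<ge> 0" unfolding K_def using K1(1) K2(1) by simp
  ultimately show ?thesis by blast
qed

lemma W_bounded_below: obtains K where "K \<ge> 0" "\<And>t. t > 0 \<Longrightarrow> W t \<ge> - K"
proof -
  obtain K where K: "K \<ge> 0" "\<And>t. t > 0 \<Longrightarrow> 0 * t - K \<le> (1 - \<alpha>) * F1 t"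
    using scaled_superlinear[OF superlinear(1), of 0] by blast
  have "W t \<ge> - (K + \<bar>C\<bar>)" if "t > 0" for t
    using W_ge_F1[OF that] K(2)[OF that] by linarith
  then show thesis using K(1) by (intro that[of "K + \<bar>C\<bar>"]) auto
qed

lemma W_blowup: "filterlim W at_top (at_right 0)"
proof (rule filterlim_at_top_mono)
  have "filterlim (\<lambda>t. C + (1 - \<alpha>) * F1 t) at_top (at_right 0)"
    using alpha by (intro filterlim_tendsto_add_at_top[OF tendsto_const]
        filterlim_tendsto_pos_mult_at_top[OF tendsto_const _ F1_blowup]) auto
  then show "filterlim (\<lambda>t. (1 - \<alpha>) * F1 t + C) at_top (at_right 0)"
    by (simp only: add.commute)
  show "\<forall>\<^sub>F t in at_right 0. (1 - \<alpha>) * F1 t + C \<le> W t"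
    using eventually_at_right_less[of "0::real"] by eventually_elim (rule W_ge_F1)
qed

text \<open>The tangent at \<open>t\<close> lies below \<open>W\<close> at the point 1. Once
  \<open>W t\<close> exceeds \<open>W 1\<close>, this forces its slope to be nonpositive for
  \<open>t < 1\<close>.\<close>

lemma W_large_near_0: obtains d where "d > 0" "\<And>t. 0 < t \<Longrightarrow> t < d \<Longrightarrow> W t \<ge> R \<and> W' t \<le> 0"
proof -
  have "\<forall>\<^sub>F t in at_right 0. max R (W 1 + 1) \<le> W t"
    using W_blowup by (simp only: filterlim_at_top)
  then obtain d where d: "d > 0" "\<And>t. 0 < t \<Longrightarrow> t < d \<Longrightarrow> max R (W 1 + 1) \<le> W t"
    unfolding eventually_at_right_field by auto
  have "W t \<ge> R \<and> W' t \<le> 0" if t: "0 < t" "t < min d 1" for t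
  proof -
    have "W t + W' t * (1 - t) \<le> W 1" using tangent[of t 1] t by (simp add: W_def)
    moreover have "max R (W 1 + 1) \<le> W t" using d(2) t by simp
    ultimately have "W' t * (1 - t) \<le> 0" "W t \<ge> R" by linarith+
    then show ?thesis using t by (simp add: mult_le_0_iff)
  qed
  then show thesis using d(1) by (intro that[of "min d 1"]) auto
qed

text \<open>Replacing the potential to the left of \<open>1 / M\<close> by its tangent line gives real-valued
  minorants which are attained by an affine minorant at every point.\<close>

definition W_trunc :: "nat \<Rightarrow> real \<Rightarrow> real" where
  "W_trunc M s = (let q = max s (1 / real M) in W q + W' q * (s - q))"

lemma W_trunc_eq: "1 / real M \<le> s \<Longrightarrow> W_trunc M s = W s"
  by (simp add: W_trunc_def max_def Let_def)

text \<open>For large \<open>M\<close> the tangent at \<open>1 / M\<close> has nonpositive slope, so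
  to its left it stays above \<open>W (1 / M)\<close>, which is large by the blow-up at 0.\<close>

lemma W_trunc_ge_left:
  "\<forall>\<^sub>F M in sequentially. \<forall>s. s < 1 / real M \<longrightarrow> W_trunc M s \<ge> R"
proof -
  obtain d where d: "d > 0" "\<And>t. 0 < t \<Longrightarrow> t < d \<Longrightarrow> W t \<ge> R \<and> W' t \<le> 0" using W_large_near_0 by blast
  have "\<forall>\<^sub>F M in sequentially. 1 / real M < d" using order_tendstoD(2)[OF lim_1_over_n d(1)] .
  then show ?thesis
    using eventually_gt_at_top[of "0::nat"]
  proof eventually_elim
    case (elim M)
    show ?case
    proof (intro allI impI)
      fix s assume s: "s < 1 / real M"
      then have "W_trunc M s = W (1 / real M) + W' (1 / real M) * (s - 1 / real M)"
        by (simp add: W_trunc_def max_def Let_def)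
      moreover have "W' (1 / real M) * (s - 1 / real M) \<ge> 0"
        using d(2)[of "1 / real M"] elim s by (intro mult_nonpos_nonpos) auto
      moreover have "W (1 / real M) \<ge> R" using d(2)[of "1 / real M"] elim by simp
      ultimately show "W_trunc M s \<ge> R" by linarith
    qed
  qed
qed

lemma W_trunc_lower:
  obtains K where "K \<ge> 0" "\<And>t. t > 0 \<Longrightarrow> W t \<ge> - K" "\<forall>\<^sub>F M in sequentially. \<forall>s. W_trunc M s \<ge> - K"
proof -
  obtain K where K: "K \<ge> 0" "\<And>t. t > 0 \<Longrightarrow> W t \<ge> - K" using W_bounded_below by blast
  have "\<forall>\<^sub>F M in sequentially. \<forall>s. W_trunc M s \<ge> - K"
    using W_trunc_ge_left[of "- K"] eventually_gt_at_top[of "0::nat"]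
  proof eventually_elim
    case (elim M)
    show ?case
    proof
      fix s
      have "0 < 1 / real M" using elim(2) by simp
      then consider "s < 1 / real M" | "1 / real M \<le> s" "s > 0" by linarith
      then show "W_trunc M s \<ge> - K" using elim(1) W_trunc_eq[of M s] K(2)[of s] by cases auto
    qed
  qed
  then show thesis using K by (intro that) auto
qed

text \<open>For a positive limit the truncation is eventually inactive. Otherwise the arguments
  eventually lie either left of \<open>1 / M\<close>, where the tangent is large, or between
  \<open>1 / M\<close> and a small \<open>d\<close>, where \<open>W\<close> itself is large; this
  includes the limit 0.\<close>

lemma W_trunc_tendsto:
  assumes s: "s \<longlonglongrightarrow> l"
  shows "(\<lambda>M. ereal (W_trunc M (s M))) \<longlonglongrightarrow> W_ext l"
proof (cases "l > 0")
  case True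
  have "(\<lambda>M. s M - 1 / real M) \<longlonglongrightarrow> l - 0"
    by (intro tendsto_diff s lim_1_over_n)
  then have "\<forall>\<^sub>F M in sequentially. 0 < s M - 1 / real M"
    using True by (intro order_tendstoD) auto
  then have ev: "\<forall>\<^sub>F M in sequentially. W (s M) = W_trunc M (s M)"
    by eventually_elim (simp add: W_trunc_eq)
  have "isCont W l" using W_cont True by (simp add: continuous_on_eq_continuous_at)
  then have "(\<lambda>M. W (s M)) \<longlonglongrightarrow> W l" using s by (rule isCont_tendsto_compose)
  then have "(\<lambda>M. W_trunc M (s M)) \<longlonglongrightarrow> W l" using ev by (rule Lim_transform_eventually)
  then show ?thesis using True by (simp add: W_ext_def)
next
  case False
  have "\<forall>\<^sub>F M in sequentially. ereal R < ereal (W_trunc M (s M))" for R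
  proof -
    obtain d where d: "d > 0" "\<And>t. 0 < t \<Longrightarrow> t < d \<Longrightarrow> W t \<ge> R + 1 \<and> W' t \<le> 0" using W_large_near_0 by blast
    have "\<forall>\<^sub>F M in sequentially. s M < d" using False d(1) by (intro order_tendstoD(2)[OF s]) simp
    then show ?thesis
      using W_trunc_ge_left[of "R + 1"] eventually_gt_at_top[of "0::nat"]
    proof eventually_elim
      case (elim M)
      have M: "0 < 1 / real M" using elim by simp
      have "W_trunc M (s M) \<ge> R + 1"
      proof (cases "s M < 1 / real M")
        case True
        then show ?thesis using elim(2) by blast
      next
        case False
        then show ?thesis using W_trunc_eq[of M "s M"] d(2)[of "s M"] M elim(1) by simp
      qed
      then show ?case by simp
    qed
  qed
  then show ?thesis using False by (simp add: W_ext_def tendsto_PInfty)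
qed

lemma W_ext_measurable: "W_ext \<in> borel_measurable borel"
proof -
  have "(\<lambda>t. if t \<in> {0<..} then W t else 0) \<in> borel_measurable borel"
    using W_cont by (intro borel_measurable_continuous_on_if) auto
  then have "(\<lambda>t. if t > 0 then ereal (if t \<in> {0<..} then W t else 0) else \<infinity>) \<in> borel_measurable borel"
    by measurable
  also have "(\<lambda>t. if t > 0 then ereal (if t \<in> {0<..} then W t else 0) else \<infinity>) = W_ext"
    by (auto simp: W_ext_def fun_eq_iff)
  finally show ?thesis .
qed

lemma W_ext_measurable_comp:
  "g \<in> borel_measurable M \<Longrightarrow> (\<lambda>x. W_ext (g x)) \<in> borel_measurable M"
  using measurable_compose[OF _ W_ext_measurable] by blast

text \<open>On each coarse cell the minorant is the tangent of \<open>W\<close> at the coarse slope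
  of the limit, so it attains the value \<open>W_trunc\<close> there. Positivity of the slopes is a
  premise inside the eventuality because members without it are treated separately, having infinite
  energy.\<close>

lemma real_energy_eventually_ge:
  assumes z: "uniform_limit Omega z y sequentially" and y: "continuous_on Omega y"
    and M: "M > 0" and e: "e > 0"
  shows "\<forall>\<^sub>F N in sequentially. (\<forall>i\<in>cells N. slope N (z N) 1 i > 0) \<longrightarrow>
    (\<Sum>k\<in>cells M. eps M * W_trunc M (slope M y 1 k)) - e
      < eps N * real_energy F1 F2 G1 G2 N (diffq N (z N) 1)"
proof -
  \<comment> \<open>The point of tangency is the coarse slope, moved up to \<open>1 / M\<close> if
    it is smaller, exactly as in \<open>W_trunc\<close>; thus tangents exist even where the coarse
    slope is not positive.\<close>
  define q where "q k = max (slope M y 1 k) (1 / real M)" for k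
  define A B where "A k = W (q k) - W' (q k) * q k" and "B k = W' (q k)" for k
  have q: "q k > 0" for k using M by (simp add: q_def less_max_iff_disj)
  have AB: "A k + B k * t \<le> W t" if "t > 0" for k t
    using tangent[OF q that, of k] by (simp add: A_def B_def W_def algebra_simps)
  have ABs: "A k + B k * slope M y 1 k = W_trunc M (slope M y 1 k)" for k
    by (simp add: A_def B_def W_trunc_def q_def Let_def algebra_simps)
  have "\<exists>K\<ge>0. \<forall>i. \<forall>t>0. A k + B k * t - (if i \<in> {-2, -1, 0, 1} then K else 0) \<le> site_energy F1 F2 G1 G2 i t" for k
    using AB by (rule site_energy_ge_affine)
  then have "\<exists>Kk. \<forall>k. Kk k \<ge> 0 \<and> (\<forall>i. \<forall>t>0. A k + B k * t - (if i \<in> {-2, -1, 0, 1} then Kk k else 0) \<le> site_energy F1 F2 G1 G2 i t)"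
    by (intro choice allI)
  then obtain Kk where Kk': "\<forall>k. Kk k \<ge> 0 \<and> (\<forall>i. \<forall>t>0. A k + B k * t - (if i \<in> {-2, -1, 0, 1} then Kk k else 0) \<le> site_energy F1 F2 G1 G2 i t)"
    by (rule exE)
  have Kk: "Kk k \<ge> 0"
    "t > 0 \<Longrightarrow> A k + B k * t - (if i \<in> {-2, -1, 0, 1} then Kk k else 0) \<le> site_energy F1 F2 G1 G2 i t" for k i t
    using Kk'[rule_format, of k] by auto
  \<comment> \<open>The sum of finitely many nonnegative penalties bounds each of them, giving one
    constant for all coarse cells.\<close>
  define K where "K = (\<Sum>k\<in>{- int M..<int M}. Kk k)"
  have K0: "K \<ge> 0" unfolding K_def using Kk(1) by (simp add: sum_nonneg)
  have KK: "Kk k \<le> K" if "k \<in> {- int M..<int M}" for k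
    unfolding K_def using that Kk(1) by (intro member_le_sum) auto
  define R where "R N = coarse_sum M N A B (\<lambda>i. z N (grid N i)) - eps N * (4 * K)" for N
  let ?S = "\<Sum>k\<in>cells M. eps M * W_trunc M (slope M y 1 k)"
  have "R \<longlonglongrightarrow> (\<Sum>k\<in>{- int M..<int M}. eps M * (A k + B k * slope M y 1 k))"
    unfolding R_def by (rule affine_sum_tendsto[OF M z y])
  also have "(\<Sum>k\<in>{- int M..<int M}. eps M * (A k + B k * slope M y 1 k)) = ?S"
    unfolding ABs by (rule sum.cong) auto
  finally have "\<forall>\<^sub>F N in sequentially. ?S - e < R N"
    using e by (intro order_tendstoD(1)) auto
  then show ?thesis
    using eventually_ge_at_top[of "2::nat"]
  proof eventually_elim
    case (elim N)
    show ?case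
    proof
      assume pos: "\<forall>i\<in>cells N. slope N (z N) 1 i > 0"
      have N: "N > 0" using elim by simp
      let ?p = "diffq N (z N) 1"
      have p: "?p i > 0" for i using diffq_pos[OF N] pos by blast
      have "R N \<le> eps N * (\<Sum>i\<in>cells N. site_energy F1 F2 G1 G2 i (?p i))"
        unfolding R_def
      proof (rule sum_affine_minorant[OF M _ _ _ K0])
        show "z N (grid N (i + 1)) - z N (grid N i) = eps N * ?p i" if "i \<in> cells N" for i
          using slope_times_eps[OF N, of "z N" i] diffq_slope[OF N that, of "z N"] by (simp add: mult.commute)
        show "A k + B k * ?p i - (if i \<in> {-2, -1, 0, 1} then K else 0) \<le> site_energy F1 F2 G1 G2 i (?p i)"
          if "k \<in> {- int M..<int M}" for i k
        proof -
          have "(if i \<in> {-2, -1, 0, 1} then Kk k else 0) \<le> (if i \<in> {-2, -1, 0, 1} then K else 0)"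
            using KK[OF that] by simp
          then show ?thesis using Kk(2)[OF p, of k i i] by linarith
        qed
      qed (use elim in simp)
      also have "\<dots> \<le> eps N * real_energy F1 F2 G1 G2 N ?p"
      proof (intro mult_left_mono real_energy_ge_sites conc p)
        show "?p (int N) = ?p (- int N)"
          using diffq_periodic[OF N, of "z N" 1 "- int N"] by simp
      qed (use elim eps_pos[OF N] in auto)
      finally show "?S - e < eps N * real_energy F1 F2 G1 G2 N ?p" using elim by simp
    qed
  qed
qed

abbreviation W_integral :: "real \<Rightarrow> (real \<Rightarrow> real) \<Rightarrow> ennreal" where
  "W_integral K g \<equiv> \<integral>\<^sup>+ x. e2ennreal (W_ext (g x) + ereal K) \<partial>\<mu>"

text \<open>The coarse sum is the integral of a step function whose values converge to
  \<open>W_ext (g x)\<close> almost everywhere. The shift by \<open>K\<close> makes the integrands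
  nonnegative, as Fatou's lemma requires.\<close>

lemma W_integral_le_if_truncated:
  assumes p: "primitive g y" and K: "K \<ge> 0" "\<forall>\<^sub>F M in sequentially. \<forall>s. W_trunc M s \<ge> - K"
    and le: "\<And>M. M > 0 \<Longrightarrow> (\<Sum>k\<in>cells M. eps M * W_trunc M (slope M y 1 k)) \<le> r"
  shows "W_integral K g \<le> ennreal (r + K)"
proof -
  let ?M = "\<mu>"
  let ?v = "\<lambda>M x. ennreal (W_trunc M (slope M y 1 (cell M x)) + K)"
  have "W_integral K g = (\<integral>\<^sup>+ x. liminf (\<lambda>M. ?v M x) \<partial>?M)"
  proof (rule nn_integral_cong_AE)
    show "AE x in ?M. e2ennreal (W_ext (g x) + ereal K) = liminf (\<lambda>M. ?v M x)"
      using slope_tendsto[OF p, of 1, simplified]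
    proof eventually_elim
      case (elim x)
      have "(\<lambda>M. ereal (W_trunc M (slope M y 1 (cell M x))) + ereal K) \<longlonglongrightarrow> W_ext (g x) + ereal K"
        by (intro tendsto_add_ereal_general1 W_trunc_tendsto elim tendsto_const) simp
      then have "(\<lambda>M. e2ennreal (ereal (W_trunc M (slope M y 1 (cell M x))) + ereal K)) \<longlonglongrightarrow> e2ennreal (W_ext (g x) + ereal K)"
        by (rule continuous_on_tendsto_compose[OF continuous_on_e2ennreal[of UNIV]]) auto
      then have "(\<lambda>M. ?v M x) \<longlonglongrightarrow> e2ennreal (W_ext (g x) + ereal K)" by (simp add: e2ennreal_ereal)
      from lim_imp_Liminf[OF _ this] show ?case by simp
    qed
  qed
  also have "\<dots> \<le> liminf (\<lambda>M. \<integral>\<^sup>+ x. ?v M x \<partial>?M)"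
  proof (rule nn_integral_liminf)
    show "?v M \<in> borel_measurable ?M" for M by measurable
  qed
  also have "\<dots> \<le> liminf (\<lambda>M. ennreal (r + K))"
  proof (rule Liminf_mono)
    show "\<forall>\<^sub>F M in sequentially. (\<integral>\<^sup>+ x. ?v M x \<partial>?M) \<le> ennreal (r + K)"
      using K(2) eventually_gt_at_top[of "0::nat"]
    proof eventually_elim
      case (elim M)
      let ?w = "\<lambda>i. W_trunc M (slope M y 1 i)"
      have w: "?w i + K \<ge> 0" for i using elim(1)[rule_format, of "slope M y 1 i"] by linarith
      have e: "eps M \<ge> 0" using eps_pos[OF elim(2)] by simp
      have "(\<integral>\<^sup>+ x. ?v M x \<partial>?M) = (\<Sum>i\<in>cells M. ennreal (?w i + K) * ennreal (eps M))"
        by (rule nn_integral_cell[OF elim(2), of "\<lambda>i. ennreal (?w i + K)"])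
      also have "\<dots> = (\<Sum>i\<in>cells M. ennreal ((?w i + K) * eps M))"
        using w e by (intro sum.cong refl) (simp add: ennreal_mult)
      also have "\<dots> = ennreal (\<Sum>i\<in>cells M. (?w i + K) * eps M)"
        using w e by (intro sum_ennreal) simp
      also have "(\<Sum>i\<in>cells M. (?w i + K) * eps M)
          = (\<Sum>i\<in>cells M. eps M * ?w i) + (\<Sum>i\<in>cells M. eps M * K)"
        unfolding sum.distrib[symmetric] by (intro sum.cong refl) (simp add: algebra_simps)
      also have "(\<Sum>i\<in>cells M. eps M * K) = K"
        using elim(2) by (simp add: eps_def)
      finally show ?case using le[OF elim(2)] by (simp add: ennreal_leI)
    qed
  qed
  also have "\<dots> = ennreal (r + K)" by (simp add: Liminf_const)
  finally show ?thesis .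
qed

end

section \<open>The liminf inequality\<close>

lemma admissible_primitive:
  assumes "y \<in> admissible L"
  shows "primitive (weak_deriv y) y" "continuous_on Omega y" "y (-1/2) = 0" "y (1/2) = L"
    "weak_deriv y \<in> borel_measurable \<mu>"
proof -
  show c: "continuous_on Omega y" and "y (-1/2) = 0" "y (1/2) = L"
    using assms by (auto simp: admissible_def H1_Omega_def)
  have "\<exists>g. g \<in> L2_Omega \<and> has_weak_deriv y g" using assms by (auto simp: admissible_def H1_Omega_def)
  from someI_ex[OF this] have g: "weak_deriv y \<in> L2_Omega" "has_weak_deriv y (weak_deriv y)"
    by (simp_all add: weak_deriv_def)
  note gi = L2_imp_integrable[OF g(1)]
  show "weak_deriv y \<in> borel_measurable \<mu>" using gi by (rule borel_measurable_integrable)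
  show "primitive (weak_deriv y) y"
    unfolding primitive_def using gi weak_deriv_has_integral[OF c gi g(2)] by blast
qed

text \<open>The lattice force differs from a Riemann sum of the limit integrand only through the
  nodal errors of \<open>z N\<close>, which are uniformly small.\<close>

lemma force_tendsto:
  assumes f: "continuous_on Omega f" and z: "uniform_limit Omega z y sequentially" and y: "continuous_on Omega y"
  shows "(\<lambda>N. eps N * energy_force L f N (z N)) \<longlonglongrightarrow> (LINT x|\<mu>. f x * (y x - L * (x + 1/2)))"
proof -
  let ?u = "\<lambda>x. f x * (y x - L * (x + 1/2))"
  obtain B where B0: "B \<ge> 0" and B: "\<And>x. x \<in> Omega \<Longrightarrow> \<bar>f x\<bar> \<le> B"
    by (rule continuous_bounded_Omega[OF f]) (rule that; assumption)
  have lim: "(\<lambda>N. \<Sum>i\<in>cells N. eps N * ?u (grid N i)) \<longlonglongrightarrow> (LINT x|\<mu>. ?u x)"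
    by (intro riemann_sum_tendsto continuous_intros f y)
  have "(\<lambda>N. eps N * energy_force L f N (z N) - (\<Sum>i\<in>cells N. eps N * ?u (grid N i))) \<longlonglongrightarrow> 0"
  proof (rule LIMSEQ_I)
    fix r :: real assume r: "r > 0"
    \<comment> \<open>The denominator \<open>B + 1\<close> keeps \<open>d\<close> positive and
      \<open>B * d < r\<close> even when \<open>B = 0\<close>.\<close>
    define d where "d = r / (B + 1)"
    have d0: "d > 0" unfolding d_def using r B0 by (intro divide_pos_pos) auto
    have "(B + 1) * d = r" unfolding d_def using B0 by simp
    then have d: "d > 0" "B * d < r" using d0 distrib_right[of B 1 d] by linarith+
    have "\<forall>\<^sub>F N in sequentially. \<forall>x\<in>Omega. dist (z N x) (y x) < d"
      using z d(1) by (rule uniform_limitD)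
    then have "\<forall>\<^sub>F N in sequentially. norm (eps N * energy_force L f N (z N) - (\<Sum>i\<in>cells N. eps N * ?u (grid N i)) - 0) < r"
      using eventually_gt_at_top[of "0::nat"]
    proof eventually_elim
      case (elim N)
      have e: "eps N > 0" using eps_pos elim by simp
      have "eps N * energy_force L f N (z N) - (\<Sum>i\<in>cells N. eps N * ?u (grid N i))
        = (\<Sum>i\<in>cells N. eps N * (f (grid N i) * (z N (grid N i) - y (grid N i))))"
        unfolding energy_force_def sum_distrib_left sum_subtractf[symmetric]
        by (intro sum.cong refl) (use elim in \<open>simp add: node_eq algebra_simps\<close>)
      also have "\<bar>\<dots>\<bar> \<le> (\<Sum>i\<in>cells N. eps N * (B * d))"
      proof (rule order_trans[OF sum_abs sum_mono])
        fix i assume i: "i \<in> cells N"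
        have g: "grid N i \<in> Omega" using i elim by (intro grid_in_Omega) auto
        have "\<bar>f (grid N i)\<bar> * \<bar>z N (grid N i) - y (grid N i)\<bar> \<le> B * d"
          using elim g B[OF g] B0 by (intro mult_mono) (auto simp: dist_real_def less_imp_le)
        then show "\<bar>eps N * (f (grid N i) * (z N (grid N i) - y (grid N i)))\<bar> \<le> eps N * (B * d)"
          using e by (simp add: abs_mult mult_left_mono)
      qed
      also have "\<dots> = B * d" using elim by (simp add: eps_def)
      finally show ?case using d(2) by simp
    qed
    then show "\<exists>n0. \<forall>n\<ge>n0. norm (eps n * energy_force L f n (z n) - (\<Sum>i\<in>cells n. eps n * ?u (grid n i)) - 0) < r"
      by (simp only: eventually_sequentially)
  qed
  from tendsto_add[OF this lim] show ?thesis by simp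
qed

locale defect_model = defect_potentials +
  fixes L :: real and f :: "real \<Rightarrow> real" and \<phi>1 \<psi>1 :: "real \<Rightarrow> ereal"
  assumes f_cont: "continuous_on Omega f"
    and \<phi>1: "\<And>t. t > 0 \<Longrightarrow> \<phi>1 t = ereal (F1 t)" "\<And>t. t \<le> 0 \<Longrightarrow> \<phi>1 t = \<infinity>"
    and \<psi>1: "\<And>t. t > 0 \<Longrightarrow> \<psi>1 t = ereal (G1 t)"
begin

abbreviation "F_eps \<equiv> discrete_functional L \<phi>1 F2 \<psi>1 G2 f"
abbreviation "F_0 \<equiv> limit_functional L \<phi>1 F2 f"

definition force :: "(real \<Rightarrow> real) \<Rightarrow> real" where
  "force y = (LINT x|\<mu>. f x * (y x - L * (x + 1/2)))"

lemma cauchy_born_eq_W_ext: "cauchy_born \<phi>1 F2 t = W_ext t"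
  by (cases "t > 0") (simp_all add: cauchy_born_def W_ext_def W_def \<phi>1)

lemma F_0_eq:
  assumes y: "y \<in> admissible L" and K: "K \<ge> 0" "\<And>t. t > 0 \<Longrightarrow> W t \<ge> - K"
  shows "F_0 y = enn2ereal (W_integral K (weak_deriv y))
    + ereal (force y - K)"
  unfolding limit_functional_def cauchy_born_eq_W_ext force_def
proof (rule ereal_integral_split)
  show "(\<lambda>x. W_ext (weak_deriv y x)) \<in> borel_measurable \<mu>"
    by (intro W_ext_measurable_comp admissible_primitive[OF y])
  show "- ereal K \<le> W_ext (weak_deriv y x)" for x
    using K(2)[of "weak_deriv y x"] by (simp add: W_ext_def)
  show "continuous_on Omega (\<lambda>x. f x * (y x - L * (x + 1/2)))"
    by (intro continuous_intros f_cont admissible_primitive[OF y])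
qed

lemma F_eps_eq:
  assumes N: "N > 0" and z: "z \<in> admissible_eps N L"
    and pos: "\<And>i. i \<in> cells N \<Longrightarrow> slope N z 1 i > 0"
  shows "F_eps N z = ereal (eps N * real_energy F1 F2 G1 G2 N (diffq N z 1) + eps N * energy_force L f N z)"
proof -
  have "energy L \<phi>1 F2 \<psi>1 G2 f N z = ereal (real_energy F1 F2 G1 G2 N (diffq N z 1) + energy_force L f N z)"
    by (rule energy_eq_real_energy[OF diffq_pos[OF N pos] \<phi>1(1) \<psi>1])
  then show ?thesis using z by (simp add: discrete_functional_def distrib_left)
qed

lemma F_eps_eq_infinity:
  assumes N: "N > 0" and bad: "\<not> (z \<in> admissible_eps N L \<and> (\<forall>i\<in>cells N. slope N z 1 i > 0))"
  shows "F_eps N z = \<infinity>"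
proof (cases "z \<in> admissible_eps N L")
  case True
  then obtain i where i: "i \<in> cells N" "slope N z 1 i \<le> 0" using bad by (auto simp: not_less)
  then have "diffq N z 1 i \<le> 0" using diffq_slope[OF N i(1)] by simp
  then have "energy L \<phi>1 F2 \<psi>1 G2 f N z = \<infinity>" unfolding energy_def by auto
  then show ?thesis using True eps_pos[OF N] by (simp add: discrete_functional_def)
qed (simp add: discrete_functional_def)

theorem F_0_le_liminf:
  assumes ys: "\<And>N. ys N \<in> admissible L" and y: "y \<in> admissible L" and conv: "L2_converges ys y"
  shows "F_0 y \<le> liminf (\<lambda>N. F_eps N (ys N))"
proof -
  note yp = admissible_primitive[OF y]
  define good where "good N \<longleftrightarrow> N > 0 \<and> ys N \<in> admissible_eps N L \<and> (\<forall>i\<in>cells N. slope N (ys N) 1 i > 0)" for N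
  \<comment> \<open>Members of infinite energy are replaced by the limit, so that the whole sequence
    converges uniformly; where a replacement was made, the bound for the original member is
    trivial.\<close>
  define z where "z N = (if good N then ys N else y)" for N
  have z_adm: "z N \<in> admissible L" for N using ys y by (simp add: z_def)
  have "L2_converges z y"
    unfolding L2_converges_def
  proof (rule tendsto_sandwich[OF _ _ tendsto_const])
    show "(\<lambda>N. sqrt (LINT x|\<mu>. (ys N x - y x)\<^sup>2)) \<longlonglongrightarrow> 0"
      using conv by (simp add: L2_converges_def)
  qed (auto intro!: always_eventually simp: z_def)
  then have zu: "uniform_limit Omega z y sequentially"
  proof (intro mono_L2_imp_uniform yp(2))
    show "continuous_on Omega (z N)" for N using admissible_primitive(2)[OF z_adm] .
    show "mono_on Omega (z N) \<or> z N = y" for N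
      using admissible_eps_mono[of N "ys N" L] by (auto simp: z_def good_def)
    show "z N (-1/2) = y (-1/2)" "z N (1/2) = y (1/2)" for N
      using admissible_primitive(3,4)[OF z_adm] yp(3,4) by auto
  qed
  define c where "c = liminf (\<lambda>N. F_eps N (ys N))"
  define S where "S M = (\<Sum>k\<in>cells M. eps M * W_trunc M (slope M y 1 k))" for M
  have low: "ereal (S M + force y - 2 * e) \<le> c" if M: "M > 0" and e: "e > 0" for M e
    unfolding c_def
  proof (rule Liminf_bounded)
    have "\<forall>\<^sub>F N in sequentially. force y - e < eps N * energy_force L f N (z N)"
      using e unfolding force_def by (intro order_tendstoD(1)[OF force_tendsto[OF f_cont zu yp(2)]]) simp
    then show "\<forall>\<^sub>F N in sequentially. ereal (S M + force y - 2 * e) \<le> F_eps N (ys N)"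
      using real_energy_eventually_ge[OF zu yp(2) M e] eventually_gt_at_top[of "0::nat"]
    proof eventually_elim
      case (elim N)
      show ?case
      proof (cases "good N")
        case True
        then have z: "z N = ys N" by (simp add: z_def)
        have "S M - e < eps N * real_energy F1 F2 G1 G2 N (diffq N (ys N) 1)"
          using elim(2) True unfolding z S_def good_def by blast
        moreover have "F_eps N (ys N) = ereal (eps N * real_energy F1 F2 G1 G2 N (diffq N (ys N) 1) + eps N * energy_force L f N (ys N))"
          using True by (intro F_eps_eq) (auto simp: good_def)
        ultimately show ?thesis using elim(1) unfolding z by simp
      next
        case False
        then have "F_eps N (ys N) = \<infinity>" using elim(3) by (intro F_eps_eq_infinity) (auto simp: good_def)
        then show ?thesis by simp
      qed
    qed
  qed
  obtain K where K: "K \<ge> 0" "\<And>t. t > 0 \<Longrightarrow> W t \<ge> - K" "\<forall>\<^sub>F M in sequentially. \<forall>s. W_trunc M s \<ge> - K"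
    by (rule W_trunc_lower) (rule that; assumption)
  show ?thesis
  proof (cases c)
    case (real r)
    have Sr: "S M \<le> r - force y" if "M > 0" for M
    proof (rule field_le_epsilon)
      fix e :: real assume "e > 0"
      then have "S M + force y - 2 * (e / 2) \<le> r" using low[OF that, of "e / 2"] real by simp
      then show "S M \<le> r - force y + e" by simp
    qed
    obtain M where M: "\<forall>s. W_trunc M s \<ge> - K" "M > 0"
      using eventually_happens'[OF sequentially_bot eventually_conj[OF K(3) eventually_gt_at_top[of "0::nat"]]] by blast
    \<comment> \<open>Nonnegativity of the bound is required to pass from \<open>ennreal\<close>
      back to \<open>ereal\<close> without truncation at 0.\<close>
    have "- K = (\<Sum>k\<in>cells M. eps M * (- K))" using M(2) by (simp add: eps_def)
    also have "\<dots> \<le> S M"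
      unfolding S_def using M(1) eps_pos[OF M(2)] by (intro sum_mono mult_left_mono) auto
    finally have nn: "r - force y + K \<ge> 0" using Sr[OF M(2)] by simp
    have "W_integral K (weak_deriv y) \<le> ennreal (r - force y + K)"
      using Sr unfolding S_def by (intro W_integral_le_if_truncated[OF yp(1) K(1,3)])
    then have "enn2ereal (W_integral K (weak_deriv y)) \<le> ereal (r - force y + K)"
      unfolding less_eq_ennreal.rep_eq enn2ereal_ennreal[OF nn] .
    then have "enn2ereal (W_integral K (weak_deriv y)) + ereal (force y - K)
        \<le> ereal (r - force y + K) + ereal (force y - K)"
      by (rule add_right_mono)
    also have "enn2ereal (W_integral K (weak_deriv y)) + ereal (force y - K) = F_0 y"
      by (rule F_0_eq[OF y K(1), symmetric]) (rule K(2))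
    finally have "F_0 y \<le> ereal (r - force y + K) + ereal (force y - K)" .
    then show ?thesis using real by (simp add: c_def)
  next
    case PInf
    then show ?thesis by (simp add: c_def)
  next
    case MInf
    then show ?thesis using low[of 1 1] by simp
  qed
qed

end

section \<open>The recovery sequence\<close>

lemma primitive_has_bochner_integral:
  assumes p: "primitive g Y" and ab: "-1/2 \<le> a" "a \<le> b" "b \<le> 1/2"
  shows "has_bochner_integral \<mu> (\<lambda>x. g x * indicator {a..<b} x) (Y b - Y a)"
proof -
  note gi = primitiveD(1)[OF p]
  have sub: "{a..<b} \<subseteq> Omega" using ab by (auto simp: Omega_def)
  then have "{a..<b} \<in> sets \<mu>" by (simp add: sets_restrict_space_iff)
  then have i: "integrable \<mu> (\<lambda>x. g x * indicator {a..<b} x)"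
    using gi by (rule integrable_real_mult_indicator)
  have "(LINT x|\<mu>. g x * indicator {a..<b} x) = integral Omega (\<lambda>x. g x * indicator {a..<b} x)"
    using i by (rule lebesgue_integral_eq_integral) simp
  also have "\<dots> = integral Omega (\<lambda>x. if x \<in> {a..<b} then g x else 0)"
    by (rule integral_cong) (simp add: indicator_def)
  also have "\<dots> = integral {a..<b} g"
    unfolding integral_restrict_Int using sub by (simp add: Int_absorb2)
  also have "\<dots> = integral {a..b} g"
    by (rule integral_spike_set; rule negligible_subset[OF negligible_sing[of b]]) auto
  also have "\<dots> = Y b - Y a"
    using primitiveD(2)[OF p ab] by (rule integral_unique)
  finally show ?thesis using i by (simp add: has_bochner_integral_iff)
qed

lemma primitive_integral:
  assumes "primitive g Y"
  shows "(LINT x|\<mu>. g x) = Y (1/2) - Y (-1/2)"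
proof -
  have "(LINT x|\<mu>. g x) = integral Omega g"
    using primitiveD(1)[OF assms] by (rule lebesgue_integral_eq_integral) simp
  also have "\<dots> = Y (1/2) - Y (-1/2)"
    using primitiveD(2)[OF assms, of "-1/2" "1/2"] unfolding Omega_def by (intro integral_unique) simp
  finally show ?thesis .
qed

lemma primitive_less:
  assumes p: "primitive g Y" and pos: "AE x in \<mu>. g x > 0" and ab: "-1/2 \<le> a" "a < b" "b \<le> 1/2"
  shows "Y a < Y b"
proof -
  have sub: "{a..<b} \<subseteq> Omega" using ab by (auto simp: Omega_def)
  have h: "has_bochner_integral \<mu> (\<lambda>x. g x * indicator {a..<b} x) (Y b - Y a)"
    using ab by (intro primitive_has_bochner_integral[OF p]) auto
  have "(LINT x|\<mu>. 0) < (LINT x|\<mu>. g x * indicator {a..<b} x)"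
  proof (rule finite_measure.integral_less_AE[OF finite_measure_Omega, where A = "{a..<b}"])
    show "integrable \<mu> (\<lambda>x. g x * indicator {a..<b} x)"
      using h unfolding has_bochner_integral_iff by (rule conjunct1)
    show "{a..<b} \<in> sets \<mu>" using sub by (simp add: sets_restrict_space_iff)
    show "emeasure \<mu> {a..<b} \<noteq> 0" using sub ab by (simp add: emeasure_restrict_space)
    show "AE x in \<mu>. x \<in> {a..<b} \<longrightarrow> 0 \<noteq> g x * indicator {a..<b} x"
      using pos by eventually_elim auto
    show "AE x in \<mu>. 0 \<le> g x * indicator {a..<b} x"
      using pos by eventually_elim (auto simp: indicator_def)
  qed simp
  then show ?thesis using has_bochner_integral_integral_eq[OF h] by simp
qed

lemma primitive_slope_pos:
  assumes p: "primitive g Y" and pos: "AE x in \<mu>. g x > 0" and N: "N > 0" and i: "i \<in> cells N"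
  shows "slope N Y 1 i > 0"
proof -
  have "grid N i \<in> Omega" "grid N (i + 1) \<in> Omega" using i by (intro grid_in_Omega[OF N]; simp)+
  then have "Y (grid N i) < Y (grid N (i + 1))"
    by (intro primitive_less[OF p pos]) (auto simp: Omega_def grid_less[OF N])
  then show ?thesis using eps_pos[OF N] by (simp add: slope_def)
qed

lemma primitive_continuous:
  assumes p: "primitive g Y"
  shows "continuous_on Omega Y"
proof -
  have "g integrable_on {-1/2..1/2}"
    using primitiveD(2)[OF p, of "-1/2" "1/2"] by (auto intro: has_integral_integrable)
  then have "continuous_on {-1/2..1/2} (\<lambda>x. integral {-1/2..x} g + Y (-1/2))"
    by (intro continuous_intros indefinite_integral_continuous_1)
  then have "continuous_on {-1/2..1/2} Y"
  proof (rule continuous_on_cong[THEN iffD1, rotated 2])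
    fix x :: real assume "x \<in> {-1/2..1/2}"
    then have "(g has_integral (Y x - Y (-1/2))) {-1/2..x}" by (intro primitiveD(2)[OF p]) auto
    then have "integral {-1/2..x} g = Y x - Y (-1/2)" by (rule integral_unique)
    then show "integral {-1/2..x} g + Y (-1/2) = Y x" by (simp only: diff_add_cancel)
  qed simp
  then show ?thesis by (simp add: Omega_def)
qed

lemma has_bochner_integral_cell_mult:
  assumes p: "primitive g Y" and N: "N > 0"
  shows "has_bochner_integral \<mu> (\<lambda>x. b (cell N x) * g x)
    (\<Sum>i\<in>cells N. b i * (eps N * slope N Y 1 i))"
proof -
  let ?I = "\<lambda>i. {grid N i..<grid N (i + 1)}"
  have "has_bochner_integral \<mu> (\<lambda>x. \<Sum>i\<in>cells N. b i * (g x * indicator (?I i) x))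
      (\<Sum>i\<in>cells N. b i * (Y (grid N (i + 1)) - Y (grid N i)))"
  proof (intro has_bochner_integral_sum has_bochner_integral_mult_right primitive_has_bochner_integral[OF p])
    fix i assume i: "i \<in> cells N"
    then have "grid N i \<in> Omega" "grid N (i + 1) \<in> Omega"
      by (intro grid_in_Omega[OF N]; simp)+
    then show "-1/2 \<le> grid N i" "grid N (i + 1) \<le> 1/2" by (auto simp: Omega_def)
    show "grid N i \<le> grid N (i + 1)" by (rule grid_mono) simp
  qed
  also have "(\<Sum>i\<in>cells N. b i * (Y (grid N (i + 1)) - Y (grid N i)))
      = (\<Sum>i\<in>cells N. b i * (eps N * slope N Y 1 i))"
    by (intro sum.cong refl) (simp add: slope_times_eps[OF N, symmetric] mult.commute)
  finally have h: "has_bochner_integral \<mu> (\<lambda>x. \<Sum>i\<in>cells N. b i * (g x * indicator (?I i) x))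
      (\<Sum>i\<in>cells N. b i * (eps N * slope N Y 1 i))" .
  have m: "g \<in> borel_measurable \<mu>"
    using primitiveD(1)[OF p] by (rule borel_measurable_integrable)
  have "(\<lambda>x. b (cell N x)) \<in> borel_measurable \<mu>" by measurable
  with m have "(\<lambda>x. b (cell N x) * g x) \<in> borel_measurable \<mu>"
    by (intro borel_measurable_times)
  moreover have "AE x in \<mu>. (\<Sum>i\<in>cells N. b i * (g x * indicator (?I i) x)) = b (cell N x) * g x"
    using AE_Omega_interior
  proof eventually_elim
    case (elim x)
    then have "cell N x \<in> cells N" using cell_range[OF N, of x] by auto
    then show ?case by (simp add: cell_indicator[OF N] if_distrib if_distribR sum.delta cong: if_cong)
  qed
  ultimately show ?thesis
    using h by (subst has_bochner_integral_cong_AE[symmetric]) (auto simp: has_bochner_integral_iff)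
qed

definition pos_part :: "(real \<Rightarrow> real) \<Rightarrow> real \<Rightarrow> real" where
  "pos_part \<Phi> t = (if t \<in> {0<..} then \<Phi> t else 0)"

lemma pos_part_simp: "t > 0 \<Longrightarrow> pos_part \<Phi> t = \<Phi> t"
  by (simp add: pos_part_def)

lemma pos_part_measurable:
  assumes "continuous_on {0<..} \<Phi>" and g: "g \<in> borel_measurable M"
  shows "(\<lambda>x. pos_part \<Phi> (g x)) \<in> borel_measurable M"
proof -
  have "pos_part \<Phi> \<in> borel_measurable borel"
    unfolding pos_part_def[abs_def] using assms(1) by (intro borel_measurable_continuous_on_if) auto
  from measurable_compose[OF g this] show ?thesis .
qed

text \<open>The slope on a cell is the mean of \<open>g\<close> there, so the linear part of the
  tangent at this slope integrates to zero over the cell.\<close>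

lemma jensen_cells:
  assumes p: "primitive g Y" and pos: "AE x in \<mu>. g x > 0"
    and int: "integrable \<mu> (\<lambda>x. pos_part \<Phi> (g x))"
    and tangent: "\<And>s. s > 0 \<Longrightarrow> \<exists>b. \<forall>t>0. \<Phi> s + b * (t - s) \<le> \<Phi> t"
    and N: "N > 0" and sl: "\<And>i. i \<in> cells N \<Longrightarrow> slope N Y 1 i > 0"
  shows "(\<Sum>i\<in>cells N. eps N * \<Phi> (slope N Y 1 i)) \<le> (LINT x|\<mu>. pos_part \<Phi> (g x))"
proof -
  let ?p = "slope N Y 1" and ?I = "cells N"
  have "\<forall>i. \<exists>b. i \<in> ?I \<longrightarrow> (\<forall>t>0. \<Phi> (?p i) + b * (t - ?p i) \<le> \<Phi> t)"
    using tangent sl by blast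
  then obtain b where b: "\<forall>i. i \<in> ?I \<longrightarrow> (\<forall>t>0. \<Phi> (?p i) + b i * (t - ?p i) \<le> \<Phi> t)"
    by (rule choice[THEN exE])
  have h1: "has_bochner_integral \<mu> (\<lambda>x. b (cell N x) * g x) (\<Sum>i\<in>?I. b i * (eps N * ?p i))"
    by (rule has_bochner_integral_cell_mult[OF p N])
  have h2: "has_bochner_integral \<mu> (\<lambda>x. \<Phi> (?p (cell N x)) - b (cell N x) * ?p (cell N x)) (\<Sum>i\<in>?I. eps N * (\<Phi> (?p i) - b i * ?p i))"
    by (rule has_bochner_integral_cell[OF N, of "\<lambda>i. \<Phi> (?p i) - b i * ?p i"])
  have h: "has_bochner_integral \<mu> (\<lambda>x. b (cell N x) * g x + (\<Phi> (?p (cell N x)) - b (cell N x) * ?p (cell N x)))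
      ((\<Sum>i\<in>?I. b i * (eps N * ?p i)) + (\<Sum>i\<in>?I. eps N * (\<Phi> (?p i) - b i * ?p i)))"
    by (rule has_bochner_integral_add[OF h1 h2])
  have "(\<Sum>i\<in>?I. eps N * \<Phi> (?p i)) = (\<Sum>i\<in>?I. b i * (eps N * ?p i)) + (\<Sum>i\<in>?I. eps N * (\<Phi> (?p i) - b i * ?p i))"
    unfolding sum.distrib[symmetric] by (intro sum.cong refl) (simp add: algebra_simps)
  also have "\<dots> = (LINT x|\<mu>. b (cell N x) * g x + (\<Phi> (?p (cell N x)) - b (cell N x) * ?p (cell N x)))"
    by (rule has_bochner_integral_integral_eq[OF h, symmetric])
  also have "\<dots> \<le> (LINT x|\<mu>. pos_part \<Phi> (g x))"
  proof (rule integral_mono_AE[OF _ int])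
    show "integrable \<mu> (\<lambda>x. b (cell N x) * g x + (\<Phi> (?p (cell N x)) - b (cell N x) * ?p (cell N x)))"
      using h unfolding has_bochner_integral_iff by (rule conjunct1)
    show "AE x in \<mu>. b (cell N x) * g x + (\<Phi> (?p (cell N x)) - b (cell N x) * ?p (cell N x)) \<le> pos_part \<Phi> (g x)"
      using AE_Omega_interior pos
    proof eventually_elim
      case (elim x)
      then have "cell N x \<in> ?I" using cell_range[OF N, of x] by auto
      then have "\<Phi> (?p (cell N x)) + b (cell N x) * (g x - ?p (cell N x)) \<le> \<Phi> (g x)"
        using b elim by blast
      then show ?case using elim by (simp add: pos_part_simp algebra_simps)
    qed
  qed
  finally show ?thesis .
qed

text \<open>Positivity of \<open>g\<close> makes \<open>Y\<close> increasing, so on each cell both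
  functions lie between the two nodal values of \<open>Y\<close>, and these are close by uniform
  continuity.\<close>

lemma interp_uniform_limit:
  assumes p: "primitive g Y" and pos: "AE x in \<mu>. g x > 0"
  shows "uniform_limit Omega (\<lambda>N. interp N Y) Y sequentially"
proof (rule uniform_limitI)
  fix e :: real assume e: "e > 0"
  have "uniformly_continuous_on Omega Y"
    using primitive_continuous[OF p] by (intro compact_uniformly_continuous) (simp_all add: Omega_def)
  then obtain r where r: "r > 0" "\<And>s t. s \<in> Omega \<Longrightarrow> t \<in> Omega \<Longrightarrow> \<bar>s - t\<bar> < r \<Longrightarrow> \<bar>Y s - Y t\<bar> < e"
    using e unfolding uniformly_continuous_on_def dist_real_def by meson
  have "\<forall>\<^sub>F N in sequentially. eps N < r" using order_tendstoD(2)[OF eps_tendsto r(1)] .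
  then show "\<forall>\<^sub>F N in sequentially. \<forall>x\<in>Omega. dist (interp N Y x) (Y x) < e"
    using eventually_gt_at_top[of "0::nat"]
  proof eventually_elim
    case (elim N)
    have N: "N > 0" using elim by simp
    show ?case
    proof
      fix x assume x: "x \<in> Omega"
      show "dist (interp N Y x) (Y x) < e"
      proof (cases "x = 1/2")
        case True
        show ?thesis unfolding True using interp_grid[OF N, of "int N" Y] N e unfolding grid_ends(2)[OF N] by simp
      next
        case False
        let ?i = "cell N x"
        let ?a = "grid N ?i" and ?b = "grid N (?i + 1)"
        have xO: "-1/2 \<le> x" "x \<le> 1/2" using x unfolding Omega_def by auto
        then have i: "?i \<in> cells N"
          using False by (intro cell_range[OF N]) linarith+
        have xi: "?a \<le> x" "x < ?b" using cell_bounds[OF N] by auto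
        have abO: "?a \<in> Omega" "?b \<in> Omega" using i by (intro grid_in_Omega[OF N]; simp)+
        have g1: "?b = ?a + eps N" by (simp add: grid_add)
        have mono: "Y s \<le> Y t" if "s \<in> Omega" "t \<in> Omega" "s \<le> t" for s t
          using primitive_less[OF p pos, of s t] that by (cases "s = t") (auto simp: Omega_def)
        have s0: "slope N Y 1 ?i \<ge> 0"
          unfolding slope_def using mono[OF abO] xi eps_pos[OF N] by simp
        have eq: "interp N Y x = Y ?a + slope N Y 1 ?i * (x - ?a)"
          using interp_eq[OF N i, of x Y] xi by simp
        have "slope N Y 1 ?i * (x - ?a) \<le> slope N Y 1 ?i * eps N"
          using s0 xi g1 by (intro mult_left_mono) auto
        then have up: "interp N Y x \<le> Y ?b" unfolding eq slope_times_eps[OF N] by simp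
        have low: "Y ?a \<le> interp N Y x" unfolding eq using s0 xi by simp
        have "\<bar>Y ?b - Y ?a\<bar> < e" using elim g1 eps_pos[OF N] by (intro r(2) abO) simp
        moreover have "Y ?a \<le> Y x" "Y x \<le> Y ?b" using xi by (intro mono abO x; simp)+
        ultimately show ?thesis using up low unfolding dist_real_def by linarith
      qed
    qed
  qed
qed

lemma integral_const_Omega: "integrable \<mu> (\<lambda>x. c)" "(LINT x|\<mu>. c) = (c :: real)"
proof -
  show "integrable \<mu> (\<lambda>x. c)"
    by (rule finite_measure.integrable_const[OF finite_measure_Omega])
  have "measure \<mu> Omega = 1" by (simp add: measure_def emeasure_Omega)
  then show "(LINT x|\<mu>. c) = c" by (simp only: lebesgue_integral_const space_Omega) simp
qed

section \<open>Flattening near the defect and diagonal selection\<close>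

lemma integrable_flatten:
  fixes h :: "real \<Rightarrow> real"
  assumes h: "integrable \<mu> h" and d: "0 < d" "d < 1/2"
  shows "integrable \<mu> (\<lambda>x. if \<bar>x\<bar> < d then c else h x)"
proof -
  have s: "{-d<..<d} \<in> sets \<mu>" "Omega - {-d<..<d} \<in> sets \<mu>"
    using d by (auto simp: sets_restrict_space_iff Omega_def)
  have "integrable \<mu> (\<lambda>x. h x * indicator (Omega - {-d<..<d}) x + c * indicator {-d<..<d} x)"
    using integrable_real_mult_indicator[OF s(2) h] integrable_real_mult_indicator[OF s(1) integral_const_Omega(1)]
    by (rule Bochner_Integration.integrable_add)
  then show ?thesis
    by (rule Bochner_Integration.integrable_cong[THEN iffD1, rotated 2]) (auto simp: indicator_def abs_less_iff)
qed

text \<open>Averaging the derivative over \<open>(-d, d)\<close> decouples the recovery sequence from the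
  defect, since no bound on the defect potential \<open>\<psi>1\<close> in terms of \<open>\<phi>1\<close> is available.\<close>

lemma flatten_primitive:
  assumes p: "primitive g y" and d: "0 < d" "d < 1/2"
  defines "m \<equiv> (y d - y (-d)) / (2 * d)"
  shows "primitive (\<lambda>x. if \<bar>x\<bar> < d then m else g x) (\<lambda>x. if \<bar>x\<bar> < d then y (-d) + m * (x + d) else y x)"
    (is "primitive ?g ?Y")
proof -
  have gi: "integrable \<mu> g" using primitiveD(1)[OF p] .
  have md: "m * (2 * d) = y d - y (-d)" using d by (simp add: m_def)
  have i: "integrable \<mu> ?g" by (rule integrable_flatten[OF gi d])
  have left: "(?g has_integral (?Y b - ?Y a)) {a..b}" if "-1/2 \<le> a" "a \<le> b" "b \<le> -d" for a b
  proof -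
    have "(g has_integral (y b - y a)) {a..b}" using that d by (intro primitiveD(2)[OF p]) auto
    then have "(?g has_integral (y b - y a)) {a..b}"
      by (rule has_integral_eq[rotated]) (use that in auto)
    moreover have "\<not> \<bar>a\<bar> < d" "\<not> \<bar>b\<bar> < d" using that d by linarith+
    ultimately show ?thesis by simp
  qed
  have right: "(?g has_integral (?Y b - ?Y a)) {a..b}" if "d \<le> a" "a \<le> b" "b \<le> 1/2" for a b
  proof -
    have "(g has_integral (y b - y a)) {a..b}" using that d by (intro primitiveD(2)[OF p]) auto
    then have "(?g has_integral (y b - y a)) {a..b}"
      by (rule has_integral_eq[rotated]) (use that in auto)
    moreover have "\<not> \<bar>a\<bar> < d" "\<not> \<bar>b\<bar> < d" using that d by linarith+
    ultimately show ?thesis by simp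
  qed
  have lin: "?Y x = y (-d) + m * (x + d)" if x: "-d \<le> x" "x \<le> d" for x
  proof (cases "\<bar>x\<bar> < d")
    case False
    then have "x = d \<or> x = -d" using x by (auto simp: abs_less_iff)
    then consider "x = d" | "x = -d" by (rule disjE)
    then show ?thesis using md by cases (simp_all add: algebra_simps)
  qed simp
  have mid: "(?g has_integral (?Y b - ?Y a)) {a..b}" if ab: "-d \<le> a" "a \<le> b" "b \<le> d" for a b
  proof -
    have "((\<lambda>x. m) has_integral (m * (b - a))) {a..b}"
      using has_integral_const_real[of m a b] ab by (simp add: mult.commute)
    then have "(?g has_integral (m * (b - a))) {a..b}"
      by (rule has_integral_spike[OF negligible_finite[of "{-d, d}"], rotated 2]) (use ab in auto)
    moreover have "?Y b - ?Y a = m * (b - a)"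
      using lin[of a] lin[of b] ab by (simp add: algebra_simps)
    ultimately show ?thesis by (simp only:)
  qed
  have comb: "(?g has_integral (?Y b - ?Y a)) {a..b}"
    if "(?g has_integral (?Y c - ?Y a)) {a..c}" "(?g has_integral (?Y b - ?Y c)) {c..b}" "a \<le> c" "c \<le> b" for a b c
    using has_integral_combine[OF that(3,4,1,2)] by simp
  have lm: "(?g has_integral (?Y b - ?Y a)) {a..b}" if "-1/2 \<le> a" "a \<le> b" "b \<le> d" for a b
  proof -
    consider "b \<le> -d" | "-d \<le> a" | "a \<le> -d" "-d \<le> b" by linarith
    then show ?thesis
    proof cases
      case 1 then show ?thesis using that by (intro left) auto
    next
      case 2 then show ?thesis using that by (intro mid) auto
    next
      case 3 then show ?thesis using that d by (intro comb[of "-d" a b] left mid) auto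
    qed
  qed
  have "(?g has_integral (?Y b - ?Y a)) {a..b}" if "-1/2 \<le> a" "a \<le> b" "b \<le> 1/2" for a b
  proof -
    consider "b \<le> d" | "d \<le> a" | "a \<le> d" "d \<le> b" by linarith
    then show ?thesis
    proof cases
      case 1 then show ?thesis using that by (intro lm) auto
    next
      case 2 then show ?thesis using that by (intro right) auto
    next
      case 3 then show ?thesis using that d by (intro comb[of d a b] lm right) auto
    qed
  qed
  with i show ?thesis unfolding primitive_def by blast
qed

lemma diagonal_sequence:
  fixes P :: "nat \<Rightarrow> nat \<Rightarrow> bool"
  assumes "\<And>k. \<forall>\<^sub>F N in sequentially. P k N"
  obtains \<kappa> where "\<forall>\<^sub>F N in sequentially. P (\<kappa> N) N" "filterlim \<kappa> at_top sequentially"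
proof -
  have "\<forall>k. \<exists>n. \<forall>N\<ge>n. P k N" using assms by (simp add: eventually_sequentially)
  then obtain n where n: "\<forall>k. \<forall>N\<ge>n k. P k N" by (rule choice[THEN exE])
  \<comment> \<open>The indices whose threshold has been passed at \<open>N\<close>; the bound
    \<open>k \<le> N\<close> keeps the set finite, and its largest element is the diagonal
    choice.\<close>
  define A where "A N = {k. k \<le> N \<and> n k \<le> N}" for N
  have fin: "finite (A N)" for N unfolding A_def by simp
  have "P (Max (A N)) N" if "N \<ge> n 0" for N
  proof -
    have "0 \<in> A N" using that by (simp add: A_def)
    then have "Max (A N) \<in> A N" using fin by (intro Max_in) auto
    then show ?thesis using n by (simp add: A_def)
  qed
  then have "\<forall>\<^sub>F N in sequentially. P (Max (A N)) N" by (auto simp: eventually_sequentially)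
  moreover have "filterlim (\<lambda>N. Max (A N)) at_top sequentially"
    unfolding filterlim_at_top
  proof
    fix k
    have "k \<le> Max (A N)" if "N \<ge> max k (n k)" for N
      using that fin by (intro Max_ge) (auto simp: A_def)
    then show "\<forall>\<^sub>F N in sequentially. k \<le> Max (A N)" unfolding eventually_sequentially by blast
  qed
  ultimately show thesis by (rule that)
qed

lemma slope_interp:
  assumes "N > 0" "i \<in> cells N"
  shows "slope N (interp N Y) 1 i = slope N Y 1 i"
  using assms interp_grid[OF assms(1), of i Y] interp_grid[OF assms(1), of "i + 1" Y] by (simp add: slope_def)

section \<open>The limsup inequality\<close>

context defect_model
begin

lemma finite_W_integral:
  assumes g: "g \<in> borel_measurable \<mu>" and K: "K \<ge> 0" "\<And>t. t > 0 \<Longrightarrow> W t \<ge> - K"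
    and fin: "W_integral K g \<noteq> \<infinity>"
  shows "AE x in \<mu>. g x > 0"
    and "integrable \<mu> (\<lambda>x. pos_part W (g x))"
    and "enn2ereal (W_integral K g)
      = ereal ((LINT x|\<mu>. pos_part W (g x)) + K)"
proof -
  let ?h = "\<lambda>x. e2ennreal (W_ext (g x) + ereal K)"
  let ?w = "\<lambda>x. pos_part W (g x)"
  have Wm: "(\<lambda>x. W_ext (g x)) \<in> borel_measurable \<mu>" by (rule W_ext_measurable_comp[OF g])
  then have hm: "?h \<in> borel_measurable \<mu>" by measurable
  have wm: "?w \<in> borel_measurable \<mu>" by (rule pos_part_measurable[OF W_cont g])
  show pos: "AE x in \<mu>. g x > 0"
    using nn_integral_noteq_infinite[OF hm fin]
  proof eventually_elim
    case (elim x)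
    then show ?case by (cases "g x > 0") (simp_all add: W_ext_def)
  qed
  have w0: "0 \<le> ?w x + K" for x
  proof (cases "g x > 0")
    case True
    then show ?thesis using K(2)[OF True] by (simp add: pos_part_simp)
  next
    case False
    then show ?thesis using K(1) by (simp add: pos_part_def)
  qed
  have eq: "(\<integral>\<^sup>+ x. ?h x \<partial>\<mu>) = (\<integral>\<^sup>+ x. ennreal (?w x + K) \<partial>\<mu>)"
  proof (rule nn_integral_cong_AE)
    show "AE x in \<mu>. ?h x = ennreal (?w x + K)"
      using pos by eventually_elim (simp add: W_ext_def pos_part_simp e2ennreal_ereal)
  qed
  have wK: "integrable \<mu> (\<lambda>x. ?w x + K)"
  proof (rule integrableI_nonneg)
    show "(\<lambda>x. ?w x + K) \<in> borel_measurable \<mu>" using wm by measurable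
    show "AE x in \<mu>. 0 \<le> ?w x + K" by (rule AE_I2) (rule w0)
    show "(\<integral>\<^sup>+ x. ennreal (?w x + K) \<partial>\<mu>) < \<infinity>" using fin unfolding eq by (simp add: less_top)
  qed
  have "integrable \<mu> (\<lambda>x. (?w x + K) - K)"
    by (rule Bochner_Integration.integrable_diff[OF wK integral_const_Omega(1)])
  then show wi: "integrable \<mu> ?w" by simp
  have "(\<integral>\<^sup>+ x. ennreal (?w x + K) \<partial>\<mu>) = ennreal (LINT x|\<mu>. ?w x + K)"
    by (rule nn_integral_eq_integral[OF wK]) (rule AE_I2, rule w0)
  moreover have "(LINT x|\<mu>. ?w x + K) = (LINT x|\<mu>. ?w x) + K"
    using Bochner_Integration.integral_add[OF wi integral_const_Omega(1)] by (simp only: integral_const_Omega(2))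
  moreover have "0 \<le> (LINT x|\<mu>. ?w x + K)" by (rule Bochner_Integration.integral_nonneg) (rule w0)
  ultimately show "enn2ereal (\<integral>\<^sup>+ x. ?h x \<partial>\<mu>) = ereal ((LINT x|\<mu>. ?w x) + K)"
    unfolding eq by simp
qed

text \<open>The inequality \<open>W_ge_F1\<close> bounds \<open>F1\<close> from above by a multiple
  of \<open>W\<close> plus a constant, and superlinearity bounds it from below; \<open>F2\<close> is
  then the difference of two integrable functions.\<close>

lemma potentials_integrable:
  assumes g: "g \<in> borel_measurable \<mu>"
    and w: "integrable \<mu> (\<lambda>x. pos_part W (g x))"
  shows "integrable \<mu> (\<lambda>x. pos_part F1 (g x))"
    and "integrable \<mu> (\<lambda>x. pos_part F2 (g x))"
proof -
  obtain K1 where K1: "\<forall>t>0. 0 * t - K1 \<le> F1 t" using superlinear(1)[of 0] by blast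
  show i1: "integrable \<mu> (\<lambda>x. pos_part F1 (g x))"
  proof (rule Bochner_Integration.integrable_bound)
    show "integrable \<mu> (\<lambda>x. \<bar>K1\<bar> + (\<bar>pos_part W (g x)\<bar> + \<bar>C\<bar>) / (1 - \<alpha>))"
      by (intro Bochner_Integration.integrable_add integrable_divide integrable_abs w integral_const_Omega)
    show "(\<lambda>x. pos_part F1 (g x)) \<in> borel_measurable \<mu>" by (rule pos_part_measurable[OF cont(1) g])
    have "\<bar>pos_part F1 t\<bar> \<le> \<bar>K1\<bar> + (\<bar>pos_part W t\<bar> + \<bar>C\<bar>) / (1 - \<alpha>)" for t
    proof (cases "t > 0")
      case True
      have "(1 - \<alpha>) * F1 t \<le> \<bar>W t\<bar> + \<bar>C\<bar>" using W_ge_F1[OF True] by linarith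
      then have "F1 t \<le> (\<bar>W t\<bar> + \<bar>C\<bar>) / (1 - \<alpha>)" using alpha by (simp add: pos_le_divide_eq mult.commute)
      moreover have "- \<bar>K1\<bar> \<le> F1 t" using K1[rule_format, OF True] by linarith
      moreover have "0 \<le> (\<bar>W t\<bar> + \<bar>C\<bar>) / (1 - \<alpha>)" using alpha by (intro divide_nonneg_nonneg) auto
      ultimately have "\<bar>F1 t\<bar> \<le> \<bar>K1\<bar> + (\<bar>W t\<bar> + \<bar>C\<bar>) / (1 - \<alpha>)" by linarith
      then show ?thesis using True by (simp add: pos_part_simp)
    next
      case False
      have "0 \<le> (\<bar>pos_part W t\<bar> + \<bar>C\<bar>) / (1 - \<alpha>)" using alpha by (intro divide_nonneg_nonneg) auto
      moreover have "pos_part F1 t = 0" using False by (simp add: pos_part_def)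
      ultimately show ?thesis by linarith
    qed
    then show "AE x in \<mu>. norm (pos_part F1 (g x)) \<le> norm (\<bar>K1\<bar> + (\<bar>pos_part W (g x)\<bar> + \<bar>C\<bar>) / (1 - \<alpha>))"
      by (intro AE_I2) (simp only: real_norm_def, meson abs_ge_self order_trans)
  qed
  have "integrable \<mu> (\<lambda>x. pos_part W (g x) - pos_part F1 (g x))"
    by (rule Bochner_Integration.integrable_diff[OF w i1])
  moreover have "pos_part W t - pos_part F1 t = pos_part F2 t" for t by (simp add: pos_part_def W_def)
  ultimately show "integrable \<mu> (\<lambda>x. pos_part F2 (g x))" by (simp only:)
qed

text \<open>An upper bound for \<open>F2\<close> is a lower bound for the nonnegative gap
  \<open>v\<close> between its affine majorant and \<open>F2\<close>. The affine part contributes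
  the same number to the sum and to the integral, so the liminf inequality for \<open>v\<close>
  becomes a limsup inequality for \<open>F2\<close>.\<close>

lemma second_neighbour_limsup:
  assumes p: "primitive g Y" and pos: "AE x in \<mu>. g x > 0"
    and int: "integrable \<mu> (\<lambda>x. pos_part F2 (g x))" and e: "e > 0"
  shows "\<forall>\<^sub>F N in sequentially.
    (\<Sum>i\<in>cells N. eps N * F2 ((diffq N (interp N Y) 1 i + diffq N (interp N Y) 1 (i + 1)) / 2))
      < (LINT x|\<mu>. pos_part F2 (g x)) + e"
proof -
  let ?I = "\<lambda>N. cells N"
  let ?l = "Y (1/2) - Y (-1/2)"
  define P where "P N = diffq N (interp N Y) 1" for N
  define D where "D N i = (P N i + P N (i + 1)) / 2" for N i
  obtain a b where ab: "\<And>t. t > 0 \<Longrightarrow> F2 t \<le> a + b * t" using F2_upper by blast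
  have sl: "slope N Y 1 i > 0" if "N > 0" "i \<in> ?I N" for N i
    by (rule primitive_slope_pos[OF p pos that])
  have PI: "P N i = slope N Y 1 i" if "N > 0" "i \<in> ?I N" for N i
    unfolding P_def using diffq_slope[OF that] slope_interp[OF that] by simp
  have Pp: "P N i > 0" if "N > 0" for N i
    unfolding P_def by (rule diffq_pos[OF that]) (use slope_interp[OF that] sl[OF that] in simp)
  have Dp: "D N i > 0" if "N > 0" for N i using Pp[OF that, of i] Pp[OF that, of "i + 1"] by (simp add: D_def)
  have Dsum: "(\<Sum>i\<in>?I N. eps N * D N i) = ?l" if N: "N > 0" for N
  proof -
    have per: "P N (int N) = P N (- int N)"
      unfolding P_def using diffq_periodic[OF N, of "interp N Y" 1 "- int N"] by simp
    have "(\<Sum>i\<in>?I N. P N (i + 1)) = (\<Sum>i\<in>?I N. P N i)"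
      using sum_shift_int[of "- int N" "int N - 1" "P N"] N per by simp
    then have "(\<Sum>i\<in>?I N. D N i) = (\<Sum>i\<in>?I N. P N i)"
      by (simp add: D_def sum_divide_distrib[symmetric] sum.distrib)
    then have "(\<Sum>i\<in>?I N. eps N * D N i) = (\<Sum>i\<in>?I N. eps N * P N i)"
      by (simp only: sum_distrib_left[symmetric])
    also have "\<dots> = (\<Sum>i\<in>?I N. Y (grid N (i + 1)) - Y (grid N i))"
      by (intro sum.cong refl) (simp add: PI[OF N] slope_times_eps[OF N, symmetric] mult.commute)
    also have "\<dots> = (\<Sum>i\<in>{- int N..<int N}. Y (grid N (i + 1)) - Y (grid N i))"
      by (rule sum.cong) auto
    also have "(\<Sum>i\<in>{- int N..<int N}. Y (grid N (i + 1)) - Y (grid N i)) = Y (grid N (int N)) - Y (grid N (- int N))"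
      by (rule sum_telescope_int) simp
    finally show ?thesis unfolding grid_ends[OF N] .
  qed
  define v where "v N i = a + b * D N i - F2 (D N i)" for N i
  have v0: "v N i \<ge> 0" if "N > 0" for N i using ab[OF Dp[OF that], of i] by (simp add: v_def)
  have vsum: "(\<Sum>i\<in>?I N. eps N * v N i) = a + b * ?l - (\<Sum>i\<in>?I N. eps N * F2 (D N i))" if N: "N > 0" for N
  proof -
    have "(\<Sum>i\<in>?I N. eps N * v N i) = (\<Sum>i\<in>?I N. eps N * a) + b * (\<Sum>i\<in>?I N. eps N * D N i) - (\<Sum>i\<in>?I N. eps N * F2 (D N i))"
      unfolding v_def sum_distrib_left sum.distrib[symmetric] sum_subtractf[symmetric]
      by (intro sum.cong refl) (simp add: algebra_simps)
    moreover have "(\<Sum>i\<in>?I N. eps N * a) = a" using N by (simp add: eps_def)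
    ultimately show ?thesis using Dsum[OF N] by simp
  qed
  let ?u = "\<lambda>x. a + b * g x - pos_part F2 (g x)"
  let ?J = "a + b * ?l - (LINT x|\<mu>. pos_part F2 (g x))"
  have bg: "integrable \<mu> (\<lambda>x. b * g x)" using primitiveD(1)[OF p] by (rule integrable_mult_right)
  have abg: "integrable \<mu> (\<lambda>x. a + b * g x)" by (rule Bochner_Integration.integrable_add[OF integral_const_Omega(1) bg])
  have ui: "integrable \<mu> ?u" by (rule Bochner_Integration.integrable_diff[OF abg int])
  have u0: "AE x in \<mu>. 0 \<le> ?u x"
    using pos by eventually_elim (use ab in \<open>simp add: pos_part_simp\<close>)
  have uJ: "(LINT x|\<mu>. ?u x) = ?J"
    unfolding Bochner_Integration.integral_diff[OF abg int] Bochner_Integration.integral_add[OF integral_const_Omega(1) bg]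
      integral_const_Omega(2) by (simp add: primitive_integral[OF p])
  have "ennreal ?J = (\<integral>\<^sup>+ x. ennreal (?u x) \<partial>\<mu>)"
    unfolding nn_integral_eq_integral[OF ui u0] uJ ..
  also have "\<dots> = (\<integral>\<^sup>+ x. liminf (\<lambda>N. ennreal (v N (cell N x))) \<partial>\<mu>)"
  proof (rule nn_integral_cong_AE)
    show "AE x in \<mu>. ennreal (?u x) = liminf (\<lambda>N. ennreal (v N (cell N x)))"
      using slope_tendsto[OF p, of 2, simplified] pos AE_Omega_interior
    proof eventually_elim
      case (elim x)
      \<comment> \<open>The last cell uses the periodic extension, where the quotient is not one of
        \<open>Y\<close>. A point left of 1/2 is eventually outside that cell.\<close>
      have "\<forall>\<^sub>F N in sequentially. grid N (cell N x + 1) < 1/2"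
        using elim by (intro order_tendstoD(2)[OF grid_cell_tendsto]) simp
      then have "\<forall>\<^sub>F N in sequentially. slope N Y 2 (cell N x) = D N (cell N x)"
        using eventually_gt_at_top[of "0::nat"]
      proof eventually_elim
        case (elim N)
        have N: "N > 0" using elim by simp
        have "grid N (cell N x + 1) < grid N (int N)" using elim grid_ends(2)[OF N] by simp
        then have "cell N x + 1 < int N" using grid_less[OF N] by simp
        moreover have "- int N \<le> cell N x" using cell_range[OF N, of x] \<open>-1/2 < x \<and> x < 1/2\<close> by simp
        ultimately have "cell N x \<in> ?I N" "cell N x + 1 \<in> ?I N" by auto
        then have "D N (cell N x) = (slope N Y 1 (cell N x) + slope N Y 1 (cell N x + 1)) / 2"
          by (simp add: D_def PI[OF N])
        then show ?case by (simp add: slope_def add_divide_distrib[symmetric] add.assoc)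
      qed
      with elim(1) have "(\<lambda>N. D N (cell N x)) \<longlonglongrightarrow> g x" by (rule Lim_transform_eventually)
      moreover have "isCont F2 (g x)" using cont(2) elim(2) by (simp add: continuous_on_eq_continuous_at)
      ultimately have "(\<lambda>N. v N (cell N x)) \<longlonglongrightarrow> a + b * g x - F2 (g x)"
        unfolding v_def by (intro tendsto_intros isCont_tendsto_compose[of _ F2])
      then have "(\<lambda>N. ennreal (v N (cell N x))) \<longlonglongrightarrow> ennreal (?u x)"
        using elim(2) by (intro tendsto_ennrealI) (simp add: pos_part_simp)
      from lim_imp_Liminf[OF _ this] show ?case by simp
    qed
  qed
  also have "\<dots> \<le> liminf (\<lambda>N. \<integral>\<^sup>+ x. ennreal (v N (cell N x)) \<partial>\<mu>)"
  proof (rule nn_integral_liminf)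
    show "(\<lambda>x. ennreal (v N (cell N x))) \<in> borel_measurable \<mu>" for N by measurable
  qed
  finally have lim: "ennreal ?J \<le> liminf (\<lambda>N. \<integral>\<^sup>+ x. ennreal (v N (cell N x)) \<partial>\<mu>)" .
  have vint: "(\<integral>\<^sup>+ x. ennreal (v N (cell N x)) \<partial>\<mu>) = ennreal (\<Sum>i\<in>?I N. eps N * v N i)" if N: "N > 0" for N
  proof -
    have e0: "eps N \<ge> 0" using eps_pos[OF N] by simp
    have "(\<integral>\<^sup>+ x. ennreal (v N (cell N x)) \<partial>\<mu>) = (\<Sum>i\<in>?I N. ennreal (v N i) * ennreal (eps N))"
      by (rule nn_integral_cell[OF N, of "\<lambda>i. ennreal (v N i)"])
    also have "\<dots> = (\<Sum>i\<in>?I N. ennreal (eps N * v N i))"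
      using v0[OF N] e0 by (intro sum.cong refl) (simp add: ennreal_mult mult.commute)
    also have "\<dots> = ennreal (\<Sum>i\<in>?I N. eps N * v N i)"
      using v0[OF N] e0 by (intro sum_ennreal) simp
    finally show ?thesis .
  qed
  have "\<forall>\<^sub>F N in sequentially. ?J - e < (\<Sum>i\<in>?I N. eps N * v N i)"
  \<comment> \<open>A negative bound would be truncated to 0 in \<open>ennreal\<close>; in that case
    nonnegativity of the sum suffices.\<close>
  proof (cases "?J - e < 0")
    case True
    have "0 \<le> (\<Sum>i\<in>?I N. eps N * v N i)" if "N > 0" for N
      using v0[OF that] eps_pos[OF that] by (intro sum_nonneg mult_nonneg_nonneg) auto
    then show ?thesis
      using True by (intro eventually_mono[OF eventually_gt_at_top[of "0::nat"]]) (meson less_le_trans)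
  next
    case False
    then have "ennreal (?J - e) < ennreal ?J" using e by (intro ennreal_lessI) auto
    then have "ennreal (?J - e) < liminf (\<lambda>N. \<integral>\<^sup>+ x. ennreal (v N (cell N x)) \<partial>\<mu>)"
      using lim by (rule less_le_trans)
    then have "\<forall>\<^sub>F N in sequentially. ennreal (?J - e) < (\<integral>\<^sup>+ x. ennreal (v N (cell N x)) \<partial>\<mu>)"
      by (rule less_LiminfD)
    then show ?thesis
      using eventually_gt_at_top[of "0::nat"]
    proof eventually_elim
      case (elim N)
      then have "ennreal (?J - e) < ennreal (\<Sum>i\<in>?I N. eps N * v N i)" using vint by simp
      then show ?case using False by (simp add: ennreal_less_iff)
    qed
  qed
  then show ?thesis
    using eventually_gt_at_top[of "0::nat"]
  proof eventually_elim
    case (elim N)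
    then have "?J - e < a + b * ?l - (\<Sum>i\<in>?I N. eps N * F2 (D N i))" using vsum by simp
    then show ?case unfolding D_def P_def by linarith
  qed
qed

text \<open>Jensen's inequality on (-d, d) through the tangent of \<open>W\<close> at
  \<open>m\<close>: the added linear term vanishes outside this interval, and its integral over
  \<open>Omega\<close> is zero because both derivatives have the same integral.\<close>

lemma flatten_W_integral_le:
  assumes g: "integrable \<mu> g" and gd: "integrable \<mu> (\<lambda>x. if \<bar>x\<bar> < d then m else g x)"
    and eq: "(LINT x|\<mu>. (if \<bar>x\<bar> < d then m else g x)) = (LINT x|\<mu>. g x)"
    and pos: "AE x in \<mu>. g x > 0" and m: "m > 0" and d: "0 < d" "d < 1/2"
    and w: "integrable \<mu> (\<lambda>x. pos_part W (g x))"
  shows "(LINT x|\<mu>. pos_part W (if \<bar>x\<bar> < d then m else g x)) \<le> (LINT x|\<mu>. pos_part W (g x))"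
proof -
  let ?g = "\<lambda>x. if \<bar>x\<bar> < d then m else g x"
  have dist: "pos_part W (?g x) = (if \<bar>x\<bar> < d then pos_part W m else pos_part W (g x))" for x by simp
  have wd: "integrable \<mu> (\<lambda>x. pos_part W (?g x))"
    unfolding dist by (rule integrable_flatten[OF w d])
  have df: "integrable \<mu> (\<lambda>x. W' m * (g x - ?g x))"
    by (rule integrable_mult_right[OF Bochner_Integration.integrable_diff[OF g gd]])
  have "(LINT x|\<mu>. pos_part W (?g x)) = (LINT x|\<mu>. pos_part W (?g x)) + (LINT x|\<mu>. W' m * (g x - ?g x))"
    using Bochner_Integration.integral_diff[OF g gd] eq by simp
  also have "\<dots> = (LINT x|\<mu>. pos_part W (?g x) + W' m * (g x - ?g x))"
    by (rule Bochner_Integration.integral_add[OF wd df, symmetric])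
  also have "\<dots> \<le> (LINT x|\<mu>. pos_part W (g x))"
  proof (rule integral_mono_AE[OF Bochner_Integration.integrable_add[OF wd df] w])
    show "AE x in \<mu>. pos_part W (?g x) + W' m * (g x - ?g x) \<le> pos_part W (g x)"
      using pos
    proof eventually_elim
      case (elim x)
      then show ?case using tangent[OF m elim] m by (simp add: pos_part_simp W_def)
    qed
  qed
  finally show ?thesis .
qed

end

context defect_model
begin

lemma recovery_energy:
  assumes p: "primitive g Y" and pos: "AE x in \<mu>. g x > 0"
    and int: "integrable \<mu> (\<lambda>x. pos_part F1 (g x))" "integrable \<mu> (\<lambda>x. pos_part F2 (g x))"
    and Y0: "Y (-1/2) = 0" "Y (1/2) = L" and e: "e > 0"
    and d: "d > 0" and m: "m > 0" and flat: "\<And>x. -d \<le> x \<Longrightarrow> x \<le> d \<Longrightarrow> Y x = c + m * x"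
  shows "\<forall>\<^sub>F N in sequentially. interp N Y \<in> admissible_eps N L \<and> F_eps N (interp N Y) \<le>
    ereal ((LINT x|\<mu>. pos_part F1 (g x)) + (LINT x|\<mu>. pos_part F2 (g x)) + force Y + e)"
proof -
  let ?I = "\<lambda>N. cells N"
  define P where "P N = diffq N (interp N Y) 1" for N
  \<comment> \<open>All slopes entering the defect terms equal \<open>m\<close> on a fine lattice,
    so the defect energy is this fixed number, and \<open>eps N\<close> times it tends to 0.\<close>
  define def_en where "def_en = (G2 m - F2 m) + (G1 m - F1 m) + (G1 m - F1 m) + (G2 m - F2 m)"
  have ev1: "\<forall>\<^sub>F N in sequentially. (\<Sum>i\<in>?I N. eps N * F2 ((P N i + P N (i + 1)) / 2)) < (LINT x|\<mu>. pos_part F2 (g x)) + e / 3"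
    unfolding P_def using e by (intro second_neighbour_limsup[OF p pos int(2)]) simp
  have "(\<lambda>N. eps N * energy_force L f N (interp N Y)) \<longlonglongrightarrow> force Y"
    unfolding force_def by (rule force_tendsto[OF f_cont interp_uniform_limit[OF p pos] primitive_continuous[OF p]])
  then have ev2: "\<forall>\<^sub>F N in sequentially. eps N * energy_force L f N (interp N Y) < force Y + e / 3"
    using e by (intro order_tendstoD(2)) auto
  have "(\<lambda>N. eps N * def_en) \<longlonglongrightarrow> 0" using tendsto_mult_left_zero[OF eps_tendsto] .
  then have ev3: "\<forall>\<^sub>F N in sequentially. eps N * def_en < e / 3"
    using e by (intro order_tendstoD(2)) auto
  \<comment> \<open>This puts the nodes from -2 to 2, the end points of the four exceptional slopes,
    into the region where \<open>Y\<close> is affine.\<close>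
  have ev4: "\<forall>\<^sub>F N in sequentially. eps N < d / 2"
    using d by (intro order_tendstoD(2)[OF eps_tendsto]) simp
  show ?thesis
    using ev1 ev2 ev3 ev4 eventually_ge_at_top[of "2::nat"]
  proof eventually_elim
    case (elim N)
    have N: "N > 0" using elim by simp
    have e0: "eps N > 0" using eps_pos[OF N] .
    have sl: "slope N Y 1 i > 0" if "i \<in> ?I N" for i
      by (rule primitive_slope_pos[OF p pos N that])
    have PI: "P N i = slope N Y 1 i" if "i \<in> ?I N" for i
      unfolding P_def using diffq_slope[OF N that] slope_interp[OF N that] by simp
    have adm: "interp N Y \<in> admissible_eps N L" by (rule interp_admissible[OF N Y0])
    have en: "F_eps N (interp N Y) = ereal (eps N * real_energy F1 F2 G1 G2 N (P N) + eps N * energy_force L f N (interp N Y))"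
      unfolding P_def by (rule F_eps_eq[OF N adm]) (use slope_interp[OF N] sl in simp)
    have node_flat: "Y (grid N i) = c + m * grid N i" if "i \<in> {-2..2}" for i
    proof (rule flat)
      have "of_int i * eps N \<le> 2 * eps N" "- 2 * eps N \<le> of_int i * eps N"
        using that e0 by (intro mult_right_mono; simp)+
      then show "-d \<le> grid N i" "grid N i \<le> d" using elim unfolding grid_def by linarith+
    qed
    have Pm: "P N i = m" if "i \<in> {-2, -1, 0, 1}" for i
    proof -
      have "i \<in> ?I N" using that elim by auto
      then have "P N i = slope N Y 1 i" by (rule PI)
      also have "\<dots> = m"
      proof -
        have i2: "i \<in> {-2..2}" "i + 1 \<in> {-2..2}" using that by auto
        have g1: "grid N (i + 1) = grid N i + eps N" by (simp add: grid_add)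
        have "Y (grid N (i + 1)) - Y (grid N i) = m * eps N"
          unfolding node_flat[OF i2(1)] node_flat[OF i2(2)] unfolding g1 by (simp add: algebra_simps)
        then show ?thesis using e0 by (simp add: slope_def)
      qed
      finally show ?thesis .
    qed
    have re: "real_energy F1 F2 G1 G2 N (P N) = (\<Sum>i\<in>?I N. F1 (P N i)) + (\<Sum>i\<in>?I N. F2 ((P N i + P N (i + 1)) / 2)) + def_en"
      unfolding real_energy_def def_en_def by (simp add: Pm sum.distrib)
    have "(\<Sum>i\<in>?I N. eps N * F1 (P N i)) = (\<Sum>i\<in>?I N. eps N * F1 (slope N Y 1 i))"
      by (intro sum.cong refl) (simp add: PI)
    also have "\<dots> \<le> (LINT x|\<mu>. pos_part F1 (g x))"
      by (rule jensen_cells[OF p pos int(1) F1_tangent N sl])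
    finally have s1: "(\<Sum>i\<in>?I N. eps N * F1 (P N i)) \<le> (LINT x|\<mu>. pos_part F1 (g x))" .
    have "eps N * real_energy F1 F2 G1 G2 N (P N)
        = (\<Sum>i\<in>?I N. eps N * F1 (P N i)) + (\<Sum>i\<in>?I N. eps N * F2 ((P N i + P N (i + 1)) / 2)) + eps N * def_en"
      unfolding re by (simp add: distrib_left sum_distrib_left)
    then show ?case using adm en s1 elim by simp
  qed
qed

lemma force_diff_le:
  assumes B: "\<And>x. x \<in> Omega \<Longrightarrow> \<bar>f x\<bar> \<le> B" and y: "continuous_on Omega y" "continuous_on Omega Y"
    and close: "\<And>x. x \<in> Omega \<Longrightarrow> \<bar>Y x - y x\<bar> \<le> w"
  shows "force Y \<le> force y + B * w"
proof -
  let ?u = "\<lambda>y x. f x * (y x - L * (x + 1/2))"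
  have B0: "B \<ge> 0" using B[of 0] by (force simp: Omega_def)
  have i: "integrable \<mu> (?u y)" "integrable \<mu> (?u Y)"
    by (intro continuous_integrable_Omega continuous_intros f_cont y)+
  have "force Y \<le> (LINT x|\<mu>. ?u y x + B * w)"
    unfolding force_def
  proof (rule integral_mono[OF i(2) Bochner_Integration.integrable_add[OF i(1) integral_const_Omega(1)]])
    fix x assume "x \<in> space \<mu>"
    then have x: "x \<in> Omega" by simp
    have "\<bar>f x * (Y x - y x)\<bar> \<le> B * w"
      unfolding abs_mult using B[OF x] close[OF x] B0 by (intro mult_mono) auto
    moreover have "?u Y x - ?u y x = f x * (Y x - y x)" by (simp add: algebra_simps)
    ultimately show "?u Y x \<le> ?u y x + B * w" by linarith
  qed
  also have "\<dots> = force y + B * w"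
    unfolding force_def Bochner_Integration.integral_add[OF i(1) integral_const_Omega(1)] integral_const_Omega(2) ..
  finally show ?thesis .
qed

text \<open>One tolerance governs both energy and uniform distance, so the diagonal argument has a
  single predicate to handle.\<close>

definition recovers :: "(real \<Rightarrow> real) \<Rightarrow> real \<Rightarrow> nat \<Rightarrow> (real \<Rightarrow> real) \<Rightarrow> bool" where
  "recovers y e N z \<longleftrightarrow> z \<in> admissible_eps N L \<and> F_eps N z \<le> F_0 y + ereal e \<and> (\<forall>x\<in>Omega. \<bar>z x - y x\<bar> \<le> e)"

text \<open>A single flattened function serves: it moves the limit by at most \<open>w\<close>, does
  not increase the integral of \<open>W\<close>, and is affine near the defect. Its interpolants
  then work for all large \<open>N\<close>.\<close>

lemma recovery_sequence:
  assumes y: "y \<in> admissible L" and fin: "F_0 y \<noteq> \<infinity>" and e: "e > 0"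
  shows "\<exists>Y. \<forall>\<^sub>F N in sequentially. recovers y e N (interp N Y)"
proof -
  note yp = admissible_primitive[OF y]
  define g where "g = weak_deriv y"
  have p: "primitive g y" and gm: "g \<in> borel_measurable \<mu>" using yp by (simp_all add: g_def)
  obtain K where K: "K \<ge> 0" "\<And>t. t > 0 \<Longrightarrow> W t \<ge> - K" using W_bounded_below by blast
  have F0: "F_0 y = enn2ereal (W_integral K g) + ereal (force y - K)"
    unfolding g_def by (rule F_0_eq[OF y K(1)]) (rule K(2))
  have fin': "W_integral K g \<noteq> \<infinity>"
  proof
    assume "W_integral K g = \<infinity>"
    then show False using fin unfolding F0 by simp
  qed
  have gpos: "AE x in \<mu>. g x > 0" and gW: "integrable \<mu> (\<lambda>x. pos_part W (g x))"
    and gI: "enn2ereal (W_integral K g) = ereal ((LINT x|\<mu>. pos_part W (g x)) + K)"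
    using finite_W_integral[OF gm K(1) _ fin'] K(2) by blast+
  have F0': "F_0 y = ereal ((LINT x|\<mu>. pos_part W (g x)) + force y)" unfolding F0 gI by simp
  obtain B where B0: "B \<ge> 0" and B: "\<And>x. x \<in> Omega \<Longrightarrow> \<bar>f x\<bar> \<le> B"
    by (rule continuous_bounded_Omega[OF f_cont]) (rule that; assumption)
  \<comment> \<open>Chosen so that \<open>w\<close> and \<open>B * w\<close> are both at most
    \<open>e / 2\<close>; they bound the change of the function and of the force term under
    flattening.\<close>
  define w where "w = e / 2 / (B + 1)"
  have w: "w > 0" "B * w \<le> e / 2" "w \<le> e / 2"
  proof -
    show "w > 0" unfolding w_def using e B0 by (intro divide_pos_pos) auto
    have cancel: "x / c * c = x" if "c \<noteq> 0" for x c :: real using that by simp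
    have "w * (B + 1) = e / 2" unfolding w_def by (rule cancel) (use B0 in simp)
    moreover have "w * (B + 1) = B * w + w" by (simp only: distrib_left mult_1_right mult.commute)
    ultimately have "B * w + w = e / 2" by (simp only:)
    moreover have "B * w \<ge> 0" using B0 \<open>w > 0\<close> by simp
    ultimately show "B * w \<le> e / 2" "w \<le> e / 2" using \<open>w > 0\<close> by linarith+
  qed
  have y_less: "y s < y t" if "-1/2 \<le> s" "s < t" "t \<le> 1/2" for s t
    by (rule primitive_less[OF p gpos that])
  \<comment> \<open>Since \<open>y\<close> is increasing, both \<open>y\<close> and its affine
    replacement stay between \<open>y (-d)\<close> and \<open>y d\<close> on the interval, so their
    distance is at most this increment.\<close>
  obtain d where d: "0 < d" "d < 1/2" "y d - y (-d) \<le> w"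
  proof -
    have "0 \<in> Omega" by (simp add: Omega_def)
    then obtain r where r: "r > 0" "\<And>x. x \<in> Omega \<Longrightarrow> \<bar>x\<bar> < r \<Longrightarrow> \<bar>y x - y 0\<bar> < w / 2"
      using yp(2)[unfolded continuous_on_iff, rule_format, OF \<open>0 \<in> Omega\<close>, of "w / 2"] w(1)
      by (auto simp: dist_real_def)
    define d where "d = min (r / 2) (1/4)"
    have "d > 0" "d < r" "d \<le> 1/4" using r(1) by (auto simp: d_def)
    moreover then have "\<bar>y d - y 0\<bar> < w / 2" "\<bar>y (-d) - y 0\<bar> < w / 2"
      by (intro r(2); simp add: Omega_def)+
    ultimately show thesis by (intro that[of d]) linarith+
  qed
  define m where "m = (y d - y (-d)) / (2 * d)"
  have md: "m * (2 * d) = y d - y (-d)" using d by (simp add: m_def)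
  have m: "m > 0" unfolding m_def using d y_less[of "-d" d] by simp
  define Y where "Y = (\<lambda>x. if \<bar>x\<bar> < d then y (-d) + m * (x + d) else y x)"
  define h where "h = (\<lambda>x. if \<bar>x\<bar> < d then m else g x)"
  have pY: "primitive h Y" unfolding h_def Y_def m_def by (rule flatten_primitive[OF p d(1,2)])
  have hpos: "AE x in \<mu>. h x > 0" using gpos by eventually_elim (simp add: h_def m)
  have Y0: "Y (-1/2) = 0" "Y (1/2) = L" using yp(3,4) d by (simp_all add: Y_def)
  have flat: "Y x = (y (-d) + m * d) + m * x" if x: "-d \<le> x" "x \<le> d" for x
  proof (cases "\<bar>x\<bar> < d")
    case False
    then have "x = d \<or> x = -d" using x by (auto simp: abs_less_iff)
    then show ?thesis using md d by (auto simp: Y_def algebra_simps)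
  qed (simp add: Y_def algebra_simps)
  have close: "\<bar>Y x - y x\<bar> \<le> w" if x: "x \<in> Omega" for x
  proof (cases "\<bar>x\<bar> < d")
    case True
    then have "0 \<le> m * (x + d)" "m * (x + d) \<le> m * (2 * d)" using m by (auto intro!: mult_left_mono)
    moreover have "y (-d) < y x" "y x < y d" using True d by (intro y_less; simp)+
    moreover have "Y x = y (-d) + m * (x + d)" using True by (simp add: Y_def)
    ultimately show ?thesis using md d(3) by linarith
  next
    case False
    then show ?thesis using w(1) by (simp add: Y_def)
  qed
  have hm: "h \<in> borel_measurable \<mu>" using primitiveD(1)[OF pY] by (rule borel_measurable_integrable)
  have hdist: "pos_part X (h x) = (if \<bar>x\<bar> < d then pos_part X m else pos_part X (g x))" for X x by (simp add: h_def)
  have hW: "integrable \<mu> (\<lambda>x. pos_part W (h x))"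
    unfolding hdist by (rule integrable_flatten[OF gW d(1,2)])
  note hF = potentials_integrable[OF hm hW]
  have "(LINT x|\<mu>. pos_part F1 (h x)) + (LINT x|\<mu>. pos_part F2 (h x)) = (LINT x|\<mu>. pos_part F1 (h x) + pos_part F2 (h x))"
    by (rule Bochner_Integration.integral_add[OF hF, symmetric])
  also have "\<dots> = (LINT x|\<mu>. pos_part W (h x))"
    by (rule Bochner_Integration.integral_cong) (simp_all add: pos_part_def W_def)
  also have "\<dots> \<le> (LINT x|\<mu>. pos_part W (g x))"
    unfolding h_def
  proof (rule flatten_W_integral_le[OF primitiveD(1)[OF p] _ _ gpos m d(1,2) gW])
    show "integrable \<mu> (\<lambda>x. if \<bar>x\<bar> < d then m else g x)" using primitiveD(1)[OF pY] unfolding h_def .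
    show "(LINT x|\<mu>. (if \<bar>x\<bar> < d then m else g x)) = (LINT x|\<mu>. g x)"
      using primitive_integral[OF pY] primitive_integral[OF p] Y0 yp(3,4) unfolding h_def by simp
  qed
  finally have J: "(LINT x|\<mu>. pos_part F1 (h x)) + (LINT x|\<mu>. pos_part F2 (h x)) \<le> (LINT x|\<mu>. pos_part W (g x))" .
  have fc: "force Y \<le> force y + B * w"
    by (rule force_diff_le[OF B yp(2) primitive_continuous[OF pY] close])
  have near: "\<forall>\<^sub>F N in sequentially. \<forall>x\<in>Omega. dist (interp N Y x) (Y x) < e / 2"
    using e by (intro uniform_limitD[OF interp_uniform_limit[OF pY hpos]]) simp
  have en: "\<forall>\<^sub>F N in sequentially. interp N Y \<in> admissible_eps N L \<and> F_eps N (interp N Y) \<le>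
      ereal ((LINT x|\<mu>. pos_part F1 (h x)) + (LINT x|\<mu>. pos_part F2 (h x)) + force Y + e / 2)"
    by (rule recovery_energy[OF pY hpos hF Y0 _ d(1) m]) (use e in simp, rule flat)
  have "\<forall>\<^sub>F N in sequentially. (interp N Y \<in> admissible_eps N L \<and> F_eps N (interp N Y) \<le>
      ereal ((LINT x|\<mu>. pos_part F1 (h x)) + (LINT x|\<mu>. pos_part F2 (h x)) + force Y + e / 2))
      \<and> (\<forall>x\<in>Omega. dist (interp N Y x) (Y x) < e / 2)"
    by (rule eventually_conj[OF en near])
  then have "\<forall>\<^sub>F N in sequentially. recovers y e N (interp N Y)"
  proof eventually_elim
    case (elim N)
    have "ereal ((LINT x|\<mu>. pos_part F1 (h x)) + (LINT x|\<mu>. pos_part F2 (h x)) + force Y + e / 2) \<le> F_0 y + ereal e"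
      unfolding F0' using J fc w(2) by simp
    moreover have "\<bar>interp N Y x - y x\<bar> \<le> e" if x: "x \<in> Omega" for x
    proof -
      have "\<bar>interp N Y x - Y x\<bar> < e / 2" using elim x by (auto simp: dist_real_def)
      then show ?thesis using close[OF x] w(3) by linarith
    qed
    ultimately show ?case using elim unfolding recovers_def by (auto intro: order_trans)
  qed
  then show ?thesis by blast
qed

theorem limsup_le_F_0:
  assumes y: "y \<in> admissible L"
  shows "\<exists>ys. (\<forall>N. ys N \<in> admissible L) \<and> L2_converges ys y \<and> limsup (\<lambda>N. F_eps N (ys N)) \<le> F_0 y"
proof (cases "F_0 y = \<infinity>")
  case True
  \<comment> \<open>With an infinite limit energy the constant sequence will do.\<close>
  then show ?thesis using y by (intro exI[of _ "\<lambda>_. y"]) (simp add: L2_converges_def)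
next
  case False
  note yp = admissible_primitive[OF y]
  let ?e = "\<lambda>k. 1 / real (Suc k)"
  have "\<forall>k. \<exists>Y. \<forall>\<^sub>F N in sequentially. recovers y (?e k) N (interp N Y)"
    by (intro allI recovery_sequence[OF y False]) simp
  then obtain Y where Y: "\<forall>k. \<forall>\<^sub>F N in sequentially. recovers y (?e k) N (interp N (Y k))"
    by (rule choice[THEN exE])
  define P where "P k N \<longleftrightarrow> recovers y (?e k) N (interp N (Y k))" for k N
  obtain \<kappa> where \<kappa>: "\<forall>\<^sub>F N in sequentially. P (\<kappa> N) N" "filterlim \<kappa> at_top sequentially"
    by (rule diagonal_sequence[of P]) (use Y in \<open>auto simp: P_def\<close>)
  have e0: "(\<lambda>N. ?e (\<kappa> N)) \<longlonglongrightarrow> 0"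
    using filterlim_compose[OF LIMSEQ_Suc[OF lim_1_over_n] \<kappa>(2)] .
  \<comment> \<open>The default \<open>y\<close> makes every member admissible, also at the early
    indices where the diagonal choice may fail.\<close>
  define ys where "ys N = (if P (\<kappa> N) N then interp N (Y (\<kappa> N)) else y)" for N
  have adm: "ys N \<in> admissible L" for N using y by (auto simp: ys_def P_def recovers_def admissible_eps_def)
  have "L2_converges ys y"
    unfolding L2_converges_def
  proof (rule tendsto_sandwich[OF _ _ tendsto_const e0])
    show "\<forall>\<^sub>F N in sequentially. 0 \<le> sqrt (LINT x|\<mu>. (ys N x - y x)\<^sup>2)"
      by (intro always_eventually allI real_sqrt_ge_zero Bochner_Integration.integral_nonneg) simp
    show "\<forall>\<^sub>F N in sequentially. sqrt (LINT x|\<mu>. (ys N x - y x)\<^sup>2) \<le> ?e (\<kappa> N)"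
      using \<kappa>(1)
    proof eventually_elim
      case (elim N)
      have "(LINT x|\<mu>. (ys N x - y x)\<^sup>2) \<le> (LINT x|\<mu>. (?e (\<kappa> N))\<^sup>2)"
      proof (rule integral_mono[OF _ integral_const_Omega(1)])
        show "integrable \<mu> (\<lambda>x. (ys N x - y x)\<^sup>2)"
          by (intro continuous_integrable_Omega continuous_intros admissible_primitive(2)[OF adm] yp(2))
        fix x assume "x \<in> space \<mu>"
        then have "\<bar>ys N x - y x\<bar> \<le> ?e (\<kappa> N)" using elim by (auto simp: ys_def P_def recovers_def)
        then show "(ys N x - y x)\<^sup>2 \<le> (?e (\<kappa> N))\<^sup>2" by (rule abs_le_square_iff[THEN iffD1, OF order_trans]) simp
      qed
      then show ?case unfolding integral_const_Omega(2) by (intro real_le_lsqrt) simp_all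
    qed
  qed
  moreover have "limsup (\<lambda>N. F_eps N (ys N)) \<le> F_0 y"
  proof -
    have "limsup (\<lambda>N. F_eps N (ys N)) \<le> limsup (\<lambda>N. F_0 y + ereal (?e (\<kappa> N)))"
      using \<kappa>(1) by (intro Limsup_mono) (auto elim!: eventually_mono simp: ys_def P_def recovers_def)
    also have "\<dots> = F_0 y"
    proof (rule lim_imp_Limsup)
      have "(\<lambda>N. F_0 y + ereal (?e (\<kappa> N))) \<longlonglongrightarrow> F_0 y + ereal 0"
        by (intro tendsto_add_ereal_general1 tendsto_const tendsto_ereal e0) simp
      then show "(\<lambda>N. F_0 y + ereal (?e (\<kappa> N))) \<longlonglongrightarrow> F_0 y" by (simp add: zero_ereal_def[symmetric])
    qed simp
    finally show ?thesis .
  qed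
  ultimately show ?thesis using adm by blast
qed

end

section \<open>Derivation of the assumptions on the potentials\<close>

text \<open>Second derivatives are local on an open set. This allows the functions obtained from
  extended-real potentials to be replaced by real ones that agree with them on the positive half
  line.\<close>

lemma deriv_deriv_eq:
  fixes g h :: "real \<Rightarrow> real"
  assumes S: "open S" and h: "\<And>x. x \<in> S \<Longrightarrow> (h has_real_derivative h' x) (at x)"
    and h': "\<And>x. x \<in> S \<Longrightarrow> (h' has_real_derivative h'' x) (at x)"
    and eq: "\<And>x. x \<in> S \<Longrightarrow> g x = h x" and x: "x \<in> S"
  shows "deriv (deriv g) x = h'' x"
proof (rule DERIV_imp_deriv)
  have d: "deriv g z = h' z" if z: "z \<in> S" for z
    by (rule DERIV_imp_deriv, rule has_field_derivative_transform_within_open[OF h[OF z] S z]) (simp add: eq)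
  show "(deriv g has_real_derivative h'' x) (at x)"
    by (rule has_field_derivative_transform_within_open[OF h'[OF x] S x]) (simp add: d)
qed

lemma C2_on_openE:
  assumes "C2_on S g" "open S"
  obtains g' g'' where "\<And>x. x \<in> S \<Longrightarrow> (g has_real_derivative g' x) (at x)"
    "\<And>x. x \<in> S \<Longrightarrow> (g' has_real_derivative g'' x) (at x)"
proof -
  from assms(1) obtain g' g'' where g: "\<forall>x\<in>S. (g has_real_derivative g' x) (at x within S)"
    "\<forall>x\<in>S. (g' has_real_derivative g'' x) (at x within S)"
    unfolding C2_on_def by blast
  have "at x within S = at x" if "x \<in> S" for x using at_within_open[OF that assms(2)] .
  then show thesis using g by (intro that[of g' g'']) auto
qed

lemma C2_on_continuous:
  assumes "C2_on S g"
  shows "continuous_on S g"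
proof -
  obtain g' where "\<forall>x\<in>S. (g has_real_derivative g' x) (at x within S)"
    using assms unfolding C2_on_def by blast
  then show ?thesis by (auto simp: continuous_on_eq_continuous_within intro: DERIV_continuous)
qed

text \<open>Subtracting \<open>l / 2 * x\<^sup>2\<close> leaves a function with nonnegative second
  derivative; its tangent inequality, rewritten for \<open>g\<close>, carries the quadratic
  term.\<close>

lemma uniformly_convex_above_parabola:
  fixes g :: "real \<Rightarrow> real"
  assumes g: "\<And>x. x > 0 \<Longrightarrow> (g has_real_derivative g' x) (at x)"
    "\<And>x. x > 0 \<Longrightarrow> (g' has_real_derivative g'' x) (at x)"
    and l: "\<And>x. x > 0 \<Longrightarrow> g'' x \<ge> l" and st: "s > 0" "t > 0"
  shows "g s + g' s * (t - s) + l / 2 * (t - s)\<^sup>2 \<le> g t"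
proof -
  define h where "h x = g x - l / 2 * x\<^sup>2" for x
  have h: "(h has_real_derivative (g' x - l * x)) (at x)" if "x > 0" for x
    unfolding h_def by (auto intro!: derivative_eq_intros g(1) that)
  have h': "((\<lambda>x. g' x - l * x) has_real_derivative (g'' x - l)) (at x)" if "x > 0" for x
    by (auto intro!: derivative_eq_intros g(2) that)
  have "convex_on {0<..} h"
    by (rule f''_ge0_imp_convex[where f' = "\<lambda>x. g' x - l * x" and f'' = "\<lambda>x. g'' x - l"])
      (use h h' l in auto)
  then have "h t - h s \<ge> (g' s - l * s) * (t - s)"
    using st by (intro convex_on_imp_above_tangent[of "{0<..}"] has_field_derivative_at_within[OF h])
      (auto simp: interior_open)
  moreover have "h t - h s = g t - g s - l / 2 * (t\<^sup>2 - s\<^sup>2)" by (simp add: h_def algebra_simps)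
  moreover have "(g' s - l * s) * (t - s) = g' s * (t - s) - l / 2 * (t\<^sup>2 - s\<^sup>2) + l / 2 * (t - s)\<^sup>2"
    by (simp add: power2_eq_square field_simps)
  ultimately show ?thesis by linarith
qed

lemma parabola_superlinear:
  fixes g :: "real \<Rightarrow> real"
  assumes l: "l > 0" and g: "\<And>t. t > 0 \<Longrightarrow> c + b * (t - 1) + l / 2 * (t - 1)\<^sup>2 \<le> g t"
  shows "\<exists>K. \<forall>t>0. B * t - K \<le> g t"
proof (intro exI allI impI)
  fix t :: real assume t: "t > 0"
  \<comment> \<open>Completing the square: the vertex offset \<open>(B - b) / l\<close> is where the
    parabola has slope \<open>B\<close>, and the constant left over determines the witness for
    \<open>K\<close>.\<close>
  have "0 \<le> l / 2 * (t - 1 - (B - b) / l)\<^sup>2" using l by simp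
  also have "\<dots> = l / 2 * (t - 1)\<^sup>2 - (B - b) * (t - 1) + (B - b)\<^sup>2 / (2 * l)"
    using l by (simp add: power2_eq_square field_simps)
  finally have "B * t - (B - c + (B - b)\<^sup>2 / (2 * l)) \<le> c + b * (t - 1) + l / 2 * (t - 1)\<^sup>2"
    by (simp add: algebra_simps)
  then show "B * t - (B - c + (B - b)\<^sup>2 / (2 * l)) \<le> g t" using g[OF t] by linarith
qed

lemma ereal_blowup_real_of_ereal:
  assumes fin: "\<And>t. t > 0 \<Longrightarrow> \<bar>\<phi> t\<bar> \<noteq> \<infinity>" and lim: "(\<phi> \<longlongrightarrow> \<infinity>) (at_right 0)"
  shows "filterlim (\<lambda>t::real. real_of_ereal (\<phi> t)) at_top (at_right 0)"
  unfolding filterlim_at_top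
proof
  fix Z
  have "\<forall>\<^sub>F t in at_right 0. ereal Z < \<phi> t" using lim by (simp add: tendsto_PInfty)
  then show "\<forall>\<^sub>F t in at_right 0. Z \<le> real_of_ereal (\<phi> t)"
    using eventually_at_right_less[of "0::real"]
  proof eventually_elim
    case (elim t)
    then show ?case using fin[of t] by (cases "\<phi> t") auto
  qed
qed

theorem mainTheorem1:
  fixes L l \<alpha> C :: real
    and \<phi>1 \<psi>1 :: "real \<Rightarrow> ereal"
    and \<phi>2 \<psi>2 f :: "real \<Rightarrow> real"
  assumes "L > 0" and "l > 0" and "0 < \<alpha>" and "\<alpha> < 1"
    and "\<forall>t>0. \<bar>\<phi>1 t\<bar> \<noteq> \<infinity>" and "\<forall>t>0. \<bar>\<psi>1 t\<bar> \<noteq> \<infinity>"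
    and "C2_on {0<..} (\<lambda>t. real_of_ereal (\<phi>1 t))" and "C2_on {0<..} \<phi>2"
    and "C2_on {0<..} (\<lambda>t. real_of_ereal (\<psi>1 t))" and "C2_on {0<..} \<psi>2"
    and "\<forall>t\<le>0. \<phi>1 t = \<infinity>" and "\<forall>t\<le>0. \<psi>1 t = \<infinity>"
    and "(\<phi>1 \<longlongrightarrow> \<infinity>) (at_right 0)" and "(\<psi>1 \<longlongrightarrow> \<infinity>) (at_right 0)"
    and "\<forall>t>0. deriv (deriv (\<lambda>s. real_of_ereal (\<phi>1 s))) t \<ge> l"
    and "\<forall>t>0. deriv (deriv (\<lambda>s. real_of_ereal (\<psi>1 s))) t \<ge> l"
    and "concave_on {0<..} \<phi>2" and "concave_on {0<..} \<psi>2"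
    and "\<forall>x>0. ereal (\<phi>2 x) \<ge> - ereal \<alpha> * \<phi>1 x + ereal C"
    and "\<forall>x>0. ereal (\<phi>2 x) \<ge> - ereal \<alpha> * \<psi>1 x + ereal C"
    and "\<forall>x>0. ereal (\<psi>2 x) \<ge> - ereal \<alpha> * \<phi>1 x + ereal C"
    and "\<forall>x>0. ereal (\<psi>2 x) \<ge> - ereal \<alpha> * \<psi>1 x + ereal C"
    and "\<forall>t>0. deriv (deriv (\<lambda>s. real_of_ereal (cauchy_born \<phi>1 \<phi>2 s))) t \<ge> l"
    and "C2_on Omega f"
  shows "gamma_converges (admissible L) L2_converges
           (discrete_functional L \<phi>1 \<phi>2 \<psi>1 \<psi>2 f)
           (limit_functional L \<phi>1 \<phi>2 f)"
proof -
  define F1 G1 where "F1 t = real_of_ereal (\<phi>1 t)" and "G1 t = real_of_ereal (\<psi>1 t)" for t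
  have F1: "\<phi>1 t = ereal (F1 t)" if "t > 0" for t
  proof -
    have "\<bar>\<phi>1 t\<bar> \<noteq> \<infinity>" by (rule assms(5)[rule_format, OF that])
    then show ?thesis unfolding F1_def by (rule ereal_real'[symmetric])
  qed
  have G1: "\<psi>1 t = ereal (G1 t)" if "t > 0" for t
  proof -
    have "\<bar>\<psi>1 t\<bar> \<noteq> \<infinity>" by (rule assms(6)[rule_format, OF that])
    then show ?thesis unfolding G1_def by (rule ereal_real'[symmetric])
  qed
  have C2: "C2_on {0<..} F1" "C2_on {0<..} \<phi>2" "C2_on {0<..} G1"
    unfolding F1_def[abs_def] G1_def[abs_def] by (fact assms)+
  obtain F1' F1'' where dF1: "\<And>x. x \<in> {0<..} \<Longrightarrow> (F1 has_real_derivative F1' x) (at x)"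
    "\<And>x. x \<in> {0<..} \<Longrightarrow> (F1' has_real_derivative F1'' x) (at x)"
    by (rule C2_on_openE[OF C2(1)]) auto
  obtain G1' G1'' where dG1: "\<And>x. x \<in> {0<..} \<Longrightarrow> (G1 has_real_derivative G1' x) (at x)"
    "\<And>x. x \<in> {0<..} \<Longrightarrow> (G1' has_real_derivative G1'' x) (at x)"
    by (rule C2_on_openE[OF C2(3)]) auto
  obtain F2' F2'' where dF2: "\<And>x. x \<in> {0<..} \<Longrightarrow> (\<phi>2 has_real_derivative F2' x) (at x)"
    "\<And>x. x \<in> {0<..} \<Longrightarrow> (F2' has_real_derivative F2'' x) (at x)"
    by (rule C2_on_openE[OF C2(2)]) auto
  have F1l: "F1'' t \<ge> l" if "t > 0" for t
  proof -
    have "deriv (deriv (\<lambda>s. real_of_ereal (\<phi>1 s))) t = F1'' t"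
      by (rule deriv_deriv_eq[of "{0<..}", OF _ dF1]) (use that in \<open>auto simp: F1_def\<close>)
    then show ?thesis using assms(15) that by auto
  qed
  have G1l: "G1'' t \<ge> l" if "t > 0" for t
  proof -
    have "deriv (deriv (\<lambda>s. real_of_ereal (\<psi>1 s))) t = G1'' t"
      by (rule deriv_deriv_eq[of "{0<..}", OF _ dG1]) (use that in \<open>auto simp: G1_def\<close>)
    then show ?thesis using assms(16) that by auto
  qed
  have Wl: "F1'' t + F2'' t \<ge> l" if "t > 0" for t
  proof -
    have "deriv (deriv (\<lambda>s. real_of_ereal (cauchy_born \<phi>1 \<phi>2 s))) t = F1'' t + F2'' t"
      by (rule deriv_deriv_eq[of "{0<..}" "\<lambda>s. F1 s + \<phi>2 s" "\<lambda>s. F1' s + F2' s"])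
        (use that in \<open>auto intro!: DERIV_add dF1 dF2 simp: cauchy_born_def F1\<close>)
    then show ?thesis using assms(23) that by auto
  qed
  have pF1: "F1 s + F1' s * (t - s) + l / 2 * (t - s)\<^sup>2 \<le> F1 t" if "s > 0" "t > 0" for s t
    by (rule uniformly_convex_above_parabola[of F1 F1' F1'']) (use that dF1 F1l in auto)
  have pG1: "G1 s + G1' s * (t - s) + l / 2 * (t - s)\<^sup>2 \<le> G1 t" if "s > 0" "t > 0" for s t
    by (rule uniformly_convex_above_parabola[of G1 G1' G1'']) (use that dG1 G1l in auto)
  have pW: "F1 s + \<phi>2 s + (F1' s + F2' s) * (t - s) + l / 2 * (t - s)\<^sup>2 \<le> F1 t + \<phi>2 t" if "s > 0" "t > 0" for s t
    by (rule uniformly_convex_above_parabola[of "\<lambda>s. F1 s + \<phi>2 s" "\<lambda>s. F1' s + F2' s" "\<lambda>s. F1'' s + F2'' s"])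
      (use that Wl in \<open>auto intro!: DERIV_add dF1 dF2\<close>)
  have sq: "l / 2 * (t - s)\<^sup>2 \<ge> 0" for s t using assms(2) by simp
  interpret M: defect_model F1 \<phi>2 G1 \<psi>2 "\<lambda>s. F1' s + F2' s" \<alpha> C L f \<phi>1 \<psi>1
  proof
    show "0 < \<alpha>" "\<alpha> < 1" "concave_on {0<..} \<phi>2" "concave_on {0<..} \<psi>2" by fact+
    show "\<phi>2 t \<ge> - \<alpha> * F1 t + C" "\<phi>2 t \<ge> - \<alpha> * G1 t + C" "\<psi>2 t \<ge> - \<alpha> * F1 t + C" "\<psi>2 t \<ge> - \<alpha> * G1 t + C"
      if "t > 0" for t
      using assms(19-22)[rule_format, OF that] F1[OF that] G1[OF that] by simp_all
    show "\<exists>K. \<forall>t>0. B * t - K \<le> F1 t" "\<exists>K. \<forall>t>0. B * t - K \<le> G1 t" for B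
      by (rule parabola_superlinear[OF assms(2) pF1[of 1]] parabola_superlinear[OF assms(2) pG1[of 1]]; simp)+
    show "continuous_on {0<..} F1" "continuous_on {0<..} \<phi>2"
      by (intro C2_on_continuous C2)+
    show "F1 s + \<phi>2 s + (F1' s + F2' s) * (t - s) \<le> F1 t + \<phi>2 t" if "s > 0" "t > 0" for s t
      using pW[OF that] sq[of t s] by linarith
    show "\<exists>b. \<forall>t>0. F1 s + b * (t - s) \<le> F1 t" if "s > 0" for s
    proof (intro exI allI impI)
      fix t :: real assume "t > 0"
      then show "F1 s + F1' s * (t - s) \<le> F1 t" using pF1[OF that, of t] sq[of t s] by linarith
    qed
    show "\<exists>a b. \<forall>t>0. \<phi>2 t \<le> a + b * t"
    proof (intro exI allI impI)
      fix t :: real assume t: "t > 0"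
      \<comment> \<open>The tangent of the concave \<phi>2 at 1, a point chosen only for
        definiteness, is the affine majorant.\<close>
      have "- \<phi>2 t - - \<phi>2 1 \<ge> - F2' 1 * (t - 1)"
      proof (rule convex_on_imp_above_tangent[of "{0<..}"])
        show "convex_on {0<..} (\<lambda>t. - \<phi>2 t)" using assms(17) unfolding concave_on_def .
        show "((\<lambda>t. - \<phi>2 t) has_real_derivative - F2' 1) (at 1 within {0<..})"
          by (rule has_field_derivative_at_within[OF DERIV_minus[OF dF2(1)]]) simp
      qed (use t in \<open>auto simp: interior_open\<close>)
      then show "\<phi>2 t \<le> (\<phi>2 1 - F2' 1) + F2' 1 * t" by (simp add: algebra_simps)
    qed
    show "filterlim F1 at_top (at_right 0)"
      unfolding F1_def[abs_def] using assms(5) by (intro ereal_blowup_real_of_ereal assms(13)) auto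
    show "continuous_on Omega f" by (rule C2_on_continuous) fact
    show "\<phi>1 t = ereal (F1 t)" if "t > 0" for t by (rule F1[OF that])
    show "\<phi>1 t = \<infinity>" if "t \<le> 0" for t using assms(11) that by blast
    show "\<psi>1 t = ereal (G1 t)" if "t > 0" for t by (rule G1[OF that])
  qed
  show ?thesis
    unfolding gamma_converges_def using M.F_0_le_liminf M.limsup_le_F_0 by blast
qed

end
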